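(* Let $n$ be a positive integer and suppose that $A(z)=P_1(z)e^{\zeta_1z^n}+P_2(z)e^{\zeta_2z^n}+Q(z)$, where $P_1\not\equiv0$, $P_2\not\equiv 0$ and $Q$ are polynomials, and $\zeta_1>0$ and $\zeta_2<0$ are real. Then every nontrivial solution $f$ of $f''+A(z)f=0$ satisfies $\lambda(f)=\infty$.
   Context: $\lambda(f)$ denotes the exponent of convergence of the zeros of $f$. *)

theory Defs
  imports "HOL-Complex_Analysis.Complex_Analysis"
begin

text \<open>
  The exponent of convergence of the zeros of an entire function \<open>f \<noteq> 0\<close>: the infimum of all
  \<open>s > 0\<close> for which the series of \<open>\<bar>z\<bar>\<^sup>-\<^sup>s\<close> over the nonzero zeros \<open>z\<close> of \<open>f\<close>, repeated according
  to multiplicity, converges.  It is extended-real valued: it is \<open>\<infinity>\<close> (the infimum of the empty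
  set) if no such \<open>s\<close> exists.
\<close>

definition zeros_convergence_exponent :: "(complex \<Rightarrow> complex) \<Rightarrow> ereal" where
  "zeros_convergence_exponent f =
     Inf {ereal s | s::real. s > 0 \<and>
       (\<lambda>z. of_int (zorder f z) * norm z powr (- s)) summable_on {z. f z = 0 \<and> z \<noteq> 0}}"

end

theory Submission
  imports Defs
begin

text \<open>
  Suppose \<open>\<lambda>(f) < \<infinity>\<close>. All zeros of \<open>f\<close> are simple, so \<open>f'/f = w + h\<close> with \<open>w\<close> entire and
  \<open>h = H'/H\<close> for a canonical product \<open>H\<close> of finite order. Away from the zeros, \<open>h\<close> grows only
  polynomially, and the Riccati equation \<open>F' + F\<^sup>2 + A = 0\<close> for \<open>F = f'/f\<close> bounds \<open>F\<close> in terms of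
  \<open>A\<close> (\<open>riccati_bound\<close>), so \<open>w\<close> has finite order too. On rays where the exponential with coefficient
  \<open>P\<^sub>j\<close> dominates, \<open>w\<close> equals \<open>\<plusminus>\<i> * y\<^sub>j\<close> with \<open>y\<^sub>j = sqrt (P\<^sub>j * exp (\<zeta>\<^sub>j * z ^ n))\<close> up to
  polynomially bounded terms. Hence the second order operator \<open>V\<close> with polynomial coefficients that
  annihilates \<open>y\<^sub>1\<close> and \<open>y\<^sub>2\<close> maps \<open>w\<close> to a function that is polynomially bounded on a dense set
  of rays, thus by Phragmen-Lindelof to a polynomial \<open>R\<close>. Let the polynomial \<open>c\<close> solve \<open>V c = R\<close> up
  to lower order terms. Then on every such ray \<open>w\<close> is \<open>\<plusminus>\<i> * y\<^sub>j + c\<close> up to a vanishing error,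
  with the same \<open>c\<close> for all rays, and the Riccati equation yields
  \<open>h + c \<sim> - n * \<zeta>\<^sub>j * z ^ (n - 1) / 4\<close>. As \<open>\<zeta>\<^sub>1\<close> and \<open>\<zeta>\<^sub>2\<close> have opposite signs,
  \<open>H * exp (\<integral> c)\<close> tends to 0 along all these rays, so it is a polynomial by Phragmen-Lindelof again,
  and therefore 0, which is absurd.
\<close>

text \<open>The limit \<open>- n * \<zeta> * z ^ (n - 1) / 4\<close> is the WKB amplitude: to
  leading order \<open>H * exp (\<integral> c)\<close> behaves like the power -1/4 of the dominant
  exponential, so it decays exactly where that exponential grows. Since \<open>\<zeta>1\<close> and
  \<open>\<zeta>2\<close> have opposite signs, one of them grows in every direction except the
  finitely many with \<open>cos (n * \<theta>) = 0\<close>. The obstacle is that \<open>w\<close> is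
  one entire function imitating different functions in neighbouring sectors, with a sign that may
  depend on the ray and square roots that need not be single valued. A linear operator absorbs all
  of this: it kills both signs, and its coefficients can be polynomials because
  \<open>y' / y\<close> is rational. Its value on \<open>w\<close> is one polynomial for the whole
  plane, hence one \<open>c\<close>. On a ray the operator splits into two first order factors.
  Errors of one factor decay; those of the other would grow exponentially, which polynomial bounds
  forbid. Zeros of \<open>f\<close> may lie near given rays, so bounds are available only on a dense
  set of rays; this still suffices, because finitely many sectors bounded by such rays cover the
  plane.\<close>

text \<open>
  The quantity \<open>(e - \<bar>z - z0\<bar>) * \<bar>F z\<bar>\<close> is maximal at some \<open>z1\<close>; around \<open>z1\<close> the function \<open>F\<close> is at
  most twice as large as at \<open>z1\<close>, so Cauchy's inequality bounds \<open>F'\<close> by \<open>F\<close> there.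
\<close>

lemma riccati_bound:
  fixes F :: "complex \<Rightarrow> complex"
  assumes hol: "F holomorphic_on ball z0 d" and d: "d > 0"
    and nonneg: "a \<ge> 0" "b \<ge> 0" "M \<ge> 0"
    and ineq: "\<And>z. z \<in> ball z0 d \<Longrightarrow> norm (F z) ^ 2 \<le> a * norm (deriv F z) + b * norm (F z) + M ^ 2"
  shows "norm (F z0) \<le> 4 * a / d + b + M"
proof -
  have main: "e * norm (F z0) \<le> 4 * a + (b + M) * d" if e: "0 < e" "e < d" for e
  proof -
    define \<phi> where "\<phi> z = (e - norm (z - z0)) * norm (F z)" for z
    have sub: "cball z0 e \<subseteq> ball z0 d"
      using e by auto
    have "continuous_on (cball z0 e) F"
      using hol sub holomorphic_on_imp_continuous_on holomorphic_on_subset by blast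
    hence "continuous_on (cball z0 e) \<phi>"
      unfolding \<phi>_def by (intro continuous_intros)
    then obtain z1 where z1: "z1 \<in> cball z0 e" and max: "\<And>z. z \<in> cball z0 e \<Longrightarrow> \<phi> z \<le> \<phi> z1"
      using continuous_attains_sup[of "cball z0 e" \<phi>] e by auto
    have z0_le: "e * norm (F z0) \<le> \<phi> z1"
      using max[of z0] e by (simp add: \<phi>_def)
    define t where "t = e - norm (z1 - z0)"
    have t: "0 \<le> t" "t \<le> e"
      using z1 by (auto simp: t_def dist_norm norm_minus_commute)
    show ?thesis
    proof (cases "t = 0")
      case True
      hence "\<phi> z1 = 0"
        by (simp add: \<phi>_def t_def)
      hence "e * norm (F z0) \<le> 0"
        using z0_le by simp
      also have "0 \<le> 4 * a + (b + M) * d"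
        using nonneg d by simp
      finally show ?thesis .
    next
      case False
      with t have tpos: "t > 0" by simp
      have sub2: "cball z1 (t / 2) \<subseteq> cball z0 e"
      proof
        fix z assume "z \<in> cball z1 (t / 2)"
        hence "dist z1 z \<le> t" using tpos by auto
        thus "z \<in> cball z0 e"
          using dist_triangle[of z0 z z1] unfolding t_def
          by (auto simp: dist_norm norm_minus_commute)
      qed
      have bd: "norm (F z) \<le> 2 * norm (F z1)" if "norm (z1 - z) = t / 2" for z
      proof -
        have "\<phi> z \<le> \<phi> z1"
          using that sub2 by (intro max) (auto simp: dist_norm)
        moreover have "e - norm (z - z0) \<ge> t / 2"
        proof -
          have "norm (z - z0) \<le> norm (z - z1) + norm (z1 - z0)"
            using norm_triangle_ineq[of "z - z1" "z1 - z0"] by simp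
          moreover have "norm (z - z1) = t / 2" using that by (simp add: norm_minus_commute)
          moreover have "norm (z1 - z0) = e - t" by (simp add: t_def)
          ultimately show ?thesis by simp
        qed
        hence "t / 2 * norm (F z) \<le> \<phi> z"
          unfolding \<phi>_def by (intro mult_right_mono) auto
        ultimately have "t / 2 * norm (F z) \<le> t * norm (F z1)"
          unfolding \<phi>_def t_def by simp
        thus ?thesis using tpos by (simp add: field_simps)
      qed
      have "norm ((deriv ^^ 1) F z1) \<le> fact 1 * (2 * norm (F z1)) / (t / 2) ^ 1"
      proof (rule Cauchy_inequality)
        show "F holomorphic_on ball z1 (t / 2)"
          using hol sub sub2 by (meson ball_subset_cball holomorphic_on_subset order_trans)
        show "continuous_on (cball z1 (t / 2)) F"
          using hol sub sub2
          by (meson holomorphic_on_subset order_trans holomorphic_on_imp_continuous_on)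
      qed (use tpos bd in auto)
      hence der: "norm (deriv F z1) \<le> 4 * norm (F z1) / t"
        by simp
      define x where "x = norm (F z1)"
      have x0: "x \<ge> 0" by (simp add: x_def)
      have "z1 \<in> ball z0 d" using z1 sub by blast
      from ineq[OF this] have "x ^ 2 \<le> a * norm (deriv F z1) + b * x + M ^ 2"
        by (simp add: x_def)
      also have "a * norm (deriv F z1) \<le> a * (4 * x / t)"
        using der nonneg by (intro mult_left_mono) (auto simp: x_def)
      finally have q: "x ^ 2 \<le> (4 * a / t + b) * x + M ^ 2"
        by (simp add: algebra_simps)
      have "x \<le> 4 * a / t + b + M"
      proof (rule ccontr)
        define y where "y = 4 * a / t + b"
        have y0: "y \<ge> 0" using nonneg tpos by (simp add: y_def)
        assume "\<not> ?thesis"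
        hence x: "x > y + M" by (simp add: y_def)
        have "x ^ 2 = y * x + (x - y) * x"
          by (simp add: algebra_simps power2_eq_square)
        moreover have "(x - y) * x > M ^ 2"
          unfolding power2_eq_square using x y0 nonneg
          by (intro mult_strict_mono') auto
        ultimately show False using q by (simp add: y_def)
      qed
      hence "t * x \<le> t * (4 * a / t + b + M)"
        using tpos by (intro mult_left_mono) auto
      also have "\<dots> = 4 * a + (b + M) * t"
        using tpos by (simp add: field_simps)
      also have "\<dots> \<le> 4 * a + (b + M) * d"
        using t e nonneg by (intro add_left_mono mult_left_mono) auto
      finally show ?thesis
        using z0_le unfolding \<phi>_def t_def x_def by simp
    qed
  qed
  \<comment> \<open>The maximum needs a closed disc while \<open>F\<close> is given on the open one;
    hence radii \<open>e < d\<close> and this limit.\<close>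
  have "((\<lambda>e. e * norm (F z0)) \<longlongrightarrow> d * norm (F z0)) (at_left d)"
    by (intro tendsto_intros)
  moreover have "\<forall>\<^sub>F e in at_left d. e * norm (F z0) \<le> 4 * a + (b + M) * d"
    using eventually_at_left_real[OF d] by eventually_elim (use main in auto)
  ultimately have "d * norm (F z0) \<le> 4 * a + (b + M) * d"
    by (intro tendsto_upperbound[of _ _ "at_left d"]) auto
  thus ?thesis using d by (simp add: field_simps)
qed

section \<open>Points off small intervals, and Phragmen-Lindelof in a half strip\<close>

text \<open>A measure argument: the excluded intervals have total length at most
  \<open>2 * \<eta> * infsum c Z\<close>, which is less than \<open>L\<close>, so they cannot cover.
  One \<open>\<eta>\<close> serves all \<open>u\<close> and \<open>X\<close>; thus the same radii
  work at every location and for every real coordinate of the zeros.\<close>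

lemma exists_avoiding_point:
  fixes c :: "'a \<Rightarrow> real"
  assumes summable: "c summable_on Z" and pos: "\<And>a. a \<in> Z \<Longrightarrow> c a > 0" and L: "L > 0"
  obtains \<eta> where "\<eta> > 0" "\<eta> \<le> 1"
    "\<And>u X. \<exists>x\<in>{u..u+L}. \<forall>a\<in>Z. \<eta> * c a \<le> \<bar>x - X a\<bar>"
proof -
  define S where "S = infsum c Z"
  have S0: "S \<ge> 0"
    unfolding S_def by (intro infsum_nonneg) (use pos in force)
  \<comment> \<open>Gives \<open>2 * \<eta> * S < L\<close>; the summand 1 keeps the denominator
    positive when \<open>S = 0\<close>.\<close>
  define \<eta> where "\<eta> = min 1 (L / (4 * (S + 1)))"
  have "\<eta> \<le> L / (4 * (S + 1))"
    by (simp add: \<eta>_def)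
  hence "\<eta> * (4 * (S + 1)) \<le> L"
    using S0 by (subst (asm) pos_le_divide_eq) auto
  hence \<eta>: "\<eta> > 0" "\<eta> \<le> 1" "4 * \<eta> * (S + 1) \<le> L"
    using L S0 by (auto simp: \<eta>_def algebra_simps)
  have "\<exists>x\<in>{u..u+L}. \<forall>a\<in>Z. \<eta> * c a \<le> \<bar>x - X a\<bar>" for u and X :: "'a \<Rightarrow> real"
  proof (rule ccontr)
    assume neg: "\<not> ?thesis"
    have cover: "{u..u+L} \<subseteq> (\<Union>a\<in>Z. ball (X a) (\<eta> * c a))"
    proof
      fix x assume "x \<in> {u..u+L}"
      with neg obtain a where "a \<in> Z" "\<bar>x - X a\<bar> < \<eta> * c a"
        by force
      thus "x \<in> (\<Union>a\<in>Z. ball (X a) (\<eta> * c a))"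
        by (auto simp: dist_real_def abs_minus_commute intro!: bexI[of _ a])
    qed
    obtain D where D: "D \<subseteq> Z" "finite D" "{u..u+L} \<subseteq> (\<Union>a\<in>D. ball (X a) (\<eta> * c a))"
      by (rule compactE_image[OF compact_Icc _ cover]) auto
    have fin: "emeasure lborel (\<Union>a\<in>D. ball (X a) (\<eta> * c a)) \<le> (\<Sum>a\<in>D. emeasure lborel (ball (X a) (\<eta> * c a)))"
      by (rule emeasure_subadditive_finite) (use D in auto)
    have "ennreal L = emeasure lborel {u..u+L}"
      using L by simp
    also have "\<dots> \<le> emeasure lborel (\<Union>a\<in>D. ball (X a) (\<eta> * c a))"
      using D by (intro emeasure_mono) auto
    also note fin
    also have "(\<Sum>a\<in>D. emeasure lborel (ball (X a) (\<eta> * c a))) = (\<Sum>a\<in>D. ennreal (2 * \<eta> * c a))"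
    proof (rule sum.cong)
      fix a assume "a \<in> D"
      hence "c a > 0" using D pos by auto
      thus "emeasure lborel (ball (X a) (\<eta> * c a)) = ennreal (2 * \<eta> * c a)"
        using \<eta> by (simp add: ball_eq_greaterThanLessThan)
    qed auto
    also have "\<dots> = ennreal (\<Sum>a\<in>D. 2 * \<eta> * c a)"
      by (intro sum_ennreal) (use D pos \<eta> in \<open>force intro!: mult_nonneg_nonneg\<close>)
    finally have "L \<le> (\<Sum>a\<in>D. 2 * \<eta> * c a)"
      using L by (subst (asm) ennreal_le_iff) (use D pos \<eta> in \<open>force intro!: sum_nonneg mult_nonneg_nonneg\<close>)+
    also have "\<dots> = 2 * \<eta> * (\<Sum>a\<in>D. c a)"
      by (simp add: sum_distrib_left)
    also have "\<dots> \<le> 2 * \<eta> * S"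
      unfolding S_def using D \<eta> summable pos
      by (intro mult_left_mono finite_sum_le_infsum) (auto intro: less_imp_le)
    also have "\<dots> < 4 * \<eta> * (S + 1)"
      using \<eta> S0 by (auto simp: algebra_simps add_pos_nonneg)
    finally show False using \<eta> by linarith
  qed
  thus ?thesis using that \<eta> by blast
qed

text \<open>The factor \<open>exp (- \<epsilon> * exp (M * (z - \<i> * y0)))\<close> beats growth of
  exponent \<open>m < M\<close>, because \<open>M * \<alpha> < pi / 2\<close> keeps the cosine in
  its exponent above \<open>k > 0\<close> on the whole strip. The maximum principle on a long
  rectangle gives a bound independent of \<open>\<epsilon>\<close>, which then tends to 0. The 1 in
  \<open>max B 1\<close> bounds the right edge.\<close>

lemma phragmen_lindelof_half_strip:
  fixes g :: "complex \<Rightarrow> complex"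
  assumes hol: "g holomorphic_on UNIV"
    and width: "0 < \<alpha>" "real M * \<alpha> < pi / 2" and m: "m < M"
    and growth: "\<And>z. Re z \<ge> 0 \<Longrightarrow> norm (g z) \<le> exp (C * exp (real m * Re z))"
    and left: "\<And>z. Re z = 0 \<Longrightarrow> norm (g z) \<le> B"
    and sides: "\<And>z. Re z \<ge> 0 \<Longrightarrow> \<bar>Im z - y0\<bar> = \<alpha> \<Longrightarrow> norm (g z) \<le> B"
    and z: "Re z \<ge> 0" "\<bar>Im z - y0\<bar> \<le> \<alpha>"
  shows "norm (g z) \<le> max B 1"
proof -
  define k where "k = cos (real M * \<alpha>)"
  have k: "k > 0"
    unfolding k_def using width by (intro cos_gt_zero_pi) (auto intro: less_le_trans[of _ 0])
  have main: "norm (g z * exp (- of_real \<epsilon> * exp (of_nat M * (z - \<i> * of_real y0)))) \<le> max B 1"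
    if \<epsilon>: "\<epsilon> > 0" for \<epsilon>
  proof -
    define G where "G z = g z * exp (- of_real \<epsilon> * exp (of_nat M * (z - \<i> * of_real y0)))" for z
    have normG: "norm (G z) \<le> norm (g z) * exp (- (\<epsilon> * k * exp (real M * Re z)))"
      if "\<bar>Im z - y0\<bar> \<le> \<alpha>" for z
    proof -
      have "\<bar>real M * (Im z - y0)\<bar> \<le> real M * \<alpha>"
        using that by (simp add: abs_mult mult_left_mono)
      moreover have "real M * \<alpha> \<le> pi" using width pi_gt_zero by linarith
      ultimately have "cos (real M * \<alpha>) \<le> cos \<bar>real M * (Im z - y0)\<bar>"
        by (intro cos_monotone_0_pi_le) auto
      hence "k \<le> cos (real M * (Im z - y0))"
        by (simp add: k_def)
      hence "\<epsilon> * exp (real M * Re z) * k \<le> \<epsilon> * exp (real M * Re z) * cos (real M * (Im z - y0))"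
        using \<epsilon> by (intro mult_left_mono) auto
      thus ?thesis
        unfolding G_def norm_mult norm_exp_eq_Re
        by (intro mult_left_mono) (auto simp: Re_exp algebra_simps)
    qed
    have "real (M - m) > 0" using m by simp
    hence lim: "filterlim (\<lambda>x. \<epsilon> * k * exp (real (M - m) * x)) at_top at_top"
      using k \<epsilon> by (intro filterlim_tendsto_pos_mult_at_top[OF tendsto_const]
          filterlim_compose[OF exp_at_top] filterlim_ident) auto
    have "\<forall>\<^sub>F x in at_top. C \<le> \<epsilon> * k * exp (real (M - m) * x)"
      using lim by (auto simp: filterlim_at_top)
    hence "\<forall>\<^sub>F x in at_top. C \<le> \<epsilon> * k * exp (real (M - m) * x) \<and> x > max (Re z) 0"
      using eventually_gt_at_top eventually_conj by blast
    then obtain X where X0: "C \<le> \<epsilon> * k * exp (real (M - m) * X)" "X > max (Re z) 0"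
      using eventually_happens by force
    have "C * exp (real m * X) \<le> \<epsilon> * k * exp (real (M - m) * X) * exp (real m * X)"
      using X0 by (intro mult_right_mono) auto
    also have "\<dots> = \<epsilon> * k * exp (real M * X)"
      using m by (simp add: algebra_simps of_nat_diff flip: exp_add)
    finally have X: "C * exp (real m * X) \<le> \<epsilon> * k * exp (real M * X)" .
    define lo hi where "lo = Complex 0 (y0 - \<alpha>)" and "hi = Complex X (y0 + \<alpha>)"
    have "norm (G z) \<le> max B 1"
    proof (rule maximum_modulus_frontier[of G "cbox lo hi"])
      show "G holomorphic_on interior (cbox lo hi)"
        unfolding G_def by (intro holomorphic_intros holomorphic_on_subset[OF hol]) auto
      show "continuous_on (closure (cbox lo hi)) G"
        unfolding G_def
        by (intro continuous_intros holomorphic_on_imp_continuous_on holomorphic_on_subset[OF hol]) auto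
      show "z \<in> cbox lo hi"
        using X0 z by (auto simp: in_cbox_complex_iff lo_def hi_def)
    next
      fix x assume "x \<in> frontier (cbox lo hi)"
      hence x: "x \<in> cbox lo hi" "x \<notin> box lo hi"
        by (auto simp: frontier_cbox)
      hence im: "\<bar>Im x - y0\<bar> \<le> \<alpha>" and re: "Re x \<ge> 0"
        by (auto simp: in_cbox_complex_iff lo_def hi_def)
      consider "Re x = 0" | "\<bar>Im x - y0\<bar> = \<alpha>" | "Re x = X"
        using x im re by (auto simp: in_cbox_complex_iff in_box_complex_iff lo_def hi_def abs_real_def split: if_splits)
      hence "norm (g x) \<le> B \<or> Re x = X"
        using left sides re by metis
      thus "norm (G x) \<le> max B 1"
      proof
        assume *: "norm (g x) \<le> B"
        have "norm (g x) * exp (- (\<epsilon> * k * exp (real M * Re x))) \<le> norm (g x) * 1"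
          using \<epsilon> k by (intro mult_left_mono) auto
        thus ?thesis using normG[OF im] * by linarith
      next
        assume *: "Re x = X"
        have "norm (g x) * exp (- (\<epsilon> * k * exp (real M * Re x))) \<le>
                exp (C * exp (real m * X)) * exp (- (\<epsilon> * k * exp (real M * X)))"
          using growth[OF re] * by (intro mult_mono) auto
        also have "\<dots> = exp (C * exp (real m * X) - \<epsilon> * k * exp (real M * X))"
          by (simp flip: exp_add)
        also have "\<dots> \<le> 1" using X by simp
        finally show ?thesis using normG[OF im] by linarith
      qed
    qed auto
    thus ?thesis by (simp add: G_def)
  qed
  have "((\<lambda>\<epsilon>. norm (g z * exp (- of_real \<epsilon> * exp (of_nat M * (z - \<i> * of_real y0))))) \<longlongrightarrow>
        norm (g z * exp (- of_real 0 * exp (of_nat M * (z - \<i> * of_real y0))))) (at_right 0)"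
    by (intro tendsto_intros)
  moreover have "\<forall>\<^sub>F \<epsilon> in at_right 0. norm (g z * exp (- of_real \<epsilon> * exp (of_nat M * (z - \<i> * of_real y0)))) \<le> max B 1"
    using eventually_at_right_less[of 0] by eventually_elim (rule main)
  ultimately show ?thesis
    using tendsto_upperbound[of _ _ "at_right (0::real)"] by fastforce
qed

section \<open>Entire functions of finite order\<close>

text \<open>The base \<open>2 + norm z\<close> is at least 2, so a constant is at most some power of
  it and can be absorbed into \<open>m\<close>. This keeps a single parameter for finite order of
  growth.\<close>

definition finite_order :: "(complex \<Rightarrow> complex) \<Rightarrow> bool" where
  "finite_order G \<longleftrightarrow> (\<exists>m. \<forall>z. norm (G z) \<le> exp ((2 + norm z) ^ m))"

lemma finite_orderI:
  assumes "\<And>z. norm (G z) \<le> exp (C * (2 + norm z) ^ m)"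
  shows "finite_order G"
proof -
  obtain k where k: "C \<le> 2 ^ k"
    using real_arch_pow[of 2 C] by (auto intro: less_imp_le)
  have "norm (G z) \<le> exp ((2 + norm z) ^ (k + m))" for z
  proof -
    have "C \<le> (2 + norm z) ^ k"
      using k by (rule order_trans) (intro power_mono, auto)
    hence "C * (2 + norm z) ^ m \<le> (2 + norm z) ^ (k + m)"
      by (simp add: power_add mult_right_mono)
    thus ?thesis using assms[of z] order_trans exp_le_cancel_iff by blast
  qed
  thus ?thesis unfolding finite_order_def by blast
qed

lemma finite_order_mult:
  assumes "finite_order F" "finite_order G"
  shows "finite_order (\<lambda>z. F z * G z)"
proof -
  obtain m k where *: "\<And>z. norm (F z) \<le> exp ((2 + norm z) ^ m)" "\<And>z. norm (G z) \<le> exp ((2 + norm z) ^ k)"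
    using assms unfolding finite_order_def by blast
  show ?thesis
  proof (rule finite_orderI)
    fix z :: complex
    have "norm (F z * G z) \<le> exp ((2 + norm z) ^ m) * exp ((2 + norm z) ^ k)"
      unfolding norm_mult by (intro mult_mono *) auto
    also have "\<dots> = exp ((2 + norm z) ^ m + (2 + norm z) ^ k)"
      by (simp add: exp_add)
    also have "\<dots> \<le> exp (2 * (2 + norm z) ^ (max m k))"
      using power_increasing[of m "max m k" "2 + norm z"] power_increasing[of k "max m k" "2 + norm z"]
      by simp
    finally show "norm (F z * G z) \<le> exp (2 * (2 + norm z) ^ (max m k))" .
  qed
qed

lemma finite_order_add:
  assumes "finite_order F" "finite_order G"
  shows "finite_order (\<lambda>z. F z + G z)"
proof -
  obtain m k where *: "\<And>z. norm (F z) \<le> exp ((2 + norm z) ^ m)" "\<And>z. norm (G z) \<le> exp ((2 + norm z) ^ k)"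
    using assms unfolding finite_order_def by blast
  show ?thesis
  proof (rule finite_orderI)
    fix z :: complex
    define x where "x = (2 + norm z) ^ (max m k)"
    have x: "x \<ge> 1" unfolding x_def by (rule one_le_power) auto
    have "norm (F z + G z) \<le> exp ((2 + norm z) ^ m) + exp ((2 + norm z) ^ k)"
      by (intro norm_triangle_le add_mono *)
    also have "\<dots> \<le> exp x + exp x"
      unfolding x_def by (intro add_mono) (auto intro!: power_increasing)
    also have "\<dots> = 2 * exp x" by simp
    also have "\<dots> \<le> exp x * exp x"
      using x by (intro mult_right_mono order_trans[OF _ exp_ge_add_one_self]) auto
    also have "\<dots> = exp (2 * x)" by (simp flip: exp_add)
    finally show "norm (F z + G z) \<le> exp (2 * (2 + norm z) ^ (max m k))" by (simp add: x_def)
  qed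
qed

lemma finite_order_const: "finite_order (\<lambda>_. c)"
  by (rule finite_orderI[where C = "norm c" and m = 0]) (auto intro: order_trans[OF _ exp_ge_add_one_self])

lemma finite_order_id: "finite_order (\<lambda>z. z)"
proof (rule finite_orderI[where C = 1 and m = 1])
  fix z :: complex
  show "norm z \<le> exp (1 * (2 + norm z) ^ 1)"
    by (rule order_trans[OF _ exp_ge_add_one_self]) auto
qed

lemma finite_order_poly: "finite_order (poly p)"
proof (induction p)
  case 0
  show ?case using finite_order_const[of 0] by simp
next
  case (pCons a p)
  have "finite_order (\<lambda>z. a + z * poly p z)"
    by (intro finite_order_add finite_order_mult finite_order_const finite_order_id pCons)
  also have "(\<lambda>z. a + z * poly p z) = poly (pCons a p)"
    by auto
  finally show ?case .
qed

lemma norm_poly_le_power: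
  fixes p :: "complex poly"
  obtains C m where "C \<ge> 0" "\<And>z. norm (poly p z) \<le> C * (2 + norm z) ^ m"
proof -
  have "\<exists>C m. C \<ge> 0 \<and> (\<forall>z. norm (poly p z) \<le> C * (2 + norm z) ^ m)"
  proof (induction p)
    case 0
    show ?case by (intro exI[of _ 0]) auto
  next
    case (pCons a p)
    then obtain C m where C: "C \<ge> 0" "\<And>z. norm (poly p z) \<le> C * (2 + norm z) ^ m" by blast
    have "norm (poly (pCons a p) z) \<le> (norm a + C) * (2 + norm z) ^ (Suc m)" for z
    proof -
      have "norm (poly (pCons a p) z) \<le> norm a + norm z * norm (poly p z)"
        by (simp add: norm_triangle_le norm_mult)
      also have "\<dots> \<le> norm a * (2 + norm z) ^ (Suc m) + (2 + norm z) * (C * (2 + norm z) ^ m)"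
        using one_le_power[of "2 + norm z" "Suc m"] C
        by (intro add_mono mult_mono mult_left_le[THEN order_trans, rotated]) (auto simp: mult_le_cancel_left1)
      finally show ?thesis by (simp add: algebra_simps)
    qed
    thus ?case using C by (intro exI[of _ "norm a + C"] exI[of _ "Suc m"]) auto
  qed
  thus ?thesis using that by blast
qed

lemma finite_order_exp_poly: "finite_order (\<lambda>z. exp (poly p z))"
proof -
  obtain C m where C: "C \<ge> 0" "\<And>z. norm (poly p z) \<le> C * (2 + norm z) ^ m"
    using norm_poly_le_power[of p] by blast
  have "norm (exp (poly p z)) \<le> exp (C * (2 + norm z) ^ m)" for z
    using norm_exp[of "poly p z"] C(2)[of z] by (meson exp_le_cancel_iff order_trans)
  thus ?thesis by (rule finite_orderI)
qed

text \<open>Cauchy's inequality on unit circles; \<open>3 + norm z \<le> (2 + norm z)^2\<close>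
  restores the base at the price of doubling the exponent.\<close>

lemma finite_order_deriv:
  assumes "G holomorphic_on UNIV" "finite_order G"
  shows "finite_order (deriv G)"
proof -
  obtain m where m: "\<And>z. norm (G z) \<le> exp ((2 + norm z) ^ m)"
    using assms unfolding finite_order_def by blast
  show ?thesis
  proof (rule finite_orderI)
    fix z :: complex
    have "norm ((deriv ^^ 1) G z) \<le> fact 1 * exp ((3 + norm z) ^ m) / 1 ^ 1"
    proof (rule Cauchy_inequality)
      fix x assume "norm (z - x) = 1"
      hence "norm x \<le> 1 + norm z"
        by (metis add.commute norm_minus_commute norm_triangle_sub)
      hence "(2 + norm x) ^ m \<le> (3 + norm z) ^ m"
        by (intro power_mono) auto
      thus "norm (G x) \<le> exp ((3 + norm z) ^ m)"
        using m[of x] by (meson exp_le_cancel_iff order_trans)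
    qed (auto intro!: holomorphic_on_imp_continuous_on holomorphic_on_subset[OF assms(1)])
    also have "(3 + norm z) ^ m \<le> ((2 + norm z) ^ 2) ^ m"
      by (intro power_mono) (auto simp: power2_eq_square algebra_simps)
    finally show "norm (deriv G z) \<le> exp (1 * (2 + norm z) ^ (2 * m))"
      by (simp add: power_mult)
  qed
qed

text \<open>The exponential function maps a half strip onto the part of the sector outside the unit disc.\<close>

lemma phragmen_lindelof_sector:
  fixes G :: "complex \<Rightarrow> complex"
  assumes hol: "G holomorphic_on UNIV"
    and growth: "\<And>z. norm (G z) \<le> exp ((2 + norm z) ^ m)"
    and \<theta>: "\<theta>1 < \<theta>2" "real M * (\<theta>2 - \<theta>1) < pi" and M: "m < M"
    and sides: "\<And>r. r \<ge> 1 \<Longrightarrow> norm (G (of_real r * cis \<theta>1)) \<le> C * r ^ k"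
               "\<And>r. r \<ge> 1 \<Longrightarrow> norm (G (of_real r * cis \<theta>2)) \<le> C * r ^ k"
  obtains B where "\<And>r \<theta>. r \<ge> 1 \<Longrightarrow> \<theta> \<in> {\<theta>1..\<theta>2} \<Longrightarrow> norm (G (of_real r * cis \<theta>)) \<le> B * r ^ k"
proof -
  \<comment> \<open>The factor \<open>exp (- k * z)\<close> divides by \<open>r ^ k\<close>, so the
    polynomial bounds on the sides become constant bounds.\<close>
  define g where "g z = G (exp z) * exp (- of_nat k * z)" for z
  have "bounded (G ` sphere 0 1)"
    by (intro compact_imp_bounded compact_continuous_image holomorphic_on_imp_continuous_on
        holomorphic_on_subset[OF hol]) auto
  then obtain B0 where "\<forall>x\<in>G ` sphere 0 1. norm x \<le> B0"
    unfolding bounded_iff by blast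
  hence B0: "norm (G z) \<le> B0" if "norm z = 1" for z
    using that by auto
  define B where "B = max C B0"
  have exp_eq: "exp z = of_real (exp (Re z)) * cis (Im z)" for z
    by (rule exp_eq_polar)
  have norm_g: "norm (g z) = norm (G (exp z)) / exp (Re z) ^ k" for z
  proof -
    have "norm (exp (- of_nat k * z)) = exp (- (real k * Re z))"
      by (simp add: norm_exp_eq_Re)
    also have "\<dots> = inverse (exp (Re z) ^ k)"
      by (simp add: exp_minus flip: exp_of_nat_mult)
    finally have "norm (exp (- of_nat k * z)) = inverse (exp (Re z) ^ k)" .
    thus ?thesis by (simp add: g_def norm_mult divide_inverse)
  qed
  have g_bound: "norm (g z) \<le> max B 1" if "Re z \<ge> 0" "\<bar>Im z - (\<theta>1 + \<theta>2) / 2\<bar> \<le> (\<theta>2 - \<theta>1) / 2" for z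
  proof (rule phragmen_lindelof_half_strip[where g = g and M = M and m = m and C = "3 ^ m"])
    show "g holomorphic_on UNIV"
      unfolding g_def by (intro holomorphic_intros holomorphic_on_compose_gen[OF _ hol, unfolded o_def]) auto
    show "real M * ((\<theta>2 - \<theta>1) / 2) < pi / 2" using \<theta> by simp
  next
    fix z :: complex assume z: "Re z \<ge> 0"
    have "(2 + norm (exp z)) ^ m \<le> (3 * exp (Re z)) ^ m"
      using z by (intro power_mono) auto
    also have "\<dots> = 3 ^ m * exp (real m * Re z)"
      by (simp add: power_mult_distrib exp_of_nat_mult)
    finally have "norm (G (exp z)) \<le> exp (3 ^ m * exp (real m * Re z))"
      using growth[of "exp z"] by (meson exp_le_cancel_iff order_trans)
    moreover have "norm (g z) \<le> norm (G (exp z))"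
      unfolding norm_g using z by (simp add: divide_le_eq mult_le_cancel_left1)
    ultimately show "norm (g z) \<le> exp (3 ^ m * exp (real m * Re z))" by simp
  next
    fix z :: complex assume "Re z = 0"
    thus "norm (g z) \<le> B"
      unfolding norm_g using B0[of "exp z"] by (simp add: B_def)
  next
    fix z :: complex assume z: "Re z \<ge> 0" "\<bar>Im z - (\<theta>1 + \<theta>2) / 2\<bar> = (\<theta>2 - \<theta>1) / 2"
    hence "Im z = \<theta>1 \<or> Im z = \<theta>2"
      by (auto simp: abs_real_def field_simps split: if_splits)
    hence "norm (G (exp z)) \<le> C * exp (Re z) ^ k"
      using sides[of "exp (Re z)"] z exp_eq[of z] by auto
    thus "norm (g z) \<le> B"
      unfolding norm_g by (simp add: divide_le_eq B_def le_max_iff_disj)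
  qed (use \<theta> M that in auto)
  have "norm (G (of_real r * cis \<theta>)) \<le> max B 1 * r ^ k" if "r \<ge> 1" "\<theta> \<in> {\<theta>1..\<theta>2}" for r \<theta>
  proof -
    have "norm (g (Complex (ln r) \<theta>)) \<le> max B 1"
      using that by (intro g_bound) (auto simp: abs_real_def field_simps)
    thus ?thesis
      unfolding norm_g using that exp_eq[of "Complex (ln r) \<theta>"] by (simp add: divide_le_eq)
  qed
  thus ?thesis using that by blast
qed

text \<open>The order of growth fixes an opening below which Phragmen-Lindelof applies. Density
  supplies one ray in each of finitely many short arcs, the sectors between these rays cover the
  plane, and polynomial growth everywhere is left to Liouville's theorem.\<close>

theorem finite_order_imp_polynomial:
  fixes G :: "complex \<Rightarrow> complex"
  assumes hol: "G holomorphic_on UNIV" and ord: "finite_order G"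
    and rays: "\<And>\<theta>1 \<theta>2. \<theta>1 < \<theta>2 \<Longrightarrow> \<exists>\<theta>\<in>{\<theta>1<..<\<theta>2}. \<exists>k. \<forall>\<^sub>F r in at_top. norm (G (of_real r * cis \<theta>)) \<le> r ^ k"
  obtains p where "\<And>z. G z = poly p z"
proof -
  obtain m where m: "\<And>z. norm (G z) \<le> exp ((2 + norm z) ^ m)"
    using ord unfolding finite_order_def by blast
  \<comment> \<open>One natural number is both factor and exponent, so the sum of these numbers
    serves finitely many rays at once.\<close>
  have rays': "\<exists>\<theta>\<in>{\<theta>1<..<\<theta>2}. \<exists>K::nat. \<forall>r\<ge>1. norm (G (of_real r * cis \<theta>)) \<le> real K * r ^ K" if \<theta>12: "\<theta>1 < \<theta>2" for \<theta>1 \<theta>2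
  proof -
    obtain \<theta> k where \<theta>: "\<theta> \<in> {\<theta>1<..<\<theta>2}" and ev: "\<forall>\<^sub>F r in at_top. norm (G (of_real r * cis \<theta>)) \<le> r ^ k"
      using rays[OF \<theta>12] by blast
    then obtain R where R: "\<And>r. r \<ge> R \<Longrightarrow> norm (G (of_real r * cis \<theta>)) \<le> r ^ k"
      by (auto simp: eventually_at_top_linorder)
    have "continuous_on {1..R} (\<lambda>r. G (of_real r * cis \<theta>))"
      by (intro continuous_on_compose2[OF holomorphic_on_imp_continuous_on[OF hol]] continuous_intros) auto
    hence "bounded ((\<lambda>r. G (of_real r * cis \<theta>)) ` {1..R})"
      by (intro compact_imp_bounded compact_continuous_image) auto
    then obtain B where "\<forall>x\<in>(\<lambda>r. G (of_real r * cis \<theta>)) ` {1..R}. norm x \<le> B"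
      unfolding bounded_iff by blast
    hence B: "norm (G (of_real r * cis \<theta>)) \<le> B" if "r \<in> {1..R}" for r
      using that by auto
    obtain K0 :: nat where K0: "B \<le> real K0" using real_arch_simple by blast
    define K where "K = K0 + k + 1"
    have "norm (G (of_real r * cis \<theta>)) \<le> real K * r ^ K" if r: "r \<ge> 1" for r
    proof (cases "r \<le> R")
      case True
      hence "norm (G (of_real r * cis \<theta>)) \<le> real K * 1"
        using B[of r] r K0 by (simp add: K_def)
      also have "\<dots> \<le> real K * r ^ K"
        using r by (intro mult_left_mono one_le_power) auto
      finally show ?thesis .
    next
      case False
      hence "norm (G (of_real r * cis \<theta>)) \<le> r ^ k" using R by simp
      also have "\<dots> \<le> 1 * r ^ K" using power_increasing[of k K r] r by (simp add: K_def)
      also have "\<dots> \<le> real K * r ^ K" using r by (intro mult_right_mono) (auto simp: K_def)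
      finally show ?thesis .
    qed
    thus ?thesis using \<theta> by blast
  qed
  define M where "M = Suc m"
  \<comment> \<open>The sector from \<open>\<theta> j\<close> to \<open>\<theta> (j + 2)\<close> is
    narrower than \<open>3 * \<delta>\<close>, and \<open>M * 3 * pi / N < pi\<close>. Steps of two
    are taken because the arc from \<open>j * \<delta>\<close> to \<open>(j + 1) * \<delta>\<close>
    is certain to lie only between \<open>\<theta> (j - 1)\<close> and
    \<open>\<theta> (j + 1)\<close>.\<close>
  define N where "N = 3 * M + 1"
  define \<delta> where "\<delta> = pi / real N"
  have N0: "real N > 0" by (simp add: N_def)
  have \<delta>: "\<delta> > 0" using N0 by (simp add: \<delta>_def)
  have \<delta>_le: "\<delta> \<le> pi" using N0 by (simp add: \<delta>_def N_def field_simps add_pos_nonneg)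
  have N\<delta>: "real N * \<delta> = pi" using N0 by (simp add: \<delta>_def)
  have "\<exists>\<theta>. \<forall>j::nat. \<theta> j \<in> {real j * \<delta><..<real (Suc j) * \<delta>} \<and>
          (\<exists>K::nat. \<forall>r\<ge>1. norm (G (of_real r * cis (\<theta> j))) \<le> real K * r ^ K)"
  proof (rule choice, rule allI)
    fix j :: nat
    show "\<exists>t. t \<in> {real j * \<delta><..<real (Suc j) * \<delta>} \<and>
          (\<exists>K::nat. \<forall>r\<ge>1. norm (G (of_real r * cis t)) \<le> real K * r ^ K)"
    proof -
      have "real j * \<delta> < real (Suc j) * \<delta>" using \<delta> by (simp add: algebra_simps)
      from rays'[OF this] show ?thesis by blast
    qed
  qed
  then obtain \<theta> K where \<theta>: "\<And>j::nat. \<theta> j \<in> {real j * \<delta><..<real (Suc j) * \<delta>}"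
    and K: "\<And>j r. r \<ge> 1 \<Longrightarrow> norm (G (of_real r * cis (\<theta> j))) \<le> real (K j) * r ^ K j"
    by metis
  define KK where "KK = (\<Sum>j\<le>2*N+2. K j)"
  have KK: "norm (G (of_real r * cis (\<theta> j))) \<le> real KK * r ^ KK" if "r \<ge> 1" "j \<le> 2*N+2" for r j
  proof -
    have "K j \<le> KK" unfolding KK_def using that by (intro member_le_sum) auto
    hence "real (K j) * r ^ K j \<le> real KK * r ^ KK"
      using that by (intro mult_mono power_increasing) auto
    thus ?thesis using K[OF that(1), of j] by linarith
  qed
  have "\<exists>B. \<forall>r\<ge>1. \<forall>t\<in>{\<theta> j..\<theta> (j+2)}. norm (G (of_real r * cis t)) \<le> B * r ^ KK" if j: "j \<le> 2 * N" for j
  proof -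
    have *: "\<theta> j < \<theta> (j + 2)" "\<theta> (j + 2) - \<theta> j \<le> 3 * \<delta>"
      using \<theta>[of j] \<theta>[of "j+2"] \<delta> by (auto simp: algebra_simps)
    have "real M * (\<theta> (j + 2) - \<theta> j) \<le> real M * (3 * \<delta>)"
      using * by (intro mult_left_mono) auto
    also have "\<dots> < real N * \<delta>" using \<delta> by (simp add: N_def algebra_simps)
    finally have **: "real M * (\<theta> (j + 2) - \<theta> j) < pi" using N\<delta> by simp
    obtain B where "\<And>r t. r \<ge> 1 \<Longrightarrow> t \<in> {\<theta> j..\<theta> (j+2)} \<Longrightarrow> norm (G (of_real r * cis t)) \<le> B * r ^ KK"
      by (rule phragmen_lindelof_sector[OF hol m *(1) **, where C = "real KK" and k = KK])
         (use KK[of _ j] KK[of _ "j + 2"] j in \<open>auto simp: M_def\<close>)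
    thus ?thesis by blast
  qed
  then obtain B where B: "\<And>j r t. j \<le> 2 * N \<Longrightarrow> r \<ge> 1 \<Longrightarrow> t \<in> {\<theta> j..\<theta> (j+2)} \<Longrightarrow>
      norm (G (of_real r * cis t)) \<le> B j * r ^ KK"
    by metis
  define BB where "BB = (\<Sum>j\<le>2*N. \<bar>B j\<bar>)"
  have bound: "norm (G z) \<le> BB * norm z ^ KK" if z: "norm z \<ge> 1" for z
  proof -
    \<comment> \<open>The angle starts at \<open>\<delta>\<close> instead of 0, so that the index
      \<open>j\<close> of its arc is at least 1 and has a predecessor.\<close>
    obtain t where t: "t \<in> {\<delta>..<\<delta> + 2 * pi}" "z = of_real (norm z) * cis t"
    proof -
      define s where "s = Arg2pi z"
      have s: "0 \<le> s" "s < 2 * pi" "z = of_real (norm z) * cis s"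
        using Arg2pi[of z] by (auto simp: s_def cis_conv_exp is_Arg_def)
      show ?thesis
      proof (cases "s \<ge> \<delta>")
        case True
        thus ?thesis using that[of s] s \<delta> by auto
      next
        case False
        have "cis (s + 2 * pi) = cis s" by (simp add: complex_eq_iff)
        thus ?thesis using that[of "s + 2 * pi"] s \<delta> False \<delta>_le pi_gt_zero by auto
      qed
    qed
    define j where "j = nat \<lfloor>t / \<delta>\<rfloor>"
    have t0: "t / \<delta> \<ge> 1" using t \<delta> by (simp add: field_simps)
    have tN: "t / \<delta> < 2 * real N + 1" using t \<delta> N\<delta> by (simp add: field_simps)
    have j1: "real j \<le> t / \<delta>" "t / \<delta> < real j + 1" "j \<ge> 1"
      using t0 unfolding j_def by linarith+
    have j2: "j \<le> 2 * N" using j1 tN by linarith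
    define i where "i = j - 1"
    have i: "j = Suc i" using j1 by (simp add: i_def)
    have "real j * \<delta> \<le> t" "t < (real j + 1) * \<delta>"
      using j1 \<delta> by (simp_all add: field_simps)
    hence "t \<in> {\<theta> i..\<theta> (i+2)}"
      using \<theta>[of i] \<theta>[of "i+2"] by (auto simp: i algebra_simps)
    hence "norm (G z) \<le> B i * norm z ^ KK"
      using B[of i "norm z" t] j2 i z t by simp
    also have "B i \<le> BB"
      unfolding BB_def using j2 i
      by (intro order_trans[OF abs_ge_self member_le_sum[of i _ "\<lambda>j. \<bar>B j\<bar>"]]) auto
    finally show ?thesis by (simp add: mult_right_mono)
  qed
  have "G z = poly (\<Sum>k\<le>KK. monom ((deriv ^^ k) G 0 / fact k) k) z" for z
    using Liouville_polynomial[OF hol, of 1 BB KK z] bound by (simp add: poly_sum poly_monom)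
  thus ?thesis using that by blast
qed

section \<open>Asymptotics of linear differential equations\<close>

lemma has_real_derivative_norm_sq:
  fixes u :: "real \<Rightarrow> complex"
  assumes "(u has_vector_derivative D) (at r)"
  shows "((\<lambda>r. (norm (u r))\<^sup>2) has_real_derivative 2 * (u r \<bullet> D)) (at r)"
proof -
  have "((\<lambda>r. u r \<bullet> u r) has_vector_derivative (u r \<bullet> D + D \<bullet> u r)) (at r)"
    using bounded_bilinear.has_vector_derivative[OF bounded_bilinear_inner assms assms] .
  thus ?thesis
    by (simp add: has_real_derivative_iff_has_vector_derivative power2_norm_eq_inner inner_commute)
qed

lemma inner_mult_self_complex: "(u::complex) \<bullet> (m * u) = Re m * (norm u)\<^sup>2"
  unfolding cmod_power2 inner_complex_def by (simp add: power2_eq_square algebra_simps)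

lemma power_integral_deriv:
  "((\<lambda>r. \<mu> * r ^ Suc k / real (Suc k)) has_real_derivative \<mu> * r ^ k) (at r)"
  using DERIV_cmult[OF DERIV_pow[of "Suc k" r], of "\<mu> / real (Suc k)"]
  by (simp del: power_Suc)

text \<open>Completing a square: with \<open>P' = \<mu> * r ^ k\<close>, the derivative of
  \<open>((norm u)^2 - d^2) * exp P\<close> is at most
  \<open>- \<mu> * r ^ k * (norm u - d)^2 * exp P\<close>. So \<open>(norm u)^2\<close> exceeds
  \<open>d^2\<close> by at most a multiple of \<open>exp (- P)\<close>.\<close>

lemma linear_ode_stable_tendsto_0:
  fixes u m \<rho> :: "real \<Rightarrow> complex"
  assumes ode: "\<forall>\<^sub>F r in at_top. (u has_vector_derivative (m r * u r + \<rho> r)) (at r)"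
    and \<mu>: "\<mu> > 0" and m: "\<forall>\<^sub>F r in at_top. Re (m r) \<le> - \<mu> * r ^ k"
    and \<rho>: "((\<lambda>r. \<rho> r / of_real (r ^ k)) \<longlongrightarrow> 0) at_top"
  shows "(u \<longlongrightarrow> 0) at_top"
proof -
  have "\<forall>\<^sub>F r in at_top. norm (u r) < e" if e: "e > 0" for e
  proof -
    define d where "d = e / 2"
    have d: "d > 0" using e by (simp add: d_def)
    have "\<forall>\<^sub>F r in at_top. norm (\<rho> r / of_real (r ^ k)) < \<mu> * d"
      using \<rho> \<mu> d by (auto simp: tendsto_iff dist_norm)
    hence "\<forall>\<^sub>F r in at_top. (u has_vector_derivative (m r * u r + \<rho> r)) (at r) \<and>
        Re (m r) \<le> - \<mu> * r ^ k \<and> norm (\<rho> r) \<le> \<mu> * d * r ^ k \<and> r \<ge> 1"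
      using ode m eventually_ge_at_top[of 1]
    proof eventually_elim
      case (elim r)
      thus ?case by (auto simp: norm_divide norm_power divide_less_eq)
    qed
    then obtain r0 where r0:
      "\<And>r. r \<ge> r0 \<Longrightarrow> (u has_vector_derivative (m r * u r + \<rho> r)) (at r)"
      "\<And>r. r \<ge> r0 \<Longrightarrow> Re (m r) \<le> - \<mu> * r ^ k"
      "\<And>r. r \<ge> r0 \<Longrightarrow> norm (\<rho> r) \<le> \<mu> * d * r ^ k"
      "\<And>r. r \<ge> r0 \<Longrightarrow> r \<ge> 1"
      by (auto simp: eventually_at_top_linorder)
    define P where "P r = \<mu> * r ^ Suc k / real (Suc k)" for r
    define \<psi> where "\<psi> r = ((norm (u r))\<^sup>2 - d\<^sup>2) * exp (P r)" for r
    have mono: "\<psi> r \<le> \<psi> r0" if "r \<ge> r0" for r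
    proof (rule DERIV_nonpos_imp_nonincreasing[OF that])
      fix x assume x: "r0 \<le> x" "x \<le> r"
      define D where "D = (2 * (u x \<bullet> (m x * u x + \<rho> x)) + \<mu> * x ^ k * ((norm (u x))\<^sup>2 - d\<^sup>2)) * exp (P x)"
      have P: "(P has_real_derivative \<mu> * x ^ k) (at x)"
        unfolding P_def by (rule power_integral_deriv)
      have "(\<psi> has_real_derivative D) (at x)"
        unfolding \<psi>_def D_def
        using DERIV_mult[OF DERIV_diff[OF has_real_derivative_norm_sq[OF r0(1)[OF x(1)]] DERIV_const[of "d\<^sup>2"]] DERIV_fun_exp[OF P]]
        by (rule DERIV_cong) (simp add: algebra_simps)
      moreover have "D \<le> 0"
      proof -
        have xk: "\<mu> * x ^ k \<ge> 0" using \<mu> r0(4)[OF x(1)] by simp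
        have "u x \<bullet> (m x * u x + \<rho> x) \<le> Re (m x) * (norm (u x))\<^sup>2 + norm (u x) * norm (\<rho> x)"
          using norm_cauchy_schwarz[of "u x" "\<rho> x"] by (simp add: inner_add_right inner_mult_self_complex)
        also have "\<dots> \<le> (- \<mu> * x ^ k) * (norm (u x))\<^sup>2 + norm (u x) * (\<mu> * d * x ^ k)"
          using r0[OF x(1)] by (intro add_mono mult_right_mono mult_left_mono) auto
        finally have "2 * (u x \<bullet> (m x * u x + \<rho> x)) + \<mu> * x ^ k * ((norm (u x))\<^sup>2 - d\<^sup>2) \<le>
            - (\<mu> * x ^ k) * (norm (u x) - d)\<^sup>2"
          by (simp add: power2_eq_square algebra_simps)
        also have "\<dots> \<le> 0" using xk by (simp add: mult_nonneg_nonneg)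
        finally show ?thesis unfolding D_def by (simp add: mult_nonpos_nonneg)
      qed
      ultimately show "\<exists>y. (\<psi> has_real_derivative y) (at x) \<and> y \<le> 0" by blast
    qed
    have "filterlim (\<lambda>r::real. r ^ Suc k) at_top at_top"
      by (rule filterlim_pow_at_top) (auto intro: filterlim_ident)
    hence "filterlim P at_top at_top"
      unfolding P_def using \<mu>
      by (intro filterlim_tendsto_pos_mult_at_top[OF tendsto_const, of "\<mu> / real (Suc k)", unfolded times_divide_eq_left]) auto
    hence "filterlim (\<lambda>r. exp (P r)) at_top at_top"
      by (rule filterlim_compose[OF exp_at_top])
    hence "((\<lambda>r. \<psi> r0 / exp (P r)) \<longlongrightarrow> 0) at_top"
      by (rule real_tendsto_divide_at_top[OF tendsto_const])
    hence "\<forall>\<^sub>F r in at_top. \<psi> r0 / exp (P r) < d\<^sup>2"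
      using d by (intro order_tendstoD(2)[where y = 0]) auto
    thus ?thesis using eventually_ge_at_top[of r0]
    proof eventually_elim
      case (elim r)
      have "(norm (u r))\<^sup>2 - d\<^sup>2 = \<psi> r / exp (P r)" by (simp add: \<psi>_def)
      also have "\<dots> \<le> \<psi> r0 / exp (P r)" using mono[OF elim(2)] by (intro divide_right_mono) auto
      finally have "(norm (u r))\<^sup>2 < 2 * d\<^sup>2" using elim(1) by simp
      also have "\<dots> < e\<^sup>2" using e by (simp add: d_def power2_eq_square)
      finally show ?case using e by (simp add: power_less_imp_less_base)
    qed
  qed
  thus ?thesis by (auto simp: tendsto_iff)
qed

text \<open>The square is completed with the opposite sign, so \<open>\<psi>\<close> is
  nondecreasing. The polynomial bound on \<open>u\<close> excludes the exponentially growing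
  solutions: it bounds \<open>\<psi>\<close> near infinity by a quantity tending to 0, hence
  \<open>\<psi> \<le> 0\<close> already at finite \<open>r\<close>, that is,
  \<open>norm u \<le> d\<close>.\<close>

lemma linear_ode_unstable_tendsto_0:
  fixes u m \<rho> :: "real \<Rightarrow> complex"
  assumes ode: "\<forall>\<^sub>F r in at_top. (u has_vector_derivative (m r * u r + \<rho> r)) (at r)"
    and \<mu>: "\<mu> > 0" and m: "\<forall>\<^sub>F r in at_top. Re (m r) \<ge> \<mu> * r ^ k"
    and \<rho>: "((\<lambda>r. \<rho> r / of_real (r ^ k)) \<longlongrightarrow> 0) at_top"
    and u: "\<forall>\<^sub>F r in at_top. norm (u r) \<le> r ^ j"
  shows "(u \<longlongrightarrow> 0) at_top"
proof -
  have "\<forall>\<^sub>F r in at_top. norm (u r) < e" if e: "e > 0" for e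
  proof -
    define d where "d = e / 2"
    have d: "d > 0" using e by (simp add: d_def)
    have "\<forall>\<^sub>F r in at_top. norm (\<rho> r / of_real (r ^ k)) < \<mu> * d"
      using \<rho> \<mu> d by (auto simp: tendsto_iff dist_norm)
    hence "\<forall>\<^sub>F r in at_top. (u has_vector_derivative (m r * u r + \<rho> r)) (at r) \<and>
        Re (m r) \<ge> \<mu> * r ^ k \<and> norm (\<rho> r) \<le> \<mu> * d * r ^ k \<and> norm (u r) \<le> r ^ j \<and> r \<ge> 1"
      using ode m u eventually_ge_at_top[of 1]
    proof eventually_elim
      case (elim r)
      thus ?case by (auto simp: norm_divide norm_power divide_less_eq)
    qed
    then obtain r0 where r0:
      "\<And>r. r \<ge> r0 \<Longrightarrow> (u has_vector_derivative (m r * u r + \<rho> r)) (at r)"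
      "\<And>r. r \<ge> r0 \<Longrightarrow> Re (m r) \<ge> \<mu> * r ^ k"
      "\<And>r. r \<ge> r0 \<Longrightarrow> norm (\<rho> r) \<le> \<mu> * d * r ^ k"
      "\<And>r. r \<ge> r0 \<Longrightarrow> norm (u r) \<le> r ^ j"
      "\<And>r. r \<ge> r0 \<Longrightarrow> r \<ge> 1"
      by (auto simp: eventually_at_top_linorder)
    define P where "P r = - \<mu> * r ^ Suc k / real (Suc k)" for r
    define \<psi> where "\<psi> r = ((norm (u r))\<^sup>2 - d\<^sup>2) * exp (P r)" for r
    have mono: "\<psi> r \<le> \<psi> s" if "r \<ge> r0" "r \<le> s" for r s
    proof (rule DERIV_nonneg_imp_nondecreasing[OF that(2)])
      fix x assume "r \<le> x" "x \<le> s"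
      hence x: "r0 \<le> x" using that by simp
      define D where "D = (2 * (u x \<bullet> (m x * u x + \<rho> x)) - \<mu> * x ^ k * ((norm (u x))\<^sup>2 - d\<^sup>2)) * exp (P x)"
      have P: "(P has_real_derivative - \<mu> * x ^ k) (at x)"
        unfolding P_def by (rule power_integral_deriv)
      have "(\<psi> has_real_derivative D) (at x)"
        unfolding \<psi>_def D_def
        using DERIV_mult[OF DERIV_diff[OF has_real_derivative_norm_sq[OF r0(1)[OF x]] DERIV_const[of "d\<^sup>2"]] DERIV_fun_exp[OF P]]
        by (rule DERIV_cong) (simp add: algebra_simps)
      moreover have "D \<ge> 0"
      proof -
        have xk: "\<mu> * x ^ k \<ge> 0" using \<mu> r0(5)[OF x] by simp
        have "u x \<bullet> (m x * u x + \<rho> x) \<ge> Re (m x) * (norm (u x))\<^sup>2 - norm (u x) * norm (\<rho> x)"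
          using norm_cauchy_schwarz[of "u x" "- \<rho> x"] by (simp add: inner_add_right inner_mult_self_complex)
        moreover have "Re (m x) * (norm (u x))\<^sup>2 - norm (u x) * norm (\<rho> x) \<ge>
           \<mu> * x ^ k * (norm (u x))\<^sup>2 - norm (u x) * (\<mu> * d * x ^ k)"
          using r0[OF x] by (intro diff_mono mult_right_mono mult_left_mono) auto
        ultimately have "2 * (u x \<bullet> (m x * u x + \<rho> x)) - \<mu> * x ^ k * ((norm (u x))\<^sup>2 - d\<^sup>2) \<ge>
            (\<mu> * x ^ k) * (norm (u x) - d)\<^sup>2"
          by (simp add: power2_eq_square algebra_simps)
        moreover have "(\<mu> * x ^ k) * (norm (u x) - d)\<^sup>2 \<ge> 0" using xk by (simp add: mult_nonneg_nonneg)
        ultimately show ?thesis unfolding D_def by simp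
      qed
      ultimately show "\<exists>y. (\<psi> has_real_derivative y) (at x) \<and> y \<ge> 0" by blast
    qed
    have lim: "((\<lambda>r. r ^ (2 * j) * exp (P r)) \<longlongrightarrow> 0) at_top"
    proof (rule Lim_null_comparison)
      define c where "c = \<mu> / real (Suc k)"
      have c: "c > 0" using \<mu> by (simp add: c_def)
      have "filterlim (\<lambda>r. c * r) at_top at_top"
        using c by (intro filterlim_tendsto_pos_mult_at_top[OF tendsto_const]) (auto intro: filterlim_ident)
      hence "((\<lambda>r. (c * r) ^ (2 * j) / exp (c * r)) \<longlongrightarrow> 0) at_top"
        by (rule filterlim_compose[OF tendsto_power_div_exp_0])
      hence "((\<lambda>r. (1 / c ^ (2 * j)) * ((c * r) ^ (2 * j) / exp (c * r))) \<longlongrightarrow> (1 / c ^ (2 * j)) * 0) at_top"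
        by (intro tendsto_intros)
      thus "((\<lambda>r. r ^ (2 * j) * exp (- (c * r))) \<longlongrightarrow> 0) at_top"
        using c by (simp add: power_mult_distrib exp_minus field_simps)
      show "\<forall>\<^sub>F r in at_top. norm (r ^ (2 * j) * exp (P r)) \<le> r ^ (2 * j) * exp (- (c * r))"
        using eventually_ge_at_top[of 1]
      proof eventually_elim
        case (elim r)
        have "r * 1 \<le> r * r ^ k" using elim by (intro mult_left_mono one_le_power) auto
        hence "c * r \<le> c * r ^ Suc k" using c by simp
        also have "\<dots> = - P r" by (simp add: P_def c_def)
        finally show ?case using elim by (simp add: norm_mult mult_left_mono)
      qed
    qed
    have "\<psi> r \<le> 0" if r: "r \<ge> r0" for r
    proof (rule tendsto_lowerbound[OF lim])
      show "\<forall>\<^sub>F s in at_top. \<psi> r \<le> s ^ (2 * j) * exp (P s)"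
        using eventually_ge_at_top[of r]
      proof eventually_elim
        case (elim s)
        have "(norm (u s))\<^sup>2 \<le> (s ^ j)\<^sup>2"
          using r0(4)[of s] elim r by (intro power_mono) auto
        moreover have "s ^ (2 * j) = (s ^ j)\<^sup>2" by (rule power_even_eq)
        moreover have "d\<^sup>2 \<ge> 0" by simp
        ultimately have "(norm (u s))\<^sup>2 - d\<^sup>2 \<le> s ^ (2 * j)" by linarith
        hence "\<psi> s \<le> s ^ (2 * j) * exp (P s)"
          unfolding \<psi>_def by (intro mult_right_mono) auto
        thus ?case using mono[OF r elim] by simp
      qed
    qed auto
    hence le: "(norm (u r))\<^sup>2 \<le> d\<^sup>2" if "r \<ge> r0" for r
      using that by (auto simp: \<psi>_def mult_le_0_iff)
    show ?thesis using eventually_ge_at_top[of r0]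
    proof eventually_elim
      case (elim r)
      hence "norm (u r) \<le> d" using le d by (meson less_imp_le power2_le_imp_le)
      thus ?case using e by (simp add: d_def)
    qed
  qed
  thus ?thesis by (auto simp: tendsto_iff)
qed

section \<open>Leading terms of polynomials and division by a differential operator\<close>

text \<open>The value \<open>l\<close> may be 0: \<open>leading p d 0\<close> says that
  \<open>p\<close> is 0 or has degree below \<open>d\<close>. Recording the coefficient at a nominal
  degree lets leading terms cancel without case distinctions.\<close>

definition leading :: "complex poly \<Rightarrow> nat \<Rightarrow> complex \<Rightarrow> bool" where
  "leading p d l \<longleftrightarrow> degree p \<le> d \<and> coeff p d = l"

lemma leading_degree: "leading p (degree p) (lead_coeff p)"
  by (simp add: leading_def)

lemma leading_add: "leading p d a \<Longrightarrow> leading q d b \<Longrightarrow> leading (p + q) d (a + b)"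
  by (auto simp: leading_def degree_add_le)

lemma leading_minus: "leading p d a \<Longrightarrow> leading (- p) d (- a)"
  by (auto simp: leading_def)

lemma leading_diff: "leading p d a \<Longrightarrow> leading q d b \<Longrightarrow> leading (p - q) d (a - b)"
  by (auto simp: leading_def degree_diff_le)

lemma leading_mult:
  assumes "leading p d a" "leading q e b"
  shows "leading (p * q) (d + e) (a * b)"
proof -
  have "coeff (p * q) (d + e) = (\<Sum>i\<le>d + e. coeff p i * coeff q (d + e - i))"
    by (rule coeff_mult)
  also have "\<dots> = (\<Sum>i\<le>d + e. if i = d then coeff p i * coeff q (d + e - i) else 0)"
  proof (rule sum.cong)
    fix i assume "i \<in> {..d + e}"
    show "coeff p i * coeff q (d + e - i) = (if i = d then coeff p i * coeff q (d + e - i) else 0)"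
      using assms by (cases i d rule: linorder_cases) (auto simp: leading_def coeff_eq_0)
  qed auto
  also have "\<dots> = a * b" using assms by (simp add: leading_def)
  finally show ?thesis
    using assms degree_mult_le[of p q] by (auto simp: leading_def)
qed

lemma leading_pderiv: "leading p d a \<Longrightarrow> leading (pderiv p) d 0"
  by (auto simp: leading_def coeff_pderiv degree_pderiv coeff_eq_0)

lemma leading_monom: "leading (monom c k) k c"
  by (simp add: leading_def degree_monom_le)

lemma leading_weaken: "leading p d a \<Longrightarrow> d < e \<Longrightarrow> leading p e 0"
  by (auto simp: leading_def coeff_eq_0)

lemma leading_weaken': "leading p d 0 \<Longrightarrow> d \<le> e \<Longrightarrow> leading p e 0"
  by (cases "d = e") (auto intro: leading_weaken)

lemma leading_imp_tendsto:
  assumes "leading p d l"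
  shows "((\<lambda>z. poly p z / z ^ d) \<longlongrightarrow> l) at_infinity"
proof -
  have "((\<lambda>z. (\<Sum>i\<le>d. coeff p i * (1 / z) ^ (d - i))) \<longlongrightarrow> (\<Sum>i\<le>d. coeff p i * 0 ^ (d - i))) at_infinity"
    by (intro tendsto_intros tendsto_divide_0[OF tendsto_const filterlim_ident])
  also have "(\<Sum>i\<le>d. coeff p i * 0 ^ (d - i)) = (\<Sum>i\<le>d. if i = d then coeff p i else 0)"
    by (intro sum.cong) (auto simp: power_0_left)
  also have "\<dots> = l" using assms by (simp add: leading_def)
  finally show ?thesis
  proof (rule Lim_transform_eventually)
    have "\<forall>\<^sub>F z in at_infinity. norm (z::complex) \<ge> 1"
      by (auto simp: eventually_at_infinity)
    thus "\<forall>\<^sub>F z in at_infinity. (\<Sum>i\<le>d. coeff p i * (1 / z) ^ (d - i)) = poly p z / z ^ d"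
    proof eventually_elim
      case (elim z)
      hence z: "z \<noteq> 0" by auto
      have "poly p z = (\<Sum>i\<le>d. coeff p i * z ^ i)"
        unfolding poly_altdef
        by (intro sum.mono_neutral_left) (use assms in \<open>auto simp: leading_def coeff_eq_0\<close>)
      hence "poly p z / z ^ d = (\<Sum>i\<le>d. coeff p i * z ^ i / z ^ d)"
        by (simp add: sum_divide_distrib)
      also have "\<dots> = (\<Sum>i\<le>d. coeff p i * (1 / z) ^ (d - i))"
      proof (rule sum.cong)
        fix i assume "i \<in> {..d}"
        hence "z ^ d = z ^ (d - i) * z ^ i" by (simp flip: power_add)
        thus "coeff p i * z ^ i / z ^ d = coeff p i * (1 / z) ^ (d - i)"
          using z by (simp add: power_divide)
      qed auto
      finally show ?case by (rule sym)
    qed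
  qed
qed

text \<open>Long division: on \<open>z ^ N\<close> the operator has leading term
  \<open>l * z ^ (D + N)\<close>, because each derivative term loses more degree than its
  coefficient can restore. Thus the top coefficient of \<open>R\<close> can be removed as long as
  its degree is at least \<open>D\<close>.\<close>

lemma linear_differential_division:
  fixes k0 k1 k2 :: "complex poly"
  assumes k0: "leading k0 D l" "l \<noteq> 0" and k1: "degree k1 \<le> D" and k2: "degree k2 \<le> Suc D"
  obtains c where "leading (R - (k0 * c + k1 * pderiv c + k2 * pderiv (pderiv c))) D 0"
proof -
  define V where "V c = k0 * c + k1 * pderiv c + k2 * pderiv (pderiv c)" for c
  have V_add: "V (c + c') = V c + V c'" for c c'
    by (simp add: V_def pderiv_add algebra_simps)
  have "\<exists>c. leading (R - V c) D 0" if "leading R (D + N) 0" for N R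
    using that
  proof (induction N arbitrary: R)
    case 0
    thus ?case by (intro exI[of _ 0]) (simp add: V_def)
  next
    case (Suc N)
    define c where "c = monom (coeff R (D + N) / l) N"
    have c: "leading c N (coeff R (D + N) / l)" unfolding c_def by (rule leading_monom)
    have R: "leading R (D + N) (coeff R (D + N))"
    proof -
      have "coeff R i = 0" if "i > D + N" for i
        using Suc.prems that by (cases "i = D + Suc N") (auto simp: leading_def coeff_eq_0)
      thus ?thesis by (simp add: leading_def degree_le)
    qed
    have 0: "leading (k0 * c) (D + N) (coeff R (D + N))"
      using leading_mult[OF k0(1) c] k0(2) by simp
    have 1: "leading (k1 * pderiv c) (D + N) 0"
      using leading_mult[OF _ leading_pderiv[OF c], of k1 D "coeff k1 D"] k1 by (simp add: leading_def)
    have 2: "leading (k2 * pderiv (pderiv c)) (D + N) 0"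
    proof (cases N)
      case 0
      thus ?thesis by (simp add: c_def monom_0 leading_def)
    next
      case (Suc N')
      have "degree (pderiv c) \<le> N'" unfolding c_def degree_pderiv Suc
        using degree_monom_le[of "coeff R (D + N) / l" "Suc N'"] by (simp add: Suc)
      hence "leading (pderiv c) N' (coeff (pderiv c) N')" by (simp add: leading_def)
      from leading_mult[OF _ leading_pderiv[OF this], of k2 "Suc D" "coeff k2 (Suc D)"] k2 Suc
      show ?thesis by (simp add: leading_def)
    qed
    have "leading (R - V c) (D + N) (coeff R (D + N) - (coeff R (D + N) + 0 + 0))"
      unfolding V_def by (intro leading_diff leading_add R 0 1 2)
    then obtain c' where "leading (R - V c - V c') D 0"
      using Suc.IH[of "R - V c"] by auto
    thus ?case by (intro exI[of _ "c + c'"]) (simp add: V_add algebra_simps)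
  qed
  moreover have "leading R (D + Suc (degree R)) 0"
    by (rule leading_weaken[OF leading_degree]) auto
  ultimately show ?thesis using that unfolding V_def by blast
qed

section \<open>Moderate functions along a ray\<close>

text \<open>
  Tubes whose width decays polynomially are thin enough to avoid the zeros of \<open>f\<close>, yet wide enough
  for Cauchy's inequality to preserve polynomial bounds under differentiation.
\<close>

definition tube :: "real \<Rightarrow> nat \<Rightarrow> complex set" where
  "tube \<theta> k = {z. \<exists>r\<ge>real k + 3. dist z (of_real r * cis \<theta>) < 1 / r ^ k}"

definition tubes :: "real \<Rightarrow> complex filter" where
  "tubes \<theta> = (INF k. principal (tube \<theta> k))"

lemma tube_mono:
  assumes "j \<le> k"
  shows "tube \<theta> k \<subseteq> tube \<theta> j"
proof
  fix z assume "z \<in> tube \<theta> k"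
  then obtain r where r: "r \<ge> real k + 3" "dist z (of_real r * cis \<theta>) < 1 / r ^ k"
    by (auto simp: tube_def)
  have "1 / r ^ k \<le> 1 / r ^ j"
    using r assms by (intro divide_left_mono power_increasing mult_pos_pos) auto
  thus "z \<in> tube \<theta> j"
    unfolding tube_def using r assms by (intro CollectI exI[of _ r]) auto
qed

lemma eventually_tubes: "eventually P (tubes \<theta>) \<longleftrightarrow> (\<exists>k. \<forall>z\<in>tube \<theta> k. P z)"
proof -
  have "eventually P (tubes \<theta>) \<longleftrightarrow> (\<exists>k\<in>UNIV. eventually P (principal (tube \<theta> k)))"
    unfolding tubes_def
  proof (rule eventually_INF_base)
    fix j k :: nat
    show "\<exists>x\<in>UNIV. principal (tube \<theta> x) \<le> inf (principal (tube \<theta> j)) (principal (tube \<theta> k))"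
      using tube_mono[of j "max j k"] tube_mono[of k "max j k"] by (intro bexI[of _ "max j k"]) auto
  qed auto
  thus ?thesis by (simp add: eventually_principal)
qed

lemma tube_norm:
  assumes "z \<in> tube \<theta> k"
  obtains r where "r \<ge> real k + 3" "dist z (of_real r * cis \<theta>) < 1 / r ^ k"
    "\<bar>norm z - r\<bar> < 1"
proof -
  obtain r where r: "r \<ge> real k + 3" "dist z (of_real r * cis \<theta>) < 1 / r ^ k"
    using assms by (auto simp: tube_def)
  have "1 / r ^ k \<le> 1" using r by simp
  moreover have "\<bar>norm z - r\<bar> \<le> dist z (of_real r * cis \<theta>)"
    using norm_triangle_ineq3[of z "of_real r * cis \<theta>"] r by (simp add: dist_norm norm_mult)
  ultimately have "\<bar>norm z - r\<bar> < 1" using r(2) by linarith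
  thus ?thesis using that r by blast
qed

lemma tubes_le_at_infinity: "tubes \<theta> \<le> at_infinity"
proof (rule filter_leI)
  fix P :: "complex \<Rightarrow> bool"
  assume "eventually P at_infinity"
  then obtain b where b: "\<And>z. norm z \<ge> b \<Longrightarrow> P z" by (auto simp: eventually_at_infinity)
  obtain k :: nat where k: "b \<le> real k" using real_arch_simple by blast
  have "P z" if "z \<in> tube \<theta> k" for z
    using that k by (elim tube_norm) (auto intro!: b)
  thus "eventually P (tubes \<theta>)" by (auto simp: eventually_tubes)
qed

lemma tubes_norm_ge: "\<forall>\<^sub>F z in tubes \<theta>. norm z \<ge> c"
  by (rule filter_leD[OF tubes_le_at_infinity]) (auto simp: eventually_at_infinity)

lemma filterlim_norm_tubes: "filterlim norm at_top (tubes \<theta>)"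
  unfolding filterlim_at_top by (auto intro: tubes_norm_ge)

lemma filterlim_ray: "filterlim (\<lambda>r. of_real r * cis \<theta>) (tubes \<theta>) at_top"
  unfolding filterlim_iff
proof safe
  fix P assume "eventually P (tubes \<theta>)"
  then obtain k where k: "\<And>z. z \<in> tube \<theta> k \<Longrightarrow> P z" by (auto simp: eventually_tubes)
  show "\<forall>\<^sub>F r in at_top. P (of_real r * cis \<theta>)"
    using eventually_ge_at_top[of "real k + 3"]
  proof eventually_elim
    case (elim r)
    thus ?case by (intro k) (auto simp: tube_def intro!: exI[of _ r])
  qed
qed

text \<open>Tube \<open>k + 1\<close> is so much thinner than tube \<open>k\<close> that discs of
  radius \<open>1 / norm z ^ (2 * (k + 1))\<close> about its points remain in tube \<open>k\<close>.
  Hence every eventual property holds on discs of polynomially small radius, as Cauchy's inequality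
  and analyticity require.\<close>

lemma eventually_tubes_ball:
  assumes "eventually P (tubes \<theta>)"
  obtains k where "\<forall>\<^sub>F z in tubes \<theta>. \<forall>y\<in>ball z (1 / norm z ^ k). P y"
proof -
  obtain k where k: "\<And>z. z \<in> tube \<theta> k \<Longrightarrow> P z" using assms by (auto simp: eventually_tubes)
  have "P y" if z: "z \<in> tube \<theta> (Suc k)" and y: "y \<in> ball z (1 / norm z ^ (2 * Suc k))" for y z
  proof -
    obtain r where r: "r \<ge> real (Suc k) + 3" "dist z (of_real r * cis \<theta>) < 1 / r ^ Suc k" "\<bar>norm z - r\<bar> < 1"
      using z by (rule tube_norm)
    \<comment> \<open>Powers of \<open>r\<close> are traded for powers of
      \<open>norm z > r - 1\<close>. This uses \<open>r \<ge> 3\<close>, which is guaranteed by the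
      offset 3 in \<open>tube\<close>.\<close>
    have "r \<le> (r - 1)\<^sup>2"
    proof -
      have "(r - 1)\<^sup>2 - r = r * (r - 3) + 1" by (simp add: power2_eq_square algebra_simps)
      moreover have "r * (r - 3) \<ge> 0" using r by simp
      ultimately show ?thesis by linarith
    qed
    also have "\<dots> \<le> (norm z)\<^sup>2" using r by (intro power_mono) auto
    finally have "r ^ Suc k \<le> ((norm z)\<^sup>2) ^ Suc k" using r by (intro power_mono) auto
    hence "r ^ Suc k \<le> norm z ^ (2 * Suc k)" by (simp only: power_mult)
    hence "1 / norm z ^ (2 * Suc k) \<le> 1 / r ^ Suc k"
      using r by (intro divide_left_mono mult_pos_pos zero_less_power) auto
    have "dist y (of_real r * cis \<theta>) \<le> dist z y + dist z (of_real r * cis \<theta>)"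
      by (metis dist_commute dist_triangle)
    have "dist y (of_real r * cis \<theta>) < 2 / r ^ Suc k"
    proof -
      have "2 / r ^ Suc k = 1 / r ^ Suc k + 1 / r ^ Suc k" by simp
      moreover have "dist z y < 1 / norm z ^ (2 * Suc k)" using y by simp
      ultimately show ?thesis using r(2) \<open>1 / norm z ^ (2 * Suc k) \<le> 1 / r ^ Suc k\<close>
        \<open>dist y (of_real r * cis \<theta>) \<le> dist z y + dist z (of_real r * cis \<theta>)\<close> by linarith
    qed
    also have "\<dots> \<le> 1 / r ^ k" using r by (simp add: field_simps)
    finally show ?thesis using r by (intro k) (auto simp: tube_def intro!: exI[of _ r])
  qed
  hence "\<forall>\<^sub>F z in tubes \<theta>. \<forall>y\<in>ball z (1 / norm z ^ (2 * Suc k)). P y"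
    unfolding eventually_tubes by blast
  thus ?thesis using that by blast
qed

lemma tendsto_sgn_tubes: "((\<lambda>z. sgn z) \<longlongrightarrow> cis \<theta>) (tubes \<theta>)"
proof (rule Lim_transform[OF tendsto_const], rule Lim_null_comparison)
  show "((\<lambda>z. 2 / norm z) \<longlongrightarrow> 0) (tubes \<theta>)"
    by (intro real_tendsto_divide_at_top[OF tendsto_const] filterlim_norm_tubes)
  have "norm (sgn z - cis \<theta>) \<le> 2 / norm z" if z: "z \<in> tube \<theta> 0" for z
  proof -
    obtain r where r: "r \<ge> 3" "dist z (of_real r * cis \<theta>) < 1" "\<bar>norm z - r\<bar> < 1"
      using tube_norm[OF z] by auto
    have z0: "norm z > 0" using r by auto
    have "of_real (norm z) * (sgn z - cis \<theta>) = (z - of_real r * cis \<theta>) + of_real (r - norm z) * cis \<theta>"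
      using z0 by (simp add: sgn_eq algebra_simps)
    hence "norm z * norm (sgn z - cis \<theta>) = norm ((z - of_real r * cis \<theta>) + of_real (r - norm z) * cis \<theta>)"
      by (metis norm_mult norm_of_real abs_norm_cancel)
    also have "\<dots> \<le> 1 + 1"
      using r by (intro norm_triangle_le add_mono) (auto simp: dist_norm norm_mult simp del: of_real_diff)
    finally show ?thesis using z0 by (simp add: field_simps)
  qed
  thus "\<forall>\<^sub>F z in tubes \<theta>. norm (sgn z - cis \<theta>) \<le> 2 / norm z"
    by (auto simp: eventually_tubes)
qed

text \<open>Analyticity is included so that the class is closed under \<open>deriv\<close> as well
  as under the ring operations.\<close>

definition moderate :: "real \<Rightarrow> (complex \<Rightarrow> complex) \<Rightarrow> bool" where
  "moderate \<theta> g \<longleftrightarrow> (\<forall>\<^sub>F z in tubes \<theta>. g analytic_on {z}) \<and>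
     (\<exists>k. \<forall>\<^sub>F z in tubes \<theta>. norm (g z) \<le> norm z ^ k)"

text \<open>Stands in for exponential smallness: an error class that absorbs every moderate
  factor.\<close>

definition tiny :: "real \<Rightarrow> (complex \<Rightarrow> complex) \<Rightarrow> bool" where
  "tiny \<theta> g \<longleftrightarrow> (\<forall>k. ((\<lambda>z. z ^ k * g z) \<longlongrightarrow> 0) (tubes \<theta>))"

lemma moderateE:
  assumes "moderate \<theta> g"
  obtains k where "\<forall>\<^sub>F z in tubes \<theta>. g analytic_on {z} \<and> norm (g z) \<le> norm z ^ k \<and> norm z \<ge> 2"
proof -
  obtain k where "\<forall>\<^sub>F z in tubes \<theta>. norm (g z) \<le> norm z ^ k"
    using assms by (auto simp: moderate_def)
  hence "\<forall>\<^sub>F z in tubes \<theta>. g analytic_on {z} \<and> norm (g z) \<le> norm z ^ k \<and> norm z \<ge> 2"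
    using assms tubes_norm_ge[of 2 \<theta>] by (auto simp: moderate_def intro: eventually_conj)
  thus ?thesis using that by blast
qed

lemma moderateI:
  assumes "\<forall>\<^sub>F z in tubes \<theta>. g analytic_on {z} \<and> norm (g z) \<le> C * norm z ^ k"
  shows "moderate \<theta> g"
proof -
  have "\<forall>\<^sub>F z in tubes \<theta>. norm (g z) \<le> norm z ^ Suc k"
    using assms tubes_norm_ge[of C \<theta>]
  proof eventually_elim
    case (elim z)
    have "C * norm z ^ k \<le> norm z * norm z ^ k" using elim by (intro mult_right_mono) auto
    thus ?case using elim by simp
  qed
  moreover have "\<forall>\<^sub>F z in tubes \<theta>. g analytic_on {z}" using assms by eventually_elim auto
  ultimately show ?thesis unfolding moderate_def by blast
qed

lemma moderate_const: "moderate \<theta> (\<lambda>_. c)"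
  by (rule moderateI[where C = "norm c" and k = 0]) auto

lemma moderate_id: "moderate \<theta> (\<lambda>z. z)"
  by (rule moderateI[where C = 1 and k = 1]) auto

lemma moderate_add:
  assumes "moderate \<theta> f" "moderate \<theta> g"
  shows "moderate \<theta> (\<lambda>z. f z + g z)"
proof -
  obtain j where j: "\<forall>\<^sub>F z in tubes \<theta>. f analytic_on {z} \<and> norm (f z) \<le> norm z ^ j \<and> norm z \<ge> 2"
    using assms(1) by (rule moderateE)
  obtain k where k: "\<forall>\<^sub>F z in tubes \<theta>. g analytic_on {z} \<and> norm (g z) \<le> norm z ^ k \<and> norm z \<ge> 2"
    using assms(2) by (rule moderateE)
  show ?thesis
  proof (rule moderateI[where C = 2 and k = "max j k"])
    show "\<forall>\<^sub>F z in tubes \<theta>. (\<lambda>z. f z + g z) analytic_on {z} \<and> norm (f z + g z) \<le> 2 * norm z ^ max j k"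
      using j k
    proof eventually_elim
      case (elim z)
      have "norm z ^ j \<le> norm z ^ max j k" "norm z ^ k \<le> norm z ^ max j k"
        using elim by (auto intro!: power_increasing)
      moreover have "norm (f z + g z) \<le> norm (f z) + norm (g z)" by (rule norm_triangle_ineq)
      ultimately have "norm (f z + g z) \<le> 2 * norm z ^ max j k" using elim by linarith
      thus ?case using elim by (auto intro!: analytic_intros)
    qed
  qed
qed

lemma moderate_mult:
  assumes "moderate \<theta> f" "moderate \<theta> g"
  shows "moderate \<theta> (\<lambda>z. f z * g z)"
proof -
  obtain j where j: "\<forall>\<^sub>F z in tubes \<theta>. f analytic_on {z} \<and> norm (f z) \<le> norm z ^ j \<and> norm z \<ge> 2"
    using assms(1) by (rule moderateE)
  obtain k where k: "\<forall>\<^sub>F z in tubes \<theta>. g analytic_on {z} \<and> norm (g z) \<le> norm z ^ k \<and> norm z \<ge> 2"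
    using assms(2) by (rule moderateE)
  show ?thesis
  proof (rule moderateI[where C = 1 and k = "j + k"])
    show "\<forall>\<^sub>F z in tubes \<theta>. (\<lambda>z. f z * g z) analytic_on {z} \<and> norm (f z * g z) \<le> 1 * norm z ^ (j + k)"
      using j k
      by eventually_elim (auto intro!: analytic_intros mult_mono simp: norm_mult power_add)
  qed
qed

lemma moderate_uminus: "moderate \<theta> f \<Longrightarrow> moderate \<theta> (\<lambda>z. - f z)"
  using moderate_mult[OF moderate_const[of \<theta> "-1"], of f] by simp

lemma moderate_diff: "moderate \<theta> f \<Longrightarrow> moderate \<theta> g \<Longrightarrow> moderate \<theta> (\<lambda>z. f z - g z)"
  using moderate_add[OF _ moderate_uminus, of \<theta> f g] by simp

lemma moderate_power: "moderate \<theta> f \<Longrightarrow> moderate \<theta> (\<lambda>z. f z ^ n)"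
  by (induction n) (auto intro: moderate_mult moderate_const)

lemma moderate_poly: "moderate \<theta> (\<lambda>z. poly p z)"
  by (induction p) (auto intro!: moderate_add moderate_mult moderate_const moderate_id)

lemma moderate_cong:
  assumes "moderate \<theta> f" and eq: "\<forall>\<^sub>F z in tubes \<theta>. f z = g z"
  shows "moderate \<theta> g"
proof -
  obtain k where k: "\<forall>\<^sub>F z in tubes \<theta>. f analytic_on {z} \<and> norm (f z) \<le> norm z ^ k \<and> norm z \<ge> 2"
    using assms(1) by (rule moderateE)
  obtain j where j: "\<forall>\<^sub>F z in tubes \<theta>. \<forall>y\<in>ball z (1 / norm z ^ j). f y = g y"
    using eventually_tubes_ball[OF eq] .
  show ?thesis
  proof (rule moderateI[where C = 1 and k = k])
    show "\<forall>\<^sub>F z in tubes \<theta>. g analytic_on {z} \<and> norm (g z) \<le> 1 * norm z ^ k"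
      using k j
    proof eventually_elim
      case (elim z)
      hence r: "1 / norm z ^ j > 0" by (intro divide_pos_pos zero_less_power) auto
      have "f analytic_on {z} \<longleftrightarrow> g analytic_on {z}"
      proof (rule analytic_at_cong)
        show "\<forall>\<^sub>F x in nhds z. f x = g x"
          using eventually_nhds_in_open[of "ball z (1 / norm z ^ j)" z] r elim
          by (auto elim!: eventually_mono)
      qed auto
      moreover have "f z = g z" using elim r by (metis centre_in_ball)
      ultimately show ?case using elim by auto
    qed
  qed
qed

lemma moderate_deriv:
  assumes "moderate \<theta> f"
  shows "moderate \<theta> (deriv f)"
proof -
  obtain k where k: "\<forall>\<^sub>F z in tubes \<theta>. f analytic_on {z} \<and> norm (f z) \<le> norm z ^ k \<and> norm z \<ge> 2"
    using assms(1) by (rule moderateE)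
  obtain j where j: "\<forall>\<^sub>F z in tubes \<theta>. \<forall>y\<in>ball z (1 / norm z ^ j).
      f analytic_on {y} \<and> norm (f y) \<le> norm y ^ k \<and> norm y \<ge> 2"
    using eventually_tubes_ball[OF k] .
  show ?thesis
  proof (rule moderateI[where C = 2 and k = "2 * k + j"])
    show "\<forall>\<^sub>F z in tubes \<theta>. deriv f analytic_on {z} \<and> norm (deriv f z) \<le> 2 * norm z ^ (2 * k + j)"
      using k j
    proof eventually_elim
      case (elim z)
      define d where "d = 1 / (2 * norm z ^ j)"
      have "norm z ^ j \<ge> 1" using elim by (intro one_le_power) auto
      hence d: "d > 0" "d < 1 / norm z ^ j" "d \<le> 1"
        by (auto simp: d_def intro!: divide_strict_left_mono divide_pos_pos mult_pos_pos)
      have sub: "cball z d \<subseteq> ball z (1 / norm z ^ j)" using d by auto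
      have "f analytic_on ball z (1 / norm z ^ j)"
        using elim by (subst analytic_on_analytic_at) auto
      hence hol: "f holomorphic_on ball z (1 / norm z ^ j)" by (rule analytic_imp_holomorphic)
      have "norm ((deriv ^^ 1) f z) \<le> fact 1 * (norm z ^ (2 * k)) / d ^ 1"
      proof (rule Cauchy_inequality)
        show "f holomorphic_on ball z d"
          using holomorphic_on_subset[OF hol] sub by (meson ball_subset_cball order_trans)
        show "continuous_on (cball z d) f"
          using holomorphic_on_imp_continuous_on[OF holomorphic_on_subset[OF hol sub]] .
        fix y assume y: "norm (z - y) = d"
        hence "y \<in> ball z (1 / norm z ^ j)" using d by (simp add: dist_norm)
        hence "norm (f y) \<le> norm y ^ k" using elim by blast
        also have "norm y \<le> norm z + 1"
          using y d norm_triangle_ineq2[of y z] by (simp add: norm_minus_commute)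
        hence "norm y ^ k \<le> ((norm z)\<^sup>2) ^ k"
        proof (intro power_mono)
          assume "norm y \<le> norm z + 1"
          also have "\<dots> \<le> norm z * 2" using elim by simp
          also have "\<dots> \<le> norm z * norm z" using elim by (intro mult_left_mono) auto
          finally show "norm y \<le> (norm z)\<^sup>2" by (simp add: power2_eq_square)
        qed auto
        finally show "norm (f y) \<le> norm z ^ (2 * k)" by (simp add: power_mult)
      qed (use d in auto)
      hence "norm (deriv f z) \<le> 2 * norm z ^ (2 * k + j)"
        by (simp add: d_def power_add mult_ac)
      thus ?case using elim by (auto intro: analytic_deriv)
    qed
  qed
qed

lemma moderate_inverse:
  assumes "moderate \<theta> f" and c: "c > 0" and ge: "\<forall>\<^sub>F z in tubes \<theta>. norm (f z) \<ge> c"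
  shows "moderate \<theta> (\<lambda>z. inverse (f z))"
proof -
  obtain k where k: "\<forall>\<^sub>F z in tubes \<theta>. f analytic_on {z} \<and> norm (f z) \<le> norm z ^ k \<and> norm z \<ge> 2"
    using assms(1) by (rule moderateE)
  show ?thesis
  proof (rule moderateI[where C = "1 / c" and k = 0])
    show "\<forall>\<^sub>F z in tubes \<theta>. (\<lambda>z. inverse (f z)) analytic_on {z} \<and> norm (inverse (f z)) \<le> 1 / c * norm z ^ 0"
      using k ge
    proof eventually_elim
      case (elim z)
      hence "f z \<noteq> 0" using c by auto
      moreover have "norm (inverse (f z)) \<le> 1 / c"
        using elim c by (simp add: norm_divide inverse_eq_divide frac_le)
      ultimately show ?case using elim by (auto intro!: analytic_on_inverse)
    qed
  qed
qed

lemma poly_bounded_below: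
  fixes p :: "complex poly"
  assumes "p \<noteq> 0"
  obtains c where "c > 0" "\<forall>\<^sub>F z in at_infinity. norm (poly p z) \<ge> c"
proof -
  define c where "c = norm (lead_coeff p) / 2"
  have c: "c > 0" using assms by (simp add: c_def)
  have "((\<lambda>z. norm (poly p z / z ^ degree p)) \<longlongrightarrow> norm (lead_coeff p)) at_infinity"
    by (intro tendsto_norm leading_imp_tendsto leading_degree)
  hence "\<forall>\<^sub>F z in at_infinity. norm (poly p z / z ^ degree p) > c"
    by (rule order_tendstoD) (use assms in \<open>auto simp: c_def\<close>)
  moreover have "\<forall>\<^sub>F z in at_infinity. norm (z::complex) \<ge> 1" by (auto simp: eventually_at_infinity)
  ultimately have "\<forall>\<^sub>F z in at_infinity. norm (poly p z) \<ge> c"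
  proof eventually_elim
    case (elim z)
    hence "c * 1 \<le> c * norm z ^ degree p" using c by (intro mult_left_mono one_le_power) auto
    also have "\<dots> \<le> norm (poly p z)"
    proof -
      have "norm z ^ degree p > 0" using elim by (intro zero_less_power) auto
      thus ?thesis using elim by (simp add: norm_divide norm_power less_divide_eq)
    qed
    finally show ?case by simp
  qed
  thus ?thesis using that c by blast
qed

lemma tubes_poly_nonzero: "p \<noteq> 0 \<Longrightarrow> \<forall>\<^sub>F z in tubes \<theta>. poly p z \<noteq> 0"
  using poly_bounded_below[of p] filter_leD[OF tubes_le_at_infinity]
  by (metis (mono_tags, lifting) eventually_mono norm_zero not_le)

lemma moderate_inverse_poly: "p \<noteq> 0 \<Longrightarrow> moderate \<theta> (\<lambda>z. inverse (poly p z))"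
  using poly_bounded_below[of p] filter_leD[OF tubes_le_at_infinity] moderate_inverse[OF moderate_poly]
  by metis

lemma tiny_imp_tendsto: "tiny \<theta> g \<Longrightarrow> (g \<longlongrightarrow> 0) (tubes \<theta>)"
  by (auto simp: tiny_def dest!: spec[of _ 0])

lemma tiny_mult:
  assumes "tiny \<theta> g" "moderate \<theta> f"
  shows "tiny \<theta> (\<lambda>z. g z * f z)"
  unfolding tiny_def
proof
  fix i
  obtain k where k: "\<forall>\<^sub>F z in tubes \<theta>. f analytic_on {z} \<and> norm (f z) \<le> norm z ^ k \<and> norm z \<ge> 2"
    using assms(2) by (rule moderateE)
  show "((\<lambda>z. z ^ i * (g z * f z)) \<longlongrightarrow> 0) (tubes \<theta>)"
  proof (rule Lim_null_comparison)
    show "((\<lambda>z. norm (z ^ (i + k) * g z)) \<longlongrightarrow> 0) (tubes \<theta>)"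
      using assms(1) unfolding tiny_def by (intro tendsto_norm_zero) blast
    show "\<forall>\<^sub>F z in tubes \<theta>. norm (z ^ i * (g z * f z)) \<le> norm (z ^ (i + k) * g z)"
      using k
    proof eventually_elim
      case (elim z)
      have "norm z ^ i * norm (g z) * norm (f z) \<le> norm z ^ i * norm (g z) * norm z ^ k"
        using elim by (intro mult_left_mono) auto
      thus ?case by (simp add: norm_mult norm_power power_add mult_ac)
    qed
  qed
qed

lemma tiny_add: "tiny \<theta> f \<Longrightarrow> tiny \<theta> g \<Longrightarrow> tiny \<theta> (\<lambda>z. f z + g z)"
  unfolding tiny_def by (auto simp: algebra_simps intro: tendsto_add_zero)

lemma tiny_cong:
  assumes "tiny \<theta> f" "\<forall>\<^sub>F z in tubes \<theta>. f z = g z"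
  shows "tiny \<theta> g"
  unfolding tiny_def
proof
  fix k
  have "((\<lambda>z. z ^ k * f z) \<longlongrightarrow> 0) (tubes \<theta>)" using assms(1) by (auto simp: tiny_def)
  thus "((\<lambda>z. z ^ k * g z) \<longlongrightarrow> 0) (tubes \<theta>)"
    by (rule Lim_transform_eventually) (use assms(2) in \<open>auto elim: eventually_mono\<close>)
qed

text \<open>In thin tubes \<open>sgn z\<close> tends to \<open>cis \<theta>\<close>, so the real
  part divided by \<open>norm z ^ n\<close> tends to \<open>a * cos (n * \<theta>)\<close>; half of
  that limit serves as \<open>\<mu>\<close>.\<close>

lemma Re_power_tubes:
  assumes "a * cos (real n * \<theta>) > 0"
  obtains \<mu> where "\<mu> > 0" "\<forall>\<^sub>F z in tubes \<theta>. Re (of_real a * z ^ n) \<ge> \<mu> * norm z ^ n"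
proof -
  define \<mu> where "\<mu> = a * cos (real n * \<theta>) / 2"
  have \<mu>: "\<mu> > 0" using assms by (simp add: \<mu>_def)
  have "((\<lambda>z. Re (of_real a * sgn z ^ n)) \<longlongrightarrow> Re (of_real a * cis \<theta> ^ n)) (tubes \<theta>)"
    by (intro tendsto_intros tendsto_sgn_tubes)
  hence "\<forall>\<^sub>F z in tubes \<theta>. Re (of_real a * sgn z ^ n) > \<mu>"
    by (rule order_tendstoD) (use assms in \<open>auto simp: \<mu>_def Complex.DeMoivre\<close>)
  hence "\<forall>\<^sub>F z in tubes \<theta>. Re (of_real a * z ^ n) \<ge> \<mu> * norm z ^ n"
    using tubes_norm_ge[of 1 \<theta>]
  proof eventually_elim
    case (elim z)
    have "z ^ n = of_real (norm z ^ n) * sgn z ^ n"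
      using elim by (simp add: sgn_eq power_divide)
    hence "Re (of_real a * z ^ n) = norm z ^ n * Re (of_real a * sgn z ^ n)"
      by (simp add: mult_ac del: of_real_power)
    also have "\<dots> \<ge> norm z ^ n * \<mu>" using elim by (intro mult_left_mono) auto
    finally show ?case by (simp add: mult_ac)
  qed
  thus ?thesis using that \<mu> by blast
qed

lemma
  assumes n: "n > 0" and b: "b * cos (real n * \<theta>) < 0"
  shows tiny_exp: "tiny \<theta> (\<lambda>z. exp (of_real b * z ^ n))"
    and moderate_exp: "moderate \<theta> (\<lambda>z. exp (of_real b * z ^ n))"
    and norm_exp_le_1: "\<forall>\<^sub>F z in tubes \<theta>. norm (exp (of_real b * z ^ n)) \<le> 1"
proof -
  obtain \<mu> where \<mu>: "\<mu> > 0" "\<forall>\<^sub>F z in tubes \<theta>. Re (of_real (- b) * z ^ n) \<ge> \<mu> * norm z ^ n"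
    using Re_power_tubes[of "-b" n \<theta>] b by auto
  have le: "\<forall>\<^sub>F z in tubes \<theta>. norm (exp (of_real b * z ^ n)) \<le> exp (- (\<mu> * norm z))"
    using \<mu>(2) tubes_norm_ge[of 1 \<theta>]
  proof eventually_elim
    case (elim z)
    have "norm z ^ 1 \<le> norm z ^ n" using elim n by (intro power_increasing) auto
    hence "\<mu> * norm z \<le> \<mu> * norm z ^ n" using \<mu> by simp
    thus ?case using elim by simp
  qed
  show 1: "\<forall>\<^sub>F z in tubes \<theta>. norm (exp (of_real b * z ^ n)) \<le> 1"
    using le
  proof eventually_elim
    case (elim z)
    have "exp (- (\<mu> * norm z)) \<le> 1" using \<mu> by simp
    thus ?case using elim by linarith
  qed
  show "moderate \<theta> (\<lambda>z. exp (of_real b * z ^ n))"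
  proof (rule moderateI[where C = 1 and k = 0])
    show "\<forall>\<^sub>F z in tubes \<theta>. (\<lambda>z. exp (of_real b * z ^ n)) analytic_on {z} \<and>
        norm (exp (of_real b * z ^ n)) \<le> 1 * norm z ^ 0"
      using 1 by eventually_elim (auto intro!: analytic_intros)
  qed
  show "tiny \<theta> (\<lambda>z. exp (of_real b * z ^ n))"
    unfolding tiny_def
  proof
    fix k
    have lim: "filterlim (\<lambda>z. \<mu> * norm z) at_top (tubes \<theta>)"
      using \<mu> by (intro filterlim_tendsto_pos_mult_at_top[OF tendsto_const] filterlim_norm_tubes)
    have "((\<lambda>z. (\<mu> * norm z) ^ k / exp (\<mu> * norm z)) \<longlongrightarrow> 0) (tubes \<theta>)"
      by (rule filterlim_compose[OF tendsto_power_div_exp_0 lim])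
    hence "((\<lambda>z. (1 / \<mu> ^ k) * ((\<mu> * norm z) ^ k / exp (\<mu> * norm z))) \<longlongrightarrow> (1 / \<mu> ^ k) * 0) (tubes \<theta>)"
      by (intro tendsto_intros)
    hence lim0: "((\<lambda>z. norm z ^ k * exp (- (\<mu> * norm z))) \<longlongrightarrow> 0) (tubes \<theta>)"
      using \<mu> by (simp add: power_mult_distrib exp_minus field_simps)
    show "((\<lambda>z. z ^ k * exp (of_real b * z ^ n)) \<longlongrightarrow> 0) (tubes \<theta>)"
      by (rule Lim_null_comparison[OF _ lim0])
         (use le in \<open>auto simp: norm_mult norm_power simp del: norm_exp_eq_Re intro!: mult_left_mono elim!: eventually_mono\<close>)
  qed
qed

section \<open>The differential operator of the leading exponential terms\<close>

text \<open>The differential equations are solved in one real variable, hence on the ray itself.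
  Tubes serve for differentiating bounds, and what holds eventually on tubes restricts to the
  ray.\<close>

definition ray :: "real \<Rightarrow> complex filter" where
  "ray \<theta> = filtermap (\<lambda>r. of_real r * cis \<theta>) at_top"

lemma ray_le_tubes: "ray \<theta> \<le> tubes \<theta>"
  using filterlim_ray unfolding ray_def filterlim_def .

lemma eventually_ray: "eventually P (ray \<theta>) \<longleftrightarrow> (\<forall>\<^sub>F r in at_top. P (of_real r * cis \<theta>))"
  by (simp add: ray_def eventually_filtermap)

lemma tendsto_ray: "(f \<longlongrightarrow> l) (ray \<theta>) \<longleftrightarrow> ((\<lambda>r. f (of_real r * cis \<theta>)) \<longlongrightarrow> l) at_top"
  by (simp add: ray_def filterlim_filtermap)

lemma eventually_tubes_ray: "eventually P (tubes \<theta>) \<Longrightarrow> eventually P (ray \<theta>)"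
  using ray_le_tubes filter_leD by blast

lemma ray_le_at_infinity: "ray \<theta> \<le> at_infinity"
  using ray_le_tubes tubes_le_at_infinity order_trans by blast

lemma ray_neq_bot [simp]: "ray \<theta> \<noteq> bot"
  by (simp add: ray_def filtermap_bot_iff)

lemma has_vector_derivative_ray:
  assumes "(g has_field_derivative D) (at (of_real r * cis \<theta>))"
  shows "((\<lambda>r. g (of_real r * cis \<theta>)) has_vector_derivative (cis \<theta> * D)) (at r)"
proof -
  have "((\<lambda>r. of_real r * cis \<theta>) has_vector_derivative (of_real 1 * cis \<theta>)) (at r)"
    by (intro has_vector_derivative_mult_left has_vector_derivative_of_real DERIV_ident)
  from field_vector_diff_chain_at[OF this assms] show ?thesis
    by (simp add: o_def)
qed

text \<open>Differentiation in \<open>r\<close> brings a factor \<open>cis \<theta>\<close>, so a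
  coefficient \<open>L * z ^ N\<close> acts as \<open>L * r ^ N * cis ((N + 1) * \<theta>)\<close>.
  The sign of its real part decides between the stable and the unstable case.\<close>

lemma tendsto_ray_rate:
  assumes "((\<lambda>z. M z / z ^ N) \<longlongrightarrow> of_real L) (ray \<theta>)"
  shows "((\<lambda>r. Re (cis \<theta> * M (of_real r * cis \<theta>)) / r ^ N) \<longlongrightarrow> L * cos (real (Suc N) * \<theta>)) at_top"
proof -
  have lim: "((\<lambda>r. Re (cis \<theta> ^ Suc N * (M (of_real r * cis \<theta>) / (of_real r * cis \<theta>) ^ N))) \<longlongrightarrow> Re (cis \<theta> ^ Suc N * of_real L)) at_top"
    using assms unfolding tendsto_ray by (intro tendsto_intros)
  have eq: "Re (cis \<theta> ^ Suc N * of_real L) = L * cos (real (Suc N) * \<theta>)"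
    by (simp add: Complex.DeMoivre del: power_Suc of_nat_Suc)
  have ev: "\<forall>\<^sub>F r in at_top. Re (cis \<theta> ^ Suc N * (M (of_real r * cis \<theta>) / (of_real r * cis \<theta>) ^ N)) =
      Re (cis \<theta> * M (of_real r * cis \<theta>)) / r ^ N"
    using eventually_gt_at_top[of 0]
  proof eventually_elim
    case (elim r)
    have "cis \<theta> ^ Suc N * (M (of_real r * cis \<theta>) / (of_real r * cis \<theta>) ^ N) =
        cis \<theta> * M (of_real r * cis \<theta>) / of_real (r ^ N)"
      using elim by (simp add: power_mult_distrib)
    thus ?case by (simp only: Re_divide_of_real)
  qed
  show ?thesis using Lim_transform_eventually[OF lim ev] unfolding eq .
qed

lemma tendsto_ray_rate_0:
  assumes "((\<lambda>z. \<rho> z / z ^ N) \<longlongrightarrow> 0) (ray \<theta>)"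
  shows "((\<lambda>r. cis \<theta> * \<rho> (of_real r * cis \<theta>) / of_real (r ^ N)) \<longlongrightarrow> 0) at_top"
proof (rule tendsto_norm_zero_cancel)
  have "((\<lambda>r. norm (\<rho> (of_real r * cis \<theta>) / (of_real r * cis \<theta>) ^ N)) \<longlongrightarrow> 0) at_top"
    using assms unfolding tendsto_ray by (rule tendsto_norm_zero)
  thus "((\<lambda>r. norm (cis \<theta> * \<rho> (of_real r * cis \<theta>) / of_real (r ^ N))) \<longlongrightarrow> 0) at_top"
    by (simp add: norm_mult norm_divide norm_power)
qed

lemma ray_ode_stable:
  assumes ode: "\<forall>\<^sub>F z in ray \<theta>. (g has_field_derivative (M z * g z + \<rho> z)) (at z)"
    and M: "((\<lambda>z. M z / z ^ N) \<longlongrightarrow> of_real L) (ray \<theta>)" and L: "L * cos (real (Suc N) * \<theta>) < 0"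
    and \<rho>: "((\<lambda>z. \<rho> z / z ^ N) \<longlongrightarrow> 0) (ray \<theta>)"
  shows "(g \<longlongrightarrow> 0) (ray \<theta>)"
  unfolding tendsto_ray
proof (rule linear_ode_stable_tendsto_0[where k = N and \<mu> = "- (L * cos (real (Suc N) * \<theta>)) / 2"
      and m = "\<lambda>r. cis \<theta> * M (of_real r * cis \<theta>)"])
  show "\<forall>\<^sub>F r in at_top. ((\<lambda>r. g (of_real r * cis \<theta>)) has_vector_derivative
      cis \<theta> * M (of_real r * cis \<theta>) * g (of_real r * cis \<theta>) + cis \<theta> * \<rho> (of_real r * cis \<theta>)) (at r)"
    using ode unfolding eventually_ray
    by eventually_elim (drule has_vector_derivative_ray, simp add: algebra_simps)
  have "\<forall>\<^sub>F r in at_top. Re (cis \<theta> * M (of_real r * cis \<theta>)) / r ^ N < L * cos (real (Suc N) * \<theta>) / 2"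
    using L by (intro order_tendstoD[OF tendsto_ray_rate[OF M]]) simp
  thus "\<forall>\<^sub>F r in at_top. Re (cis \<theta> * M (of_real r * cis \<theta>)) \<le> - (- (L * cos (real (Suc N) * \<theta>)) / 2) * r ^ N"
    using eventually_gt_at_top[of 0]
    by eventually_elim (simp add: divide_less_eq)
qed (use L tendsto_ray_rate_0[OF \<rho>] in auto)

lemma ray_ode_unstable:
  assumes ode: "\<forall>\<^sub>F z in ray \<theta>. (g has_field_derivative (M z * g z + \<rho> z)) (at z)"
    and M: "((\<lambda>z. M z / z ^ N) \<longlongrightarrow> of_real L) (ray \<theta>)" and L: "L * cos (real (Suc N) * \<theta>) > 0"
    and \<rho>: "((\<lambda>z. \<rho> z / z ^ N) \<longlongrightarrow> 0) (ray \<theta>)"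
    and g: "\<forall>\<^sub>F z in ray \<theta>. norm (g z) \<le> norm z ^ j"
  shows "(g \<longlongrightarrow> 0) (ray \<theta>)"
  unfolding tendsto_ray
proof (rule linear_ode_unstable_tendsto_0[where k = N and j = j and \<mu> = "L * cos (real (Suc N) * \<theta>) / 2"
      and m = "\<lambda>r. cis \<theta> * M (of_real r * cis \<theta>)"])
  show "\<forall>\<^sub>F r in at_top. ((\<lambda>r. g (of_real r * cis \<theta>)) has_vector_derivative
      cis \<theta> * M (of_real r * cis \<theta>) * g (of_real r * cis \<theta>) + cis \<theta> * \<rho> (of_real r * cis \<theta>)) (at r)"
    using ode unfolding eventually_ray
    by eventually_elim (drule has_vector_derivative_ray, simp add: algebra_simps)
  have "\<forall>\<^sub>F r in at_top. Re (cis \<theta> * M (of_real r * cis \<theta>)) / r ^ N > L * cos (real (Suc N) * \<theta>) / 2"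
    using L by (intro order_tendstoD[OF tendsto_ray_rate[OF M]]) simp
  thus "\<forall>\<^sub>F r in at_top. Re (cis \<theta> * M (of_real r * cis \<theta>)) \<ge> L * cos (real (Suc N) * \<theta>) / 2 * r ^ N"
    using eventually_gt_at_top[of 0]
    by eventually_elim (simp add: less_divide_eq)
  show "\<forall>\<^sub>F r in at_top. norm (g (of_real r * cis \<theta>)) \<le> r ^ j"
    using g[unfolded eventually_ray] eventually_gt_at_top[of 0]
    by eventually_elim (simp add: norm_mult)
qed (use L tendsto_ray_rate_0[OF \<rho>] in auto)

text \<open>
  With \<open>y = sqrt (P * exp (a * z ^ Suc N))\<close> one has \<open>y' = wkb_q N a P / (2 * P) * y\<close> and
  \<open>y'' = wkb_s N a P / (4 * P\<^sup>2) * y\<close>.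
\<close>

definition wkb_q :: "nat \<Rightarrow> real \<Rightarrow> complex poly \<Rightarrow> complex poly" where
  "wkb_q N a P = pderiv P + monom (of_nat (Suc N) * of_real a) N * P"

definition wkb_s :: "nat \<Rightarrow> real \<Rightarrow> complex poly \<Rightarrow> complex poly" where
  "wkb_s N a P = [:2:] * (P * pderiv (wkb_q N a P)) - [:2:] * (pderiv P * wkb_q N a P) + wkb_q N a P * wkb_q N a P"

text \<open>
  The differential operator with coefficients \<open>wkb_k0\<close>, \<open>wkb_k1\<close>, \<open>wkb_k2\<close> annihilates both
  \<open>sqrt (P1 * exp (a * z ^ Suc N))\<close> and \<open>sqrt (P2 * exp (b * z ^ Suc N))\<close>.
\<close>

definition wkb_k0 :: "nat \<Rightarrow> real \<Rightarrow> real \<Rightarrow> complex poly \<Rightarrow> complex poly \<Rightarrow> complex poly" where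
  "wkb_k0 N a b P1 P2 = wkb_q N a P1 * wkb_s N b P2 * P1 - wkb_q N b P2 * wkb_s N a P1 * P2"

definition wkb_k1 :: "nat \<Rightarrow> real \<Rightarrow> real \<Rightarrow> complex poly \<Rightarrow> complex poly \<Rightarrow> complex poly" where
  "wkb_k1 N a b P1 P2 = [:-2:] * (wkb_s N b P2 * (P1 * P1) - wkb_s N a P1 * (P2 * P2))"

definition wkb_k2 :: "nat \<Rightarrow> real \<Rightarrow> real \<Rightarrow> complex poly \<Rightarrow> complex poly \<Rightarrow> complex poly" where
  "wkb_k2 N a b P1 P2 = [:4:] * (P1 * P2 * (wkb_q N b P2 * P1 - wkb_q N a P1 * P2))"

definition wkb_V :: "nat \<Rightarrow> real \<Rightarrow> real \<Rightarrow> complex poly \<Rightarrow> complex poly \<Rightarrow> (complex \<Rightarrow> complex) \<Rightarrow> complex \<Rightarrow> complex" where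
  "wkb_V N a b P1 P2 w z = poly (wkb_k2 N a b P1 P2) z * deriv (deriv w) z +
     poly (wkb_k1 N a b P1 P2) z * deriv w z + poly (wkb_k0 N a b P1 P2) z * w z"

text \<open>The operator is the Wronskian determinant of \<open>y1\<close>, \<open>y2\<close> and
  \<open>w\<close>, divided by \<open>y1 * y2\<close> and multiplied by
  \<open>8 * P1^2 * P2^2\<close> to clear denominators. A determinant changes sign when two columns
  are exchanged.\<close>

lemma wkb_k_swap:
  "wkb_k0 N b a P2 P1 = - wkb_k0 N a b P1 P2"
  "wkb_k1 N b a P2 P1 = - wkb_k1 N a b P1 P2"
  "wkb_k2 N b a P2 P1 = - wkb_k2 N a b P1 P2"
  by (simp_all add: wkb_k0_def wkb_k1_def wkb_k2_def algebra_simps)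

lemma wkb_V_swap: "wkb_V N b a P2 P1 w z = - wkb_V N a b P1 P2 w z"
  by (simp add: wkb_V_def wkb_k_swap[of N b a])

text \<open>Together with \<open>wkb_\<beta>\<close> these are the coefficients of the left factor
  when the second order operator is split off \<open>wkb_u\<close>, the factor that annihilates
  \<open>y1\<close>. The solutions of \<open>\<alpha> * v' + \<beta> * v = 0\<close> are then the
  multiples of the image of \<open>y2\<close> under \<open>wkb_u\<close>.\<close>

definition wkb_\<alpha> :: "nat \<Rightarrow> real \<Rightarrow> real \<Rightarrow> complex poly \<Rightarrow> complex poly \<Rightarrow> complex poly" where
  "wkb_\<alpha> N a b P1 P2 = [:2:] * (P2 * (wkb_q N b P2 * P1 - wkb_q N a P1 * P2))"

definition wkb_\<beta> :: "nat \<Rightarrow> real \<Rightarrow> real \<Rightarrow> complex poly \<Rightarrow> complex poly \<Rightarrow> complex poly" where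
  "wkb_\<beta> N a b P1 P2 = - (wkb_s N b P2 * P1) + [:2:] * (P2 * P2 * pderiv (wkb_q N a P1)) -
     P2 * wkb_q N b P2 * ([:2:] * pderiv P1 - wkb_q N a P1)"

text \<open>Equals \<open>2 * P * y * (w / y)'\<close> for
  \<open>y = sqrt (P * exp (a * z ^ Suc N))\<close>, so it vanishes on both signs of the root and
  needs no choice of branch.\<close>

definition wkb_u :: "nat \<Rightarrow> real \<Rightarrow> complex poly \<Rightarrow> (complex \<Rightarrow> complex) \<Rightarrow> complex \<Rightarrow> complex" where
  "wkb_u N a P w z = 2 * poly P z * deriv w z - poly (wkb_q N a P) z * w z"

lemma wkb_u_has_field_derivative:
  assumes "w analytic_on {z}"
  shows "(wkb_u N a P w has_field_derivative
    (2 * poly (pderiv P) z * deriv w z + 2 * poly P z * deriv (deriv w) z -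
     poly (pderiv (wkb_q N a P)) z * w z - poly (wkb_q N a P) z * deriv w z)) (at z)"
proof -
  have "(w has_field_derivative deriv w z) (at z)" "(deriv w has_field_derivative deriv (deriv w) z) (at z)"
    using assms analytic_deriv[OF assms] analytic_on_imp_differentiable_at DERIV_deriv_iff_field_differentiable by blast+
  thus ?thesis
    unfolding wkb_u_def by (auto intro!: derivative_eq_intros simp: algebra_simps)
qed

lemma wkb_V_factor:
  assumes "w analytic_on {z}"
  shows "wkb_V N a b P1 P2 w z = poly (wkb_\<alpha> N a b P1 P2) z * deriv (wkb_u N a P1 w) z +
           poly (wkb_\<beta> N a b P1 P2) z * wkb_u N a P1 w z"
  unfolding DERIV_imp_deriv[OF wkb_u_has_field_derivative[OF assms]]
  by (simp add: wkb_V_def wkb_k0_def wkb_k1_def wkb_k2_def wkb_\<alpha>_def wkb_\<beta>_def wkb_u_def wkb_s_def algebra_simps)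

lemma leading_scalar: "leading p d l \<Longrightarrow> leading ([:c:] * p) d (c * l)"
  using leading_mult[of "[:c:]" 0 c p d l] by (simp add: leading_def)

lemma leading_wkb_q:
  assumes "leading P d l"
  shows "leading (wkb_q N a P) (N + d) (of_nat (Suc N) * of_real a * l)"
  unfolding wkb_q_def
  using leading_add[OF leading_weaken'[OF leading_pderiv[OF assms], of "N + d"]
      leading_mult[OF leading_monom assms, of "of_nat (Suc N) * of_real a" N]]
  by simp

lemma leading_wkb_s:
  assumes "leading P d l"
  shows "leading (wkb_s N a P) (2 * N + 2 * d) ((of_nat (Suc N) * of_real a * l)\<^sup>2)"
proof -
  note q = leading_wkb_q[OF assms, of N a]
  have 1: "leading (P * pderiv (wkb_q N a P)) (2 * N + 2 * d) 0"
    using leading_weaken'[of _ "d + (N + d)"] leading_mult[OF assms leading_pderiv[OF q]] by simp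
  have 2: "leading (pderiv P * wkb_q N a P) (2 * N + 2 * d) 0"
    using leading_weaken'[of _ "d + (N + d)"] leading_mult[OF leading_pderiv[OF assms] q] by simp
  have 3: "leading (wkb_q N a P * wkb_q N a P) (2 * N + 2 * d) ((of_nat (Suc N) * of_real a * l)\<^sup>2)"
    using leading_mult[OF q q] by (simp add: power2_eq_square mult_2 add_ac)
  show ?thesis
    unfolding wkb_s_def using leading_add[OF leading_diff[OF leading_scalar[OF 1, of 2] leading_scalar[OF 2, of 2]] 3] by simp
qed

text \<open>The two products in \<open>wkb_k0\<close> contribute \<open>a * b^2\<close> and
  \<open>a^2 * b\<close>, so the leading coefficient survives for distinct nonzero exponents. The
  degrees of the other coefficients are those demanded by
  \<open>linear_differential_division\<close>.\<close>

lemma leading_wkb_k: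
  fixes N :: nat and a b :: real
  assumes P1: "leading P1 d1 l1" and P2: "leading P2 d2 l2"
  defines "D \<equiv> 3 * N + 2 * d1 + 2 * d2"
  shows "leading (wkb_k0 N a b P1 P2) D (of_nat (Suc N) ^ 3 * of_real (a * b * (b - a)) * l1\<^sup>2 * l2\<^sup>2)"
    and "degree (wkb_k1 N a b P1 P2) \<le> D" and "degree (wkb_k2 N a b P1 P2) \<le> Suc D"
proof -
  note q1 = leading_wkb_q[OF P1, of N a] and q2 = leading_wkb_q[OF P2, of N b]
  note s1 = leading_wkb_s[OF P1, of N a] and s2 = leading_wkb_s[OF P2, of N b]
  have D: "N + d1 + (2 * N + 2 * d2) + d1 = D" "N + d2 + (2 * N + 2 * d1) + d2 = D" by (simp_all add: D_def)
  show "leading (wkb_k0 N a b P1 P2) D (of_nat (Suc N) ^ 3 * of_real (a * b * (b - a)) * l1\<^sup>2 * l2\<^sup>2)"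
    using leading_diff[OF leading_mult[OF leading_mult[OF q1 s2] P1, unfolded D] leading_mult[OF leading_mult[OF q2 s1] P2, unfolded D]]
    unfolding wkb_k0_def[symmetric]
    by (simp add: power2_eq_square power3_eq_cube algebra_simps del: of_nat_Suc)
  have 1: "degree (wkb_s N b P2 * (P1 * P1)) \<le> D"
    using leading_mult[OF s2 leading_mult[OF P1 P1]] by (simp add: leading_def D_def)
  have 2: "degree (wkb_s N a P1 * (P2 * P2)) \<le> D"
    using leading_mult[OF s1 leading_mult[OF P2 P2]] by (simp add: leading_def D_def)
  show "degree (wkb_k1 N a b P1 P2) \<le> D"
    unfolding wkb_k1_def using 1 2 by (simp add: degree_diff_le)
  have 3: "leading (wkb_q N b P2 * P1 - wkb_q N a P1 * P2) (N + d1 + d2) (of_nat (Suc N) * of_real b * l2 * l1 - of_nat (Suc N) * of_real a * l1 * l2)"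
  proof (rule leading_diff)
    show "leading (wkb_q N b P2 * P1) (N + d1 + d2) (of_nat (Suc N) * of_real b * l2 * l1)"
      using leading_mult[OF q2 P1] by (simp add: add_ac)
    show "leading (wkb_q N a P1 * P2) (N + d1 + d2) (of_nat (Suc N) * of_real a * l1 * l2)"
      using leading_mult[OF q1 P2] by (simp add: add_ac)
  qed
  show "degree (wkb_k2 N a b P1 P2) \<le> Suc D"
    unfolding wkb_k2_def using leading_mult[OF leading_mult[OF P1 P2] 3] by (simp add: leading_def D_def)
qed

text \<open>The quotient gives \<open>- \<beta> / \<alpha> ~ (N + 1) * b / 2 * z ^ N\<close>, the
  exponential rate of \<open>y2\<close>.\<close>

lemma leading_wkb_factors:
  assumes P1: "leading P1 d1 l1" and P2: "leading P2 d2 l2"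
  shows "leading (wkb_\<alpha> N a b P1 P2) (N + d1 + 2 * d2) (2 * of_nat (Suc N) * of_real (b - a) * l1 * l2\<^sup>2)"
    and "leading (wkb_\<beta> N a b P1 P2) (2 * N + d1 + 2 * d2) (of_nat (Suc N) ^ 2 * of_real (b * (a - b)) * l1 * l2\<^sup>2)"
proof -
  note q1 = leading_wkb_q[OF P1, of N a] and q2 = leading_wkb_q[OF P2, of N b]
  note s2 = leading_wkb_s[OF P2, of N b]
  have 1: "leading (wkb_q N b P2 * P1) (N + d1 + d2) (of_nat (Suc N) * of_real b * l2 * l1)"
    using leading_mult[OF q2 P1] by (simp add: add_ac)
  have 2: "leading (wkb_q N a P1 * P2) (N + d1 + d2) (of_nat (Suc N) * of_real a * l1 * l2)"
    using leading_mult[OF q1 P2] by (simp add: add_ac)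
  have e: "d2 + (N + d1 + d2) = N + d1 + 2 * d2" by simp
  show "leading (wkb_\<alpha> N a b P1 P2) (N + d1 + 2 * d2) (2 * of_nat (Suc N) * of_real (b - a) * l1 * l2\<^sup>2)"
    unfolding wkb_\<alpha>_def using leading_scalar[OF leading_mult[OF P2 leading_diff[OF 1 2]], of 2, unfolded e]
    by (simp add: power2_eq_square algebra_simps del: of_nat_Suc)
  have 3: "leading (- (wkb_s N b P2 * P1)) (2 * N + d1 + 2 * d2) (- ((of_nat (Suc N) * of_real b * l2)\<^sup>2 * l1))"
    using leading_minus[OF leading_mult[OF s2 P1]] by (simp add: add_ac)
  have 4: "leading ([:2:] * (P2 * P2 * pderiv (wkb_q N a P1))) (2 * N + d1 + 2 * d2) 0"
    using leading_weaken'[of _ "d2 + d2 + (N + d1)" "2 * N + d1 + 2 * d2"]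
      leading_scalar[OF leading_mult[OF leading_mult[OF P2 P2] leading_pderiv[OF q1]], of 2] by simp
  have 5: "leading ([:2:] * pderiv P1 - wkb_q N a P1) (N + d1) (0 - of_nat (Suc N) * of_real a * l1)"
    using leading_diff[OF leading_weaken'[of _ d1 "N + d1"] q1] leading_scalar[OF leading_pderiv[OF P1], of 2] by simp
  have e: "d2 + (N + d2) + (N + d1) = 2 * N + d1 + 2 * d2" by simp
  show "leading (wkb_\<beta> N a b P1 P2) (2 * N + d1 + 2 * d2) (of_nat (Suc N) ^ 2 * of_real (b * (a - b)) * l1 * l2\<^sup>2)"
    unfolding wkb_\<beta>_def
    using leading_diff[OF leading_add[OF 3 4] leading_mult[OF leading_mult[OF P2 q2] 5, unfolded e]]
    by (simp add: power2_eq_square algebra_simps del: of_nat_Suc)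
qed

section \<open>Asymptotics of the Riccati equation along a ray\<close>

lemma eventually_tubes_nhds:
  assumes "eventually P (tubes \<theta>)"
  shows "\<forall>\<^sub>F z in tubes \<theta>. \<forall>\<^sub>F y in nhds z. P y"
proof -
  obtain k where k: "\<forall>\<^sub>F z in tubes \<theta>. \<forall>y\<in>ball z (1 / norm z ^ k). P y"
    using eventually_tubes_ball[OF assms] .
  show ?thesis using k tubes_norm_ge[of 1 \<theta>]
  proof eventually_elim
    case (elim z)
    have "1 / norm z ^ k > 0" using elim by (intro divide_pos_pos zero_less_power) auto
    hence "\<forall>\<^sub>F y in nhds z. y \<in> ball z (1 / norm z ^ k)" by (intro eventually_nhds_in_open) auto
    thus ?case by eventually_elim (use elim in auto)
  qed
qed

lemma tubes_deriv_cong: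
  assumes "\<forall>\<^sub>F z in tubes \<theta>. f z = g z"
  shows "\<forall>\<^sub>F z in tubes \<theta>. deriv f z = deriv g z"
  using eventually_tubes_nhds[OF assms] by eventually_elim (auto intro: deriv_cong_ev)

lemma analytic_has_field_derivative:
  "f analytic_on {z} \<Longrightarrow> (f has_field_derivative deriv f z) (at z)"
  using analytic_on_imp_differentiable_at DERIV_deriv_iff_field_differentiable by blast

text \<open>Here \<open>a\<close> belongs to the exponential that grows along the ray and
  \<open>b\<close> to the one that decays, so the roles of the two terms of \<open>A\<close> depend
  on the ray. The intended instance is \<open>F = f' / f\<close> with entire part \<open>w\<close>
  and \<open>h = H' / H\<close>.\<close>

locale riccati_ray =
  fixes \<theta> :: real and N :: nat and a b :: real and P1 P2 Q :: "complex poly"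
    and F h w :: "complex \<Rightarrow> complex"
  assumes a: "a * cos (real (Suc N) * \<theta>) > 0" and b: "b * cos (real (Suc N) * \<theta>) < 0"
    and P1: "P1 \<noteq> 0" and P2: "P2 \<noteq> 0"
    and F_analytic: "\<forall>\<^sub>F z in tubes \<theta>. F analytic_on {z}"
    and riccati: "\<forall>\<^sub>F z in tubes \<theta>. deriv F z + F z ^ 2 + (poly P1 z * exp (of_real a * z ^ Suc N) +
         poly P2 z * exp (of_real b * z ^ Suc N) + poly Q z) = 0"
    and h: "moderate \<theta> h" and w: "w holomorphic_on UNIV"
    and F_eq: "\<forall>\<^sub>F z in tubes \<theta>. F z = w z + h z"
begin

abbreviation "E1 (z::complex) \<equiv> exp (of_real a * z ^ Suc N)"
abbreviation "E2 (z::complex) \<equiv> exp (of_real b * z ^ Suc N)"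
text \<open>The reciprocal square root of the dominant exponential; multiplication by it brings
  \<open>F\<close> down to polynomial size.\<close>

abbreviation "E (z::complex) \<equiv> exp (of_real (- a / 2) * z ^ Suc N)"
abbreviation "q1 \<equiv> wkb_q N a P1"
abbreviation "q2 \<equiv> wkb_q N b P2"

lemma a2: "(- a / 2) * cos (real (Suc N) * \<theta>) < 0" using a by simp

lemma tiny_E: "tiny \<theta> (\<lambda>z. E z)" and moderate_E: "moderate \<theta> (\<lambda>z. E z)"
  and norm_E: "\<forall>\<^sub>F z in tubes \<theta>. norm (E z) \<le> 1"
  by (rule tiny_exp[OF _ a2] moderate_exp[OF _ a2] norm_exp_le_1[OF _ a2], simp)+

lemma moderate_E2: "moderate \<theta> (\<lambda>z. E2 z)"
  by (rule moderate_exp[OF _ b]) simp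

lemma E_sq: "E z * E z * E1 z = 1"
proof -
  have "of_real (- a / 2) * z ^ Suc N + of_real (- a / 2) * z ^ Suc N + of_real a * z ^ Suc N = 0"
    by (simp del: power_Suc add: field_simps)
  thus ?thesis by (metis exp_add exp_zero)
qed

definition "s = monom (of_nat (Suc N) * of_real (a / 2)) N"

lemma E_deriv: "((\<lambda>z. E z) has_field_derivative (- poly s z * E z)) (at z)"
  by (auto intro!: derivative_eq_intros simp: s_def poly_monom simp del: power_Suc of_nat_Suc)

lemma moderate_E_deriv:
  assumes "moderate \<theta> (\<lambda>z. E z * f z)" and f: "\<forall>\<^sub>F z in tubes \<theta>. f analytic_on {z}"
  shows "moderate \<theta> (\<lambda>z. E z * deriv f z)"
proof (rule moderate_cong)
  show "moderate \<theta> (\<lambda>z. deriv (\<lambda>z. E z * f z) z + poly s z * (E z * f z))"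
    by (intro moderate_add moderate_mult moderate_poly moderate_deriv assms)
  show "\<forall>\<^sub>F z in tubes \<theta>. deriv (\<lambda>z. E z * f z) z + poly s z * (E z * f z) = E z * deriv f z"
    using f
  proof eventually_elim
    case (elim z)
    have "deriv (\<lambda>z. E z * f z) z = - poly s z * E z * f z + deriv f z * E z"
      by (rule DERIV_imp_deriv) (rule DERIV_mult[OF E_deriv analytic_has_field_derivative[OF elim]])
    thus ?case by (simp add: algebra_simps)
  qed
qed

lemma riccati_scaled:
  "\<forall>\<^sub>F z in tubes \<theta>. (E z * F z)\<^sup>2 = - E z * (E z * deriv F z) - (poly P1 z + (E z)\<^sup>2 * (poly P2 z * E2 z + poly Q z))"
  using riccati
proof eventually_elim
  case (elim z)
  have "(E z * F z)\<^sup>2 = (E z)\<^sup>2 * (F z)\<^sup>2" by (simp add: power_mult_distrib)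
  also have "(F z)\<^sup>2 = - deriv F z - (poly P1 z * E1 z + poly P2 z * E2 z + poly Q z)"
    using elim by (simp add: algebra_simps eq_neg_iff_add_eq_0)
  also have "(E z)\<^sup>2 * \<dots> = - E z * (E z * deriv F z) - ((E z * E z * E1 z) * poly P1 z + (E z)\<^sup>2 * (poly P2 z * E2 z + poly Q z))"
    by (simp add: algebra_simps power2_eq_square)
  finally show ?case unfolding E_sq by simp
qed

text \<open>For \<open>G = E * F\<close> the equation reads
  \<open>G^2 = - E * G' - E * s * G - M\<close> with \<open>norm E \<le> 1\<close> and
  \<open>M\<close> moderate. So \<open>riccati_bound\<close> applies on discs of polynomially small
  radius and costs only powers of \<open>norm z\<close>.\<close>

lemma moderate_EF: "moderate \<theta> (\<lambda>z. E z * F z)"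
proof -
  define M where "M z = poly P1 z + (E z)\<^sup>2 * (poly P2 z * E2 z + poly Q z)" for z
  have "moderate \<theta> M"
    unfolding M_def by (intro moderate_add moderate_mult moderate_power moderate_poly moderate_E moderate_E2)
  then obtain j where j: "\<forall>\<^sub>F z in tubes \<theta>. M analytic_on {z} \<and> norm (M z) \<le> norm z ^ j \<and> norm z \<ge> 2"
    by (rule moderateE)
  obtain k where k: "\<forall>\<^sub>F z in tubes \<theta>. (\<lambda>z. poly s z) analytic_on {z} \<and> norm (poly s z) \<le> norm z ^ k \<and> norm z \<ge> 2"
    using moderate_poly by (rule moderateE)
  have EF: "((\<lambda>z. E z * F z) has_field_derivative (- poly s z * E z * F z + deriv F z * E z)) (at z)" if "F analytic_on {z}" for z
    by (rule DERIV_mult[OF E_deriv analytic_has_field_derivative[OF that]])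
  have ev: "\<forall>\<^sub>F z in tubes \<theta>. F analytic_on {z} \<and> norm (M z) \<le> norm z ^ (2 * j) \<and> norm (poly s z) \<le> norm z ^ k \<and>
      norm z \<ge> 2 \<and> (norm (E z * F z))\<^sup>2 \<le> 1 * norm (deriv (\<lambda>z. E z * F z) z) + norm z ^ k * norm (E z * F z) + norm z ^ (2 * j)"
    using j k F_analytic riccati_scaled norm_E
  proof eventually_elim
    case (elim z)
    have "deriv (\<lambda>z. E z * F z) z = - poly s z * E z * F z + deriv F z * E z"
      by (rule DERIV_imp_deriv[OF EF]) (use elim in auto)
    hence "E z * deriv F z = deriv (\<lambda>z. E z * F z) z + poly s z * (E z * F z)"
      by (simp add: algebra_simps)
    hence "(E z * F z)\<^sup>2 = - E z * deriv (\<lambda>z. E z * F z) z - E z * (poly s z * (E z * F z)) - M z"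
      using elim by (simp add: M_def algebra_simps)
    hence "norm ((E z * F z)\<^sup>2) \<le> norm (E z) * norm (deriv (\<lambda>z. E z * F z) z) + norm (E z) * (norm (poly s z) * norm (E z * F z)) + norm (M z)"
      using norm_triangle_ineq4[of "- E z * deriv (\<lambda>z. E z * F z) z - E z * (poly s z * (E z * F z))" "M z"]
        norm_triangle_ineq4[of "- E z * deriv (\<lambda>z. E z * F z) z" "E z * (poly s z * (E z * F z))"]
      by (simp add: norm_mult del: norm_exp_eq_Re)
    also have "\<dots> \<le> 1 * norm (deriv (\<lambda>z. E z * F z) z) + 1 * (norm z ^ k * norm (E z * F z)) + norm z ^ j"
      using elim by (intro add_mono mult_mono) (auto simp del: norm_exp_eq_Re)
    finally have *: "(norm (E z * F z))\<^sup>2 \<le> 1 * norm (deriv (\<lambda>z. E z * F z) z) + norm z ^ k * norm (E z * F z) + norm z ^ j"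
      by (simp add: norm_power del: norm_exp_eq_Re)
    have "norm z ^ j \<le> norm z ^ (2 * j)" using elim by (intro power_increasing) auto
    moreover have "norm (M z) \<le> norm z ^ (2 * j)" using elim calculation by linarith
    ultimately show ?case using * elim by linarith
  qed
  obtain i where i: "\<forall>\<^sub>F z in tubes \<theta>. \<forall>y\<in>ball z (1 / norm z ^ i). F analytic_on {y} \<and> norm (M y) \<le> norm y ^ (2 * j) \<and> norm (poly s y) \<le> norm y ^ k \<and>
      norm y \<ge> 2 \<and> (norm (E y * F y))\<^sup>2 \<le> 1 * norm (deriv (\<lambda>z. E z * F z) y) + norm y ^ k * norm (E y * F y) + norm y ^ (2 * j)"
    using eventually_tubes_ball[OF ev] .
  define K where "K = i + 2 * k + 2 * j"
  show ?thesis
  proof (rule moderateI[where C = 6 and k = K])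
    show "\<forall>\<^sub>F z in tubes \<theta>. (\<lambda>z. E z * F z) analytic_on {z} \<and> norm (E z * F z) \<le> 6 * norm z ^ K"
      using ev i
    proof eventually_elim
      case (elim z)
      have z2: "norm z \<ge> 2" using elim by auto
      have d: "1 / norm z ^ i > 0" using z2 by (intro divide_pos_pos zero_less_power) auto
      have "norm z ^ i \<ge> 1" using z2 by (intro one_le_power) auto
      hence dle: "1 / norm z ^ i \<le> 1" by simp
      have "norm (E z * F z) \<le> 4 * 1 / (1 / norm z ^ i) + norm z ^ (2 * k) + norm z ^ (2 * j)"
      proof (rule riccati_bound[where F = "\<lambda>z. E z * F z"])
        have "F analytic_on ball z (1 / norm z ^ i)" using elim by (subst analytic_on_analytic_at) auto
        thus "(\<lambda>z. E z * F z) holomorphic_on ball z (1 / norm z ^ i)"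
          by (intro holomorphic_intros analytic_imp_holomorphic)
        fix y assume y: "y \<in> ball z (1 / norm z ^ i)"
        have "norm y \<le> norm z + 1"
          using y dle norm_triangle_ineq2[of y z] by (simp add: dist_norm norm_minus_commute)
        also have "\<dots> \<le> norm z * 2" using z2 by simp
        also have "\<dots> \<le> norm z * norm z" using z2 by (intro mult_left_mono) auto
        finally have ny: "norm y \<le> (norm z)\<^sup>2" by (simp add: power2_eq_square)
        have yk: "norm y ^ k \<le> norm z ^ (2 * k)" "norm y ^ (2 * j) \<le> (norm z ^ (2 * j))\<^sup>2"
          using power_mono[OF ny, of k] power_mono[OF ny, of "2 * j"]
          by (simp_all add: power_mult[symmetric] mult_ac)
        have "norm y ^ k * norm (E y * F y) \<le> norm z ^ (2 * k) * norm (E y * F y)"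
          using yk by (intro mult_right_mono) auto
        moreover have "(norm (E y * F y))\<^sup>2 \<le> 1 * norm (deriv (\<lambda>z. E z * F z) y) + norm y ^ k * norm (E y * F y) + norm y ^ (2 * j)"
          using elim y by blast
        ultimately show "(norm (E y * F y))\<^sup>2 \<le> 1 * norm (deriv (\<lambda>z. E z * F z) y) + norm z ^ (2 * k) * norm (E y * F y) + (norm z ^ (2 * j))\<^sup>2"
          using yk(2) by linarith
      qed (use d in auto)
      also have "\<dots> = 4 * norm z ^ i + norm z ^ (2 * k) + norm z ^ (2 * j)" by simp
      also have "\<dots> \<le> 4 * norm z ^ K + norm z ^ K + norm z ^ K"
        using z2 by (intro add_mono mult_left_mono power_increasing) (auto simp: K_def)
      finally have "norm (E z * F z) \<le> 6 * norm z ^ K" by simp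
      thus ?case using elim by (auto intro!: analytic_intros)
    qed
  qed
qed

lemma moderate_EF': "moderate \<theta> (\<lambda>z. E z * deriv F z)"
  by (rule moderate_E_deriv[OF moderate_EF F_analytic])

lemma moderate_EF'': "moderate \<theta> (\<lambda>z. E z * deriv (deriv F) z)"
  by (rule moderate_E_deriv[OF moderate_EF']) (use F_analytic in \<open>auto elim!: eventually_mono intro: analytic_deriv\<close>)

text \<open>In the scaled equation every term other than \<open>P1\<close> retains a factor
  \<open>E\<close>, which outweighs all moderate factors.\<close>

lemma EF_sq_tiny: "tiny \<theta> (\<lambda>z. (E z * F z)\<^sup>2 + poly P1 z)"
proof (rule tiny_cong)
  show "tiny \<theta> (\<lambda>z. E z * (- (E z * deriv F z) - E z * (poly P2 z * E2 z + poly Q z)))"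
    by (intro tiny_mult tiny_E moderate_diff moderate_uminus moderate_EF' moderate_mult moderate_E moderate_add moderate_poly moderate_E2)
  show "\<forall>\<^sub>F z in tubes \<theta>. E z * (- (E z * deriv F z) - E z * (poly P2 z * E2 z + poly Q z)) = (E z * F z)\<^sup>2 + poly P1 z"
    using riccati_scaled
    by eventually_elim (simp add: algebra_simps power2_eq_square)
qed

lemma bounded_below_of_sq:
  assumes "((\<lambda>z. g z ^ 2 + poly P1 z) \<longlongrightarrow> 0) (tubes \<theta>)"
  obtains c where "c > 0" "\<forall>\<^sub>F z in tubes \<theta>. norm (g z) \<ge> c"
proof -
  obtain c where c: "c > 0" "\<forall>\<^sub>F z in at_infinity. norm (poly P1 z) \<ge> c"
    using poly_bounded_below[OF P1] .
  have "\<forall>\<^sub>F z in tubes \<theta>. norm (g z ^ 2 + poly P1 z) < c / 2"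
    using order_tendstoD(2)[OF tendsto_norm_zero[OF assms], of "c / 2"] c by simp
  moreover have "\<forall>\<^sub>F z in tubes \<theta>. norm (poly P1 z) \<ge> c"
    using c tubes_le_at_infinity filter_leD by blast
  ultimately have "\<forall>\<^sub>F z in tubes \<theta>. norm (g z) \<ge> sqrt (c / 2)"
  proof eventually_elim
    case (elim z)
    have "norm (poly P1 z) \<le> norm (g z ^ 2 + poly P1 z) + norm (g z ^ 2)"
      using norm_triangle_ineq4[of "g z ^ 2 + poly P1 z" "g z ^ 2"] by simp
    hence "c / 2 \<le> (norm (g z))\<^sup>2" using elim by (simp add: norm_power)
    thus ?case by (simp add: real_le_lsqrt)
  qed
  thus ?thesis using that[of "sqrt (c / 2)"] c by auto
qed

lemma exp_poly_deriv: "((\<lambda>z. poly P z * exp (of_real c * z ^ Suc N)) has_field_derivative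
    poly (wkb_q N c P) z * exp (of_real c * z ^ Suc N)) (at z)"
  by (auto intro!: derivative_eq_intros poly_DERIV
      simp: wkb_q_def poly_monom algebra_simps simp del: power_Suc of_nat_Suc)

lemma riccati_deriv:
  "\<forall>\<^sub>F z in tubes \<theta>. deriv (deriv F) z + 2 * F z * deriv F z + (poly q1 z * E1 z + poly q2 z * E2 z + poly (pderiv Q) z) = 0"
  using tubes_deriv_cong[OF riccati] F_analytic
proof eventually_elim
  case (elim z)
  have "((\<lambda>z. deriv F z + F z ^ 2 + (poly P1 z * E1 z + poly P2 z * E2 z + poly Q z)) has_field_derivative
     deriv (deriv F) z + 2 * F z * deriv F z + (poly q1 z * E1 z + poly q2 z * E2 z + poly (pderiv Q) z)) (at z)"
    using analytic_has_field_derivative[OF elim(2)] analytic_has_field_derivative[OF analytic_deriv[OF elim(2)]]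
    by (intro DERIV_add exp_poly_deriv poly_DERIV) (auto intro!: derivative_eq_intros)
  from DERIV_imp_deriv[OF this] elim show ?case by simp
qed

text \<open>The growing exponential is eliminated between the equation and its derivative: in
  \<open>P1 * (2 * F * F') - q1 * F^2\<close> the \<open>E1\<close> terms cancel. The left side is
  \<open>F * wkb_u F\<close> and the rest is at most of the size of \<open>F\<close>, so dividing by
  \<open>E * F\<close>, which is bounded below, leaves a moderate function.\<close>

lemma moderate_wkb_u_F: "moderate \<theta> (wkb_u N a P1 F)"
proof -
  obtain c where c: "c > 0" "\<forall>\<^sub>F z in tubes \<theta>. norm (E z * F z) \<ge> c"
    using bounded_below_of_sq[OF tiny_imp_tendsto[OF EF_sq_tiny]] .
  define R where "R z = - (E z * ((poly P1 z * poly q2 z - poly q1 z * poly P2 z) * E2 z +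
      (poly P1 z * poly (pderiv Q) z - poly q1 z * poly Q z))) - poly P1 z * (E z * deriv (deriv F) z) + poly q1 z * (E z * deriv F z)" for z
  have R: "moderate \<theta> R"
    unfolding R_def
    by (intro moderate_add moderate_diff moderate_uminus moderate_mult moderate_poly moderate_E moderate_E2 moderate_EF' moderate_EF'')
  show ?thesis
  proof (rule moderate_cong)
    show "moderate \<theta> (\<lambda>z. R z * inverse (E z * F z))"
      by (intro moderate_mult R moderate_inverse[OF moderate_EF c])
    show "\<forall>\<^sub>F z in tubes \<theta>. R z * inverse (E z * F z) = wkb_u N a P1 F z"
      using c(2) riccati riccati_deriv
    proof eventually_elim
      case (elim z)
      have "E z * F z \<noteq> 0" using elim c(1) by auto
      have F2: "F z ^ 2 = - deriv F z - (poly P1 z * E1 z + poly P2 z * E2 z + poly Q z)"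
        using elim(2) by (simp add: algebra_simps eq_neg_iff_add_eq_0)
      have F3: "2 * F z * deriv F z = - deriv (deriv F) z - (poly q1 z * E1 z + poly q2 z * E2 z + poly (pderiv Q) z)"
        using elim(3) by (simp add: algebra_simps eq_neg_iff_add_eq_0)
      have "wkb_u N a P1 F z * (E z * F z) = E z * (poly P1 z * (2 * F z * deriv F z) - poly q1 z * F z ^ 2)"
        by (simp add: wkb_u_def algebra_simps power2_eq_square)
      also have "\<dots> = R z"
        unfolding F2 F3 R_def by (simp add: algebra_simps)
      finally show ?case using \<open>E z * F z \<noteq> 0\<close> by (simp add: field_simps)
    qed
  qed
qed

lemma w_analytic: "w analytic_on {z}"
  using w by (simp add: analytic_at) (metis UNIV_I open_UNIV)

lemma h_analytic: "\<forall>\<^sub>F z in tubes \<theta>. h analytic_on {z}"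
  using h by (simp add: moderate_def)

lemma F_deriv_eq: "\<forall>\<^sub>F z in tubes \<theta>. deriv F z = deriv w z + deriv h z"
  using tubes_deriv_cong[OF F_eq] h_analytic
proof eventually_elim
  case (elim z)
  have "deriv (\<lambda>z. w z + h z) z = deriv w z + deriv h z"
    using analytic_on_imp_differentiable_at[OF w_analytic] analytic_on_imp_differentiable_at[OF elim(2)]
    by (intro deriv_add) auto
  thus ?case using elim by simp
qed

lemma moderate_wkb_u_w: "moderate \<theta> (wkb_u N a P1 w)"
proof (rule moderate_cong)
  show "moderate \<theta> (\<lambda>z. wkb_u N a P1 F z - (2 * poly P1 z * deriv h z - poly q1 z * h z))"
    by (intro moderate_diff moderate_mult moderate_wkb_u_F moderate_const moderate_poly moderate_deriv h)
  show "\<forall>\<^sub>F z in tubes \<theta>. wkb_u N a P1 F z - (2 * poly P1 z * deriv h z - poly q1 z * h z) = wkb_u N a P1 w z"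
    using F_eq F_deriv_eq by eventually_elim (simp add: wkb_u_def algebra_simps)
qed

theorem moderate_wkb_V: "moderate \<theta> (wkb_V N a b P1 P2 w)"
proof -
  have "moderate \<theta> (\<lambda>z. poly (wkb_\<alpha> N a b P1 P2) z * deriv (wkb_u N a P1 w) z +
           poly (wkb_\<beta> N a b P1 P2) z * wkb_u N a P1 w z)"
    by (intro moderate_add moderate_mult moderate_poly moderate_deriv moderate_wkb_u_w)
  also have "(\<lambda>z. poly (wkb_\<alpha> N a b P1 P2) z * deriv (wkb_u N a P1 w) z +
           poly (wkb_\<beta> N a b P1 P2) z * wkb_u N a P1 w z) = wkb_V N a b P1 P2 w"
    by (simp add: fun_eq_iff wkb_V_factor[OF w_analytic])
  finally show ?thesis .
qed

end

section \<open>Leading behaviour of the logarithmic derivative along a ray\<close>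

lemma holomorphic_on_poly: "poly p holomorphic_on A" for p :: "complex poly"
  by (auto simp: holomorphic_on_def field_differentiable_def intro: has_field_derivative_at_within poly_DERIV)

lemma analytic_on_poly: "poly p analytic_on A" for p :: "complex poly"
  using holomorphic_on_poly[of p UNIV] by (metis analytic_on_open analytic_on_subset open_UNIV subset_UNIV)

lemma leading_quotient_tendsto:
  assumes "leading p (N + d) k" "leading q d l" "l \<noteq> 0"
  shows "((\<lambda>z. poly p z / poly q z / z ^ N) \<longlongrightarrow> k / l) at_infinity"
proof -
  have lim: "((\<lambda>z. (poly p z / z ^ (N + d)) / (poly q z / z ^ d)) \<longlongrightarrow> k / l) at_infinity"
    by (intro tendsto_divide leading_imp_tendsto assms)
  have "\<forall>\<^sub>F z in at_infinity. norm (z::complex) \<ge> 1" by (auto simp: eventually_at_infinity)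
  hence "\<forall>\<^sub>F z in at_infinity. (poly p z / z ^ (N + d)) / (poly q z / z ^ d) = poly p z / poly q z / z ^ N"
  proof eventually_elim
    case (elim z)
    hence "z \<noteq> 0" by auto
    thus ?case by (simp add: power_add)
  qed
  from Lim_transform_eventually[OF lim this] show ?thesis .
qed

lemma tendsto_0_divide_power:
  fixes f :: "complex \<Rightarrow> complex"
  assumes "(f \<longlongrightarrow> 0) G" "G \<le> at_infinity"
  shows "((\<lambda>z. f z / z ^ N) \<longlongrightarrow> 0) G"
proof (rule Lim_null_comparison)
  show "((\<lambda>z. norm (f z)) \<longlongrightarrow> 0) G" using assms(1) by (rule tendsto_norm_zero)
  have "\<forall>\<^sub>F z in at_infinity. norm (z::complex) \<ge> 1" by (auto simp: eventually_at_infinity)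
  from filter_leD[OF assms(2) this] show "\<forall>\<^sub>F z in G. norm (f z / z ^ N) \<le> norm (f z)"
  proof eventually_elim
    case (elim z)
    hence "norm z ^ N \<ge> 1" by (rule one_le_power)
    thus ?case by (simp add: norm_divide norm_power divide_le_eq mult_le_cancel_left1)
  qed
qed

context riccati_ray
begin

text \<open>After subtracting \<open>c\<close> the operator leaves only a low degree remainder. The
  left factor is stable along the ray, which makes \<open>w1' - s1 * w1\<close> of lower order than
  \<open>z ^ N\<close>. This controls the defect of \<open>w1^2 = - P1 * E1\<close> through an
  unstable equation. What remains of the Riccati equation is \<open>2 * (h + c) = - s1\<close> to
  leading order. Here \<open>s1 = y1' / y1 ~ (N + 1) * a / 2 * z ^ N\<close>, whence the denominator
  4.\<close>

theorem h_asymptotics: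
  assumes V: "\<And>z. wkb_V N a b P1 P2 w z = poly R z"
    and c: "leading (R - (wkb_k0 N a b P1 P2 * c + wkb_k1 N a b P1 P2 * pderiv c + wkb_k2 N a b P1 P2 * pderiv (pderiv c)))
              (3 * N + 2 * degree P1 + 2 * degree P2) 0"
  shows "((\<lambda>z. (h z + poly c z) / z ^ N) \<longlongrightarrow> of_real (- (real (Suc N) * a / 4))) (ray \<theta>)"
proof -
  define d1 d2 l1 l2 where "d1 = degree P1" and "d2 = degree P2" and "l1 = lead_coeff P1" and "l2 = lead_coeff P2"
  have lead: "leading P1 d1 l1" "leading P2 d2 l2"
    unfolding d1_def d2_def l1_def l2_def by (rule leading_degree)+
  have l0: "l1 \<noteq> 0" "l2 \<noteq> 0" using P1 P2 by (auto simp: l1_def l2_def)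
  have ab: "a \<noteq> b" using a b by auto
  define R1 where "R1 = R - (wkb_k0 N a b P1 P2 * c + wkb_k1 N a b P1 P2 * pderiv c + wkb_k2 N a b P1 P2 * pderiv (pderiv c))"
  define \<alpha> \<beta> where "\<alpha> = wkb_\<alpha> N a b P1 P2" and "\<beta> = wkb_\<beta> N a b P1 P2"
  define w1 where "w1 z = w z - poly c z" for z
  have w1_analytic: "w1 analytic_on {z}" for z
    unfolding w1_def by (intro analytic_intros w_analytic analytic_on_poly)
  have dw1: "deriv w1 z = deriv w z - poly (pderiv c) z" for z
    unfolding w1_def by (rule DERIV_imp_deriv) (intro DERIV_diff analytic_has_field_derivative w_analytic poly_DERIV)
  have ddw1: "deriv (deriv w1) z = deriv (deriv w) z - poly (pderiv (pderiv c)) z" for z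
  proof -
    have "deriv w1 = (\<lambda>z. deriv w z - poly (pderiv c) z)" by (simp add: fun_eq_iff dw1)
    thus ?thesis
      by (auto intro!: DERIV_imp_deriv DERIV_diff analytic_has_field_derivative analytic_deriv w_analytic poly_DERIV)
  qed
  have Vw1: "wkb_V N a b P1 P2 w1 z = poly R1 z" for z
    using V[of z] by (simp add: wkb_V_def dw1 ddw1 R1_def w1_def algebra_simps)
  define u where "u = wkb_u N a P1 w1"
  have u_eq: "poly \<alpha> z * deriv u z + poly \<beta> z * u z = poly R1 z" for z
    using Vw1[of z] wkb_V_factor[OF w1_analytic, of N a b P1 P2 z] by (simp add: u_def \<alpha>_def \<beta>_def)
  have u_analytic: "u analytic_on {z}" for z
    unfolding u_def wkb_u_def by (intro analytic_intros analytic_deriv w1_analytic analytic_on_poly)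
  have u_moderate: "moderate \<theta> u"
  proof (rule moderate_cong)
    show "moderate \<theta> (\<lambda>z. wkb_u N a P1 w z - (2 * poly P1 z * poly (pderiv c) z - poly q1 z * poly c z))"
      by (intro moderate_diff moderate_mult moderate_wkb_u_w moderate_poly moderate_const)
    show "\<forall>\<^sub>F z in tubes \<theta>. wkb_u N a P1 w z - (2 * poly P1 z * poly (pderiv c) z - poly q1 z * poly c z) = u z"
      by (intro always_eventually) (simp add: u_def wkb_u_def dw1, simp add: w1_def algebra_simps)
  qed
  have la: "leading \<alpha> (N + d1 + 2 * d2) (2 * of_nat (Suc N) * of_real (b - a) * l1 * l2\<^sup>2)"
    and lb: "leading \<beta> (2 * N + d1 + 2 * d2) (of_nat (Suc N) ^ 2 * of_real (b * (a - b)) * l1 * l2\<^sup>2)"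
    unfolding \<alpha>_def \<beta>_def by (rule leading_wkb_factors[OF lead])+
  have la0: "2 * of_nat (Suc N) * of_real (b - a) * l1 * l2\<^sup>2 \<noteq> (0::complex)"
    using ab l0 by (simp del: of_nat_Suc)
  have \<alpha>0: "\<alpha> \<noteq> 0" using la la0 by (auto simp: leading_def)

  \<comment> \<open>With this exponent \<open>u = o(z ^ K)\<close> yields
    \<open>u / (2 * P1) = o(z ^ N)\<close>, the precision needed for \<open>v1\<close>
    below.\<close>
  define K where "K = N + d1"
  have lim_u: "((\<lambda>z. u z / z ^ K) \<longlongrightarrow> 0) (ray \<theta>)"
  \<comment> \<open>The rate is that of \<open>y2\<close>, the exponential that decays on this
    ray.\<close>
  proof (rule ray_ode_stable[where N = N and L = "real (Suc N) * b / 2"])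
    have "\<forall>\<^sub>F z in tubes \<theta>. poly \<alpha> z \<noteq> 0 \<and> norm z \<ge> 1"
      by (intro eventually_conj tubes_poly_nonzero \<alpha>0 tubes_norm_ge)
    hence "\<forall>\<^sub>F z in tubes \<theta>. ((\<lambda>z. u z / z ^ K) has_field_derivative
        (- (poly \<beta> z / poly \<alpha> z) - of_nat K / z) * (u z / z ^ K) + poly R1 z / (poly \<alpha> z * z ^ K)) (at z)"
    proof eventually_elim
      case (elim z)
      hence z: "z \<noteq> 0" by auto
      have "u z * (of_nat K * z ^ (K - 1)) = of_nat K * u z * z ^ K / z"
        using z by (cases K) auto
      moreover have "((\<lambda>z. u z / z ^ K) has_field_derivative
          (deriv u z * z ^ K - u z * (of_nat K * z ^ (K - 1))) / (z ^ K * z ^ K)) (at z)"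
        using z by (intro DERIV_divide analytic_has_field_derivative u_analytic) (auto intro!: derivative_eq_intros)
      moreover have du: "deriv u z = (poly R1 z - poly \<beta> z * u z) / poly \<alpha> z"
        using u_eq[of z] elim by (simp add: field_simps)
      ultimately show ?case
        using z elim by (elim DERIV_cong) (auto simp: du field_simps)
    qed
    thus "\<forall>\<^sub>F z in ray \<theta>. ((\<lambda>z. u z / z ^ K) has_field_derivative
        (- (poly \<beta> z / poly \<alpha> z) - of_nat K / z) * (u z / z ^ K) + poly R1 z / (poly \<alpha> z * z ^ K)) (at z)"
      by (rule eventually_tubes_ray)
    have lim: "((\<lambda>z. - (poly \<beta> z / poly \<alpha> z / z ^ N) - of_nat K / z / z ^ N) \<longlongrightarrow>
       - (of_nat (Suc N) ^ 2 * of_real (b * (a - b)) * l1 * l2\<^sup>2 / (2 * of_nat (Suc N) * of_real (b - a) * l1 * l2\<^sup>2)) - 0) at_infinity"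
      using lb by (intro tendsto_diff tendsto_minus leading_quotient_tendsto[OF _ la la0] tendsto_0_divide_power
          tendsto_divide_0[OF tendsto_const filterlim_ident]) (simp_all add: mult_2 add_ac)
    have eq: "- (of_nat (Suc N) ^ 2 * of_real (b * (a - b)) * l1 * l2\<^sup>2 / (2 * of_nat (Suc N) * of_real (b - a) * l1 * l2\<^sup>2)) - 0 = complex_of_real (real (Suc N) * b / 2)"
    proof -
      have "complex_of_real (b - a) \<noteq> 0" using ab by (simp del: of_real_diff)
      moreover have "complex_of_real (b * (a - b)) = - (of_real b * of_real (b - a))" by (simp add: algebra_simps)
      moreover have "complex_of_real (real (Suc N) * b / 2) = of_nat (Suc N) * of_real b / 2"
        by (simp del: of_nat_Suc)
      ultimately show ?thesis using l0
        by (simp add: power2_eq_square field_simps del: of_nat_Suc of_real_diff of_real_mult)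
    qed
    have "((\<lambda>z. (- (poly \<beta> z / poly \<alpha> z) - of_nat K / z) / z ^ N) \<longlongrightarrow> complex_of_real (real (Suc N) * b / 2)) at_infinity"
      using lim unfolding eq by (simp only: diff_divide_distrib minus_divide_left)
    thus "((\<lambda>z. (- (poly \<beta> z / poly \<alpha> z) - of_nat K / z) / z ^ N) \<longlongrightarrow> complex_of_real (real (Suc N) * b / 2)) (ray \<theta>)"
      using ray_le_at_infinity by (rule tendsto_mono[rotated])
    show "real (Suc N) * b / 2 * cos (real (Suc N) * \<theta>) < 0"
      using b by (simp add: mult_pos_neg mult.assoc del: of_nat_Suc)
    \<comment> \<open>The degree count is exact: the bound supplied for \<open>R1\<close> is
      \<open>N + K\<close> plus the degree of \<open>\<alpha>\<close>, so the inhomogeneity is just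
      \<open>o(z ^ N)\<close>.\<close>
    have R1: "leading R1 (N + (K + (N + d1 + 2 * d2))) 0"
      using c by (simp add: R1_def d1_def d2_def K_def algebra_simps mult_2)
    have "leading (monom 1 K * \<alpha>) (K + (N + d1 + 2 * d2)) (1 * (2 * of_nat (Suc N) * of_real (b - a) * l1 * l2\<^sup>2))"
      by (rule leading_mult[OF leading_monom la])
    from leading_quotient_tendsto[OF R1 this] la0
    have "((\<lambda>z. poly R1 z / poly (monom 1 K * \<alpha>) z / z ^ N) \<longlongrightarrow> 0) at_infinity" by simp
    hence "((\<lambda>z. poly R1 z / (poly \<alpha> z * z ^ K) / z ^ N) \<longlongrightarrow> 0) at_infinity"
      by (simp add: poly_monom mult_ac)
    thus "((\<lambda>z. poly R1 z / (poly \<alpha> z * z ^ K) / z ^ N) \<longlongrightarrow> 0) (ray \<theta>)"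
      using ray_le_at_infinity by (rule tendsto_mono[rotated])
  qed

  define s1 v1 where "s1 z = poly q1 z / (2 * poly P1 z)" and "v1 z = u z / (2 * poly P1 z)" for z
  have P1_nz: "\<forall>\<^sub>F z in tubes \<theta>. poly P1 z \<noteq> 0" by (rule tubes_poly_nonzero[OF P1])
  have mod_iP1: "moderate \<theta> (\<lambda>z. inverse (poly P1 z) * (1 / 2))"
    by (intro moderate_mult moderate_inverse_poly P1 moderate_const)
  have mod_s1: "moderate \<theta> s1"
    using moderate_mult[OF moderate_poly[of \<theta> q1] mod_iP1] by (simp add: s1_def[abs_def] field_simps)
  have mod_v1: "moderate \<theta> v1"
    using moderate_mult[OF u_moderate mod_iP1] by (simp add: v1_def[abs_def] field_simps)
  have dw1_eq: "\<forall>\<^sub>F z in tubes \<theta>. deriv w1 z = s1 z * w1 z + v1 z"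
    using P1_nz by eventually_elim (simp add: s1_def v1_def u_def wkb_u_def field_simps)
  have lim_v1: "((\<lambda>z. v1 z / z ^ N) \<longlongrightarrow> 0) (ray \<theta>)"
  proof -
    have "((\<lambda>z. poly P1 z / z ^ d1) \<longlongrightarrow> l1) (ray \<theta>)"
      using tendsto_mono[OF ray_le_at_infinity leading_imp_tendsto[OF lead(1)]] .
    hence "((\<lambda>z. (u z / z ^ K) / (2 * (poly P1 z / z ^ d1))) \<longlongrightarrow> 0 / (2 * l1)) (ray \<theta>)"
      using l0 by (intro tendsto_intros lim_u) auto
    hence lim: "((\<lambda>z. (u z / z ^ K) / (2 * (poly P1 z / z ^ d1))) \<longlongrightarrow> 0) (ray \<theta>)" by simp
    have "\<forall>\<^sub>F z in ray \<theta>. (u z / z ^ K) / (2 * (poly P1 z / z ^ d1)) = v1 z / z ^ N"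
      using eventually_tubes_ray[OF tubes_norm_ge[of 1 \<theta>]]
    proof eventually_elim
      case (elim z)
      hence "z \<noteq> 0" by auto
      thus ?case by (simp add: v1_def K_def power_add)
    qed
    from Lim_transform_eventually[OF lim this] show ?thesis .
  qed
  have lim_s1: "((\<lambda>z. s1 z / z ^ N) \<longlongrightarrow> of_real (real (Suc N) * a / 2)) (ray \<theta>)"
  proof -
    have "((\<lambda>z. poly q1 z / poly ([:2:] * P1) z / z ^ N) \<longlongrightarrow> of_nat (Suc N) * of_real a * l1 / (2 * l1)) at_infinity"
      using l0 by (intro leading_quotient_tendsto[OF leading_wkb_q[OF lead(1)] leading_scalar[OF lead(1)]]) auto
    hence "((\<lambda>z. s1 z / z ^ N) \<longlongrightarrow> of_real (real (Suc N) * a / 2)) at_infinity"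
      using l0 by (simp add: s1_def del: of_nat_Suc)
    thus ?thesis using ray_le_at_infinity by (rule tendsto_mono[rotated])
  qed

  define hc where "hc z = h z + poly c z" for z
  have mod_hc: "moderate \<theta> hc" unfolding hc_def by (intro moderate_add h moderate_poly)
  define W where "W z = E z * F z - E z * hc z" for z
  have mod_W: "moderate \<theta> W"
    unfolding W_def by (intro moderate_diff moderate_EF moderate_mult moderate_E mod_hc)
  have W_eq: "\<forall>\<^sub>F z in tubes \<theta>. W z = E z * w1 z"
    using F_eq by eventually_elim (simp add: W_def w1_def hc_def algebra_simps)
  have "tiny \<theta> (\<lambda>z. ((E z * F z)\<^sup>2 + poly P1 z) + E z * (E z * hc z * hc z - 2 * (E z * F z) * hc z))"
    by (intro tiny_add EF_sq_tiny tiny_mult tiny_E moderate_diff moderate_mult moderate_E mod_hc moderate_EF moderate_const)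
  \<comment> \<open>Replacing \<open>E * F\<close> by \<open>W = E * w1\<close> changes the square
    only by terms with a factor \<open>E\<close>, so \<open>W\<close> too is bounded away from 0 and
    \<open>1 / w1\<close> is tiny.\<close>
  also have "(\<lambda>z. ((E z * F z)\<^sup>2 + poly P1 z) + E z * (E z * hc z * hc z - 2 * (E z * F z) * hc z)) = (\<lambda>z. W z ^ 2 + poly P1 z)"
    by (simp add: W_def fun_eq_iff power2_eq_square algebra_simps)
  finally have "tiny \<theta> (\<lambda>z. W z ^ 2 + poly P1 z)" .
  then obtain k where k: "k > 0" "\<forall>\<^sub>F z in tubes \<theta>. norm (W z) \<ge> k"
    using bounded_below_of_sq[OF tiny_imp_tendsto] by blast
  have iw_tiny: "tiny \<theta> (\<lambda>z. inverse (w1 z))" and w1_nz: "\<forall>\<^sub>F z in tubes \<theta>. w1 z \<noteq> 0"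
  proof -
    show "\<forall>\<^sub>F z in tubes \<theta>. w1 z \<noteq> 0" using k(2) W_eq by eventually_elim (use k(1) in auto)
    have "tiny \<theta> (\<lambda>z. E z * inverse (W z))"
      by (intro tiny_mult tiny_E moderate_inverse[OF mod_W k])
    thus "tiny \<theta> (\<lambda>z. inverse (w1 z))"
      by (rule tiny_cong) (use W_eq in \<open>auto elim!: eventually_mono\<close>)
  qed

  define X where "X z = v1 z + poly (pderiv c) z + deriv h z + hc z * hc z + poly P2 z * E2 z + poly Q z" for z
  \<comment> \<open>\<open>Z = (w1^2 + P1 * E1) / w1\<close> measures the distance of
    \<open>w1\<close> from the two roots of \<open>- P1 * E1\<close> without choosing a root or a
    sign.\<close>
  define Z where "Z z = w1 z + poly P1 z * E1 z * inverse (w1 z)" for z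
  have X_tiny: "tiny \<theta> (\<lambda>z. inverse (w1 z) * X z)"
    unfolding X_def
    by (intro tiny_mult iw_tiny moderate_add mod_v1 moderate_poly moderate_deriv h moderate_mult mod_hc moderate_E2)
  \<comment> \<open>The Riccati equation for \<open>F = w1 + hc\<close>, divided by
    \<open>w1\<close>: all terms without a factor \<open>w1\<close> are collected in
    \<open>X\<close> and become tiny.\<close>
  have Z_eq: "\<forall>\<^sub>F z in tubes \<theta>. Z z = - (s1 z + 2 * hc z) - inverse (w1 z) * X z"
    using riccati F_eq F_deriv_eq dw1_eq w1_nz
  proof eventually_elim
    case (elim z)
    have F: "F z = w1 z + hc z" using elim by (simp add: w1_def hc_def)
    have "deriv w z = deriv w1 z + poly (pderiv c) z" using dw1[of z] by simp
    hence F': "deriv F z = s1 z * w1 z + v1 z + poly (pderiv c) z + deriv h z" using elim by simp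
    have "w1 z * Z z = w1 z * w1 z + poly P1 z * E1 z"
      using elim by (simp add: Z_def field_simps)
    also have "\<dots> = - (s1 z * w1 z + 2 * w1 z * hc z) - X z"
    proof -
      have "w1 z * w1 z + poly P1 z * E1 z - (- (s1 z * w1 z + 2 * w1 z * hc z) - X z) =
          deriv F z + F z ^ 2 + (poly P1 z * E1 z + poly P2 z * E2 z + poly Q z)"
        unfolding F F' X_def by (simp add: algebra_simps power2_eq_square del: power_Suc)
      also have "\<dots> = 0" by (rule elim(1))
      finally show ?thesis by (simp only: right_minus_eq)
    qed
    finally show ?case using elim by (simp add: field_simps)
  qed
  have iw_moderate: "moderate \<theta> (\<lambda>z. inverse (w1 z))"
  proof (rule moderate_cong)
    show "moderate \<theta> (\<lambda>z. E z * inverse (W z))"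
      by (intro moderate_mult moderate_E moderate_inverse[OF mod_W k])
    show "\<forall>\<^sub>F z in tubes \<theta>. E z * inverse (W z) = inverse (w1 z)"
      using W_eq by eventually_elim auto
  qed
  have Z_moderate: "moderate \<theta> Z"
  proof (rule moderate_cong)
    show "moderate \<theta> (\<lambda>z. - (s1 z + 2 * hc z) - inverse (w1 z) * X z)"
      unfolding X_def
      by (intro moderate_diff moderate_uminus moderate_add moderate_mult moderate_const mod_s1 mod_hc iw_moderate
          mod_v1 moderate_poly moderate_deriv h moderate_E2)
  qed (use Z_eq in \<open>auto elim: eventually_mono\<close>)
  then obtain j where j: "\<forall>\<^sub>F z in tubes \<theta>. Z analytic_on {z} \<and> norm (Z z) \<le> norm z ^ j \<and> norm z \<ge> 2"
    by (rule moderateE)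
  have lim_Z: "(Z \<longlongrightarrow> 0) (ray \<theta>)"
  \<comment> \<open>The rate is that of \<open>y1\<close>, which grows here; the polynomial bound on
    \<open>Z\<close> obtained from \<open>Z_eq\<close> rules out a growing solution.\<close>
  proof (rule ray_ode_unstable[where N = N and L = "real (Suc N) * a / 2"])
    have "\<forall>\<^sub>F z in tubes \<theta>. (Z has_field_derivative (s1 z - inverse (w1 z) * v1 z) * Z z + 2 * v1 z) (at z)"
      using w1_nz dw1_eq P1_nz
    proof eventually_elim
      case (elim z)
      have "(w1 has_field_derivative s1 z * w1 z + v1 z) (at z)"
        using analytic_has_field_derivative[OF w1_analytic] elim by metis
      hence "(Z has_field_derivative (s1 z * w1 z + v1 z) + (poly q1 z * E1 z * inverse (w1 z) +
          - (inverse (w1 z) * (s1 z * w1 z + v1 z) * inverse (w1 z)) * (poly P1 z * E1 z))) (at z)"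
        unfolding Z_def using elim by (intro DERIV_add DERIV_mult exp_poly_deriv DERIV_inverse') auto
      moreover have q1: "poly q1 z = 2 * s1 z * poly P1 z" using elim by (simp add: s1_def)
      ultimately show ?case
        using elim by (elim DERIV_cong) (simp add: Z_def q1 field_simps)
    qed
    thus "\<forall>\<^sub>F z in ray \<theta>. (Z has_field_derivative (s1 z - inverse (w1 z) * v1 z) * Z z + 2 * v1 z) (at z)"
      by (rule eventually_tubes_ray)
    have "((\<lambda>z. inverse (w1 z) * v1 z / z ^ N) \<longlongrightarrow> 0) (ray \<theta>)"
      by (intro tendsto_0_divide_power ray_le_at_infinity tendsto_mono[OF ray_le_tubes tiny_imp_tendsto] tiny_mult iw_tiny mod_v1)
    from tendsto_diff[OF lim_s1 this]
    show "((\<lambda>z. (s1 z - inverse (w1 z) * v1 z) / z ^ N) \<longlongrightarrow> of_real (real (Suc N) * a / 2)) (ray \<theta>)"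
      by (simp add: diff_divide_distrib)
    show "real (Suc N) * a / 2 * cos (real (Suc N) * \<theta>) > 0"
      using a by (simp add: mult.assoc del: of_nat_Suc)
    show "((\<lambda>z. 2 * v1 z / z ^ N) \<longlongrightarrow> 0) (ray \<theta>)"
      using tendsto_mult[OF tendsto_const[of 2] lim_v1] by simp
    show "\<forall>\<^sub>F z in ray \<theta>. norm (Z z) \<le> norm z ^ j"
      using eventually_tubes_ray[OF j] by eventually_elim auto
  qed
  have lim: "((\<lambda>z. (- (s1 z / z ^ N) - Z z / z ^ N - inverse (w1 z) * X z / z ^ N) / 2) \<longlongrightarrow>
      (- of_real (real (Suc N) * a / 2) - 0 - 0) / 2) (ray \<theta>)"
    by (intro tendsto_intros lim_s1 tendsto_0_divide_power ray_le_at_infinity lim_Z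
        tendsto_mono[OF ray_le_tubes tiny_imp_tendsto[OF X_tiny]]) auto
  have ev: "\<forall>\<^sub>F z in ray \<theta>. (- (s1 z / z ^ N) - Z z / z ^ N - inverse (w1 z) * X z / z ^ N) / 2 = (h z + poly c z) / z ^ N"
    using eventually_tubes_ray[OF Z_eq]
  proof eventually_elim
    case (elim z)
    show ?case
      unfolding elim by (simp add: hc_def add_divide_distrib diff_divide_distrib)
  qed
  show ?thesis using Lim_transform_eventually[OF lim ev] by simp
qed

end

section \<open>Canonical products with simple zeros\<close>

definition simple_zeros_entire :: "(complex \<Rightarrow> complex) \<Rightarrow> complex set \<Rightarrow> bool" where
  "simple_zeros_entire P Z \<longleftrightarrow> P holomorphic_on UNIV \<and> (\<forall>z. P z = 0 \<longleftrightarrow> z \<in> Z) \<and> (\<forall>z\<in>Z. deriv P z \<noteq> 0)"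

lemma simple_zeros_entire_linear_mult:
  assumes "simple_zeros_entire P Z" "a \<notin> Z"
  shows "simple_zeros_entire (\<lambda>z. (z - a) * P z) (insert a Z)"
    and "\<And>z. z \<noteq> a \<Longrightarrow> z \<notin> Z \<Longrightarrow> deriv (\<lambda>z. (z - a) * P z) z / ((z - a) * P z) = 1 / (z - a) + deriv P z / P z"
proof -
  have hol: "P holomorphic_on UNIV" using assms by (simp add: simple_zeros_entire_def)
  have der: "deriv (\<lambda>z. (z - a) * P z) z = P z + (z - a) * deriv P z" for z
    by (rule DERIV_imp_deriv) (auto intro!: derivative_eq_intros holomorphic_derivI[OF hol])
  show "simple_zeros_entire (\<lambda>z. (z - a) * P z) (insert a Z)"
    unfolding simple_zeros_entire_def der
  proof (intro conjI ballI allI)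
    fix z assume "z \<in> insert a Z"
    thus "P z + (z - a) * deriv P z \<noteq> 0"
    proof
      assume "z \<in> Z"
      hence "P z = 0" "deriv P z \<noteq> 0" "z \<noteq> a" using assms by (auto simp: simple_zeros_entire_def)
      thus ?thesis by simp
    qed (use assms in \<open>auto simp: simple_zeros_entire_def\<close>)
  qed (use assms in \<open>auto simp: simple_zeros_entire_def intro!: holomorphic_intros\<close>)
  fix z assume "z \<noteq> a" "z \<notin> Z"
  hence "P z \<noteq> 0" using assms by (auto simp: simple_zeros_entire_def)
  thus "deriv (\<lambda>z. (z - a) * P z) z / ((z - a) * P z) = 1 / (z - a) + deriv P z / P z"
    using \<open>z \<noteq> a\<close> unfolding der by (simp add: field_simps)
qed

lemma finite_product_exists:
  assumes "finite Z"
  shows "\<exists>P. simple_zeros_entire P Z \<and> finite_order P \<and>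
           (\<forall>z. z \<notin> Z \<longrightarrow> deriv P z / P z = (\<Sum>a\<in>Z. 1 / (z - a)))"
  using assms
proof (induction Z rule: finite_induct)
  case empty
  have "simple_zeros_entire (\<lambda>_. 1) {}" by (simp add: simple_zeros_entire_def)
  thus ?case using finite_order_const[of 1] by (intro exI[of _ "\<lambda>_. 1"]) auto
next
  case (insert a Z)
  then obtain P where P: "simple_zeros_entire P Z" "finite_order P"
    "\<And>z. z \<notin> Z \<Longrightarrow> deriv P z / P z = (\<Sum>a\<in>Z. 1 / (z - a))"
    by blast
  have "finite_order (\<lambda>z. (z + (- a)) * P z)"
    by (intro finite_order_mult finite_order_add finite_order_id finite_order_const P)
  thus ?case
    using simple_zeros_entire_linear_mult[OF P(1) insert.hyps(2)] P(3) insert.hyps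
    by (intro exI[of _ "\<lambda>z. (z - a) * P z"]) auto
qed

text \<open>The exponent differentiates to a geometric sum, which the factor \<open>1 - x\<close>
  collapses to a single power.\<close>

lemma weierstrass_factor_has_field_derivative:
  "(weierstrass_factor q has_field_derivative - (x ^ q * exp (\<Sum>k=1..q. x ^ k / of_nat k))) (at x)"
proof -
  have sum: "((\<lambda>x::complex. \<Sum>k=1..q. x ^ k / of_nat k) has_field_derivative (\<Sum>k=1..q. x ^ (k - 1))) (at x)"
    by (rule DERIV_sum) (auto intro!: derivative_eq_intros)
  have geo: "(1 - x) * (\<Sum>k=1..q. x ^ (k - 1)) = 1 - x ^ q"
  proof -
    have "(\<Sum>k=1..q. x ^ (k - 1)) = (\<Sum>k<q. x ^ k)"
      by (rule sum.reindex_bij_witness[of _ Suc "\<lambda>k. k - 1"]) auto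
    thus ?thesis by (simp add: sum_gp_strict[symmetric] one_diff_power_eq)
  qed
  have "((\<lambda>x. (1 - x) * exp (\<Sum>k=1..q. x ^ k / of_nat k)) has_field_derivative
      (- 1) * exp (\<Sum>k=1..q. x ^ k / of_nat k) + (exp (\<Sum>k=1..q. x ^ k / of_nat k) * (\<Sum>k=1..q. x ^ (k - 1))) * (1 - x)) (at x)"
    by (intro DERIV_mult DERIV_fun_exp sum) (auto intro!: derivative_eq_intros)
  also have "(- 1) * exp (\<Sum>k=1..q. x ^ k / of_nat k) + (exp (\<Sum>k=1..q. x ^ k / of_nat k) * (\<Sum>k=1..q. x ^ (k - 1))) * (1 - x)
     = exp (\<Sum>k=1..q. x ^ k / of_nat k) * ((1 - x) * (\<Sum>k=1..q. x ^ (k - 1)) - 1)"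
    by (simp add: algebra_simps)
  also have "\<dots> = - (x ^ q * exp (\<Sum>k=1..q. x ^ k / of_nat k))"
    unfolding geo by simp
  finally show ?thesis unfolding weierstrass_factor_def[abs_def] .
qed

text \<open>The closed form turns the logarithmic derivative of a product into a series whose terms
  are of size \<open>norm a ^ (- q - 1)\<close> for large \<open>a\<close>.\<close>

lemma weierstrass_factor_logderiv:
  assumes "a \<noteq> 0" "z \<noteq> a"
  shows "deriv (\<lambda>z. weierstrass_factor q (z / a)) z / weierstrass_factor q (z / a) = (z / a) ^ q / (z - a)"
proof -
  define S where "S = exp (\<Sum>k=1..q. (z / a) ^ k / of_nat k)"
  have S: "S \<noteq> 0" by (simp add: S_def)
  have "((\<lambda>z. weierstrass_factor q (z / a)) has_field_derivative - ((z / a) ^ q * S) * (1 / a)) (at z)"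
    unfolding S_def
    by (rule DERIV_chain2[OF weierstrass_factor_has_field_derivative])
       (use assms in \<open>auto intro!: derivative_eq_intros\<close>)
  hence "deriv (\<lambda>z. weierstrass_factor q (z / a)) z = - ((z / a) ^ q * S) * (1 / a)"
    by (rule DERIV_imp_deriv)
  moreover have "weierstrass_factor q (z / a) = (1 - z / a) * S"
    by (simp add: weierstrass_factor_def S_def)
  moreover have "(1 - z / a) * a = - (z - a)" using assms by (simp add: field_simps)
  ultimately have "deriv (\<lambda>z. weierstrass_factor q (z / a)) z / weierstrass_factor q (z / a) =
      - ((z / a) ^ q * S) / (- (z - a) * S)"
    by (metis (no_types, lifting) divide_divide_eq_left mult.assoc mult.commute mult.right_neutral times_divide_eq_right)
  also have "\<dots> = ((z / a) ^ q * S) / ((z - a) * S)"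
    by (simp only: mult_minus_left minus_divide_divide)
  also have "\<dots> = (z / a) ^ q / (z - a)" using S by simp
  finally show ?thesis .
qed

text \<open>Near 0 the factor differs from 1 by a multiple of \<open>norm x ^ (q + 1)\<close>. Away
  from 0 every power up to \<open>q\<close>, including \<open>norm x\<close> itself, is at most
  \<open>2 ^ q * norm x ^ q\<close>, so the factors of the product can be estimated
  termwise.\<close>

lemma weierstrass_factor_norm_le:
  assumes "q \<ge> 1"
  shows "norm (weierstrass_factor q x) \<le> exp ((3 + (real q + 1) * 2 ^ q) * norm x ^ q)"
proof (cases "norm x \<le> 1 / 2")
  case True
  have "norm (weierstrass_factor q x) \<le> 1 + norm (weierstrass_factor q x - 1)"
    using norm_triangle_ineq[of 1 "weierstrass_factor q x - 1"] by simp
  also have "\<dots> \<le> 1 + 3 * norm x ^ Suc q"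
    using weierstrass_factor_bound[OF True] by simp
  also have "\<dots> \<le> 1 + (3 + (real q + 1) * 2 ^ q) * norm x ^ q"
  proof -
    have "3 * (norm x ^ Suc q) \<le> 3 * (norm x ^ q)"
      using True by (intro mult_left_mono power_decreasing) auto
    also have "\<dots> \<le> (3 + (real q + 1) * 2 ^ q) * norm x ^ q"
      by (intro mult_right_mono) auto
    finally show ?thesis by simp
  qed
  also have "\<dots> \<le> exp ((3 + (real q + 1) * 2 ^ q) * norm x ^ q)" by (rule exp_ge_add_one_self)
  finally show ?thesis .
next
  case False
  have pow: "norm x ^ k \<le> 2 ^ q * norm x ^ q" if "k \<le> q" for k
  proof -
    have "1 \<le> (2 * norm x) ^ (q - k)" using False by (intro one_le_power) auto
    hence "norm x ^ k * 1 \<le> norm x ^ k * (2 * norm x) ^ (q - k)" by (intro mult_left_mono) auto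
    also have "\<dots> = 2 ^ (q - k) * norm x ^ q"
      using that by (simp add: power_mult_distrib flip: power_add)
    also have "\<dots> \<le> 2 ^ q * norm x ^ q" by (intro mult_right_mono power_increasing) auto
    finally show ?thesis by simp
  qed
  have "norm (weierstrass_factor q x) \<le> (1 + norm x) * exp (norm (\<Sum>k=1..q. x ^ k / of_nat k))"
    unfolding weierstrass_factor_def norm_mult
    using norm_triangle_ineq4[of 1 x] by (intro mult_mono norm_exp) auto
  also have "\<dots> \<le> exp (norm x) * exp (\<Sum>k=1..q. 2 ^ q * norm x ^ q)"
  proof (intro mult_mono exp_ge_add_one_self)
    have "norm (\<Sum>k=1..q. x ^ k / of_nat k) \<le> (\<Sum>k=1..q. 2 ^ q * norm x ^ q)"
    proof (rule sum_norm_le)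
      fix k assume k: "k \<in> {1..q}"
      have "norm (x ^ k / of_nat k) \<le> norm x ^ k"
        using k by (simp add: norm_divide norm_power divide_le_eq mult_le_cancel_left1)
      also have "\<dots> \<le> 2 ^ q * norm x ^ q" using pow k by auto
      finally show "norm (x ^ k / of_nat k) \<le> 2 ^ q * norm x ^ q" .
    qed
    thus "exp (norm (\<Sum>k=1..q. x ^ k / of_nat k)) \<le> exp (\<Sum>k=1..q. 2 ^ q * norm x ^ q)" by simp
  qed auto
  also have "\<dots> \<le> exp (2 ^ q * norm x ^ q) * exp (\<Sum>k=1..q. 2 ^ q * norm x ^ q)"
    using pow[of 1] assms by (intro mult_right_mono) auto
  also have "\<dots> = exp ((real q + 1) * 2 ^ q * norm x ^ q)"
    by (simp add: algebra_simps flip: exp_add)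
  also have "\<dots> \<le> exp ((3 + (real q + 1) * 2 ^ q) * norm x ^ q)"
    by (simp add: algebra_simps)
  finally show ?thesis .
qed

text \<open>If \<open>norm a \<ge> 2 * norm z\<close>, the denominator is at least 1. Otherwise
  \<open>norm a\<close> is bounded by \<open>2 * norm z\<close>, and the assumed distance is at
  least a negative power of \<open>norm z\<close>.\<close>

lemma good_point_term_bound:
  fixes z a :: complex
  assumes z: "norm z \<ge> 1" and \<eta>: "0 < \<eta>" "\<eta> \<le> 1" and a: "a \<noteq> 0" and good: "\<eta> / norm a ^ q \<le> norm (z - a)"
  shows "norm ((z / a) ^ q / (z - a)) \<le> 2 ^ q / \<eta> * norm z ^ (2 * q) * (1 / norm a ^ q)"
proof (cases "norm a \<ge> 2 * norm z")
  case True
  have "norm (z - a) \<ge> norm a - norm z"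
    using norm_triangle_ineq3[of a z] by (simp add: norm_minus_commute)
  hence ge: "norm (z - a) \<ge> 1" using True z by linarith
  have "norm ((z / a) ^ q / (z - a)) = norm z ^ q / norm a ^ q / norm (z - a)"
    by (simp only: norm_divide norm_power power_divide)
  also have "\<dots> \<le> norm z ^ q / norm a ^ q / 1"
    using ge by (intro divide_left_mono) auto
  also have "\<dots> = 1 * (norm z ^ q * (1 / norm a ^ q))" by simp
  also have "\<dots> \<le> 2 ^ q / \<eta> * (norm z ^ (2 * q) * (1 / norm a ^ q))"
  proof (intro mult_mono)
    have "\<eta> \<le> 2 ^ q" using \<eta> one_le_power[of "2::real" q] by linarith
    thus "1 \<le> 2 ^ q / \<eta>" using \<eta> by simp
    show "norm z ^ q \<le> norm z ^ (2 * q)" using z by (intro power_increasing) auto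
  qed (use \<eta> in auto)
  finally show ?thesis by (simp add: mult_ac)
next
  case False
  have z0: "z \<noteq> 0" using z by auto
  have ge: "norm (z - a) \<ge> \<eta> / (2 * norm z) ^ q"
  proof -
    have "norm a ^ q \<le> (2 * norm z) ^ q" using False by (intro power_mono) auto
    hence "\<eta> / (2 * norm z) ^ q \<le> \<eta> / norm a ^ q"
      using \<eta> a z0 by (intro divide_left_mono mult_pos_pos zero_less_power) auto
    thus ?thesis using good by linarith
  qed
  have pos: "\<eta> / (2 * norm z) ^ q > 0" using \<eta> z by (intro divide_pos_pos zero_less_power) auto
  have "norm ((z / a) ^ q / (z - a)) = norm z ^ q / norm a ^ q / norm (z - a)"
    by (simp only: norm_divide norm_power power_divide)
  also have "\<dots> \<le> norm z ^ q / norm a ^ q / (\<eta> / (2 * norm z) ^ q)"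
    using ge pos by (intro divide_left_mono mult_pos_pos) auto
  also have "\<dots> = 2 ^ q / \<eta> * (norm z ^ q * norm z ^ q) * (1 / norm a ^ q)"
    by (simp add: power_mult_distrib mult_ac)
  also have "norm z ^ q * norm z ^ q = norm z ^ (2 * q)"
    by (metis mult_2 power_add)
  finally show ?thesis .
qed

lemma zorder_1_imp_deriv_nonzero:
  assumes hol: "P holomorphic_on UNIV" and nz: "\<exists>w. P w \<noteq> 0" and ord: "zorder P a = 1"
  shows "deriv P a \<noteq> 0"
proof -
  define g where "g = zor_poly P a"
  obtain r where r: "r > 0" "g holomorphic_on cball a r"
    "\<And>w. w \<in> cball a r \<Longrightarrow> P w = g w * (w - a) ^ nat (zorder P a) \<and> g w \<noteq> 0"
    using zorder_exist_zero[OF hol open_UNIV connected_UNIV UNIV_I, where z = a] nz unfolding g_def by blast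
  have "g holomorphic_on ball a r" using r(2) by (rule holomorphic_on_subset) auto
  hence "(g has_field_derivative deriv g a) (at a)"
    using r(1) by (intro holomorphic_derivI[of _ "ball a r"]) auto
  hence "((\<lambda>w. g w * (w - a)) has_field_derivative g a) (at a)"
    by (auto intro!: derivative_eq_intros)
  moreover have ev: "\<forall>\<^sub>F w in nhds a. g w * (w - a) = P w"
    using eventually_nhds_in_open[of "ball a r" a] r(1)
    by (auto simp: ord r(3) elim!: eventually_mono)
  ultimately have "(P has_field_derivative g a) (at a)"
    using DERIV_cong_ev[OF refl ev refl] by blast
  hence "deriv P a = g a" by (rule DERIV_imp_deriv)
  thus ?thesis using r(1) r(3)[of a] by auto
qed

text \<open>A Weierstrass product of constant genus \<open>q\<close>: the sum of
  \<open>1 / norm a ^ q\<close> controls both \<open>log (norm P)\<close> by a multiple of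
  \<open>(2 + norm z) ^ q\<close> and, away from the zeros, the series for \<open>P' / P\<close>. A
  finite \<open>Z\<close> is treated apart, since the infinite product runs over a sequence tending
  to infinity.\<close>

lemma canonical_product_exists:
  assumes q: "q \<ge> 1" and sum: "(\<lambda>a. 1 / norm a ^ q) summable_on Z" and Z0: "0 \<notin> Z" and count: "countable Z"
  obtains P C where "simple_zeros_entire P Z" "finite_order P" "C \<ge> 0"
    "\<And>\<eta> z. 0 < \<eta> \<Longrightarrow> \<eta> \<le> 1 \<Longrightarrow> norm z \<ge> 1 \<Longrightarrow> (\<And>a. a \<in> Z \<Longrightarrow> \<eta> / norm a ^ q \<le> norm (z - a)) \<Longrightarrow>
       norm (deriv P z / P z) \<le> C / \<eta> * norm z ^ (2 * q)"
proof (cases "finite Z")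
  case True
  then obtain P where P: "simple_zeros_entire P Z" "finite_order P"
    "\<And>z. z \<notin> Z \<Longrightarrow> deriv P z / P z = (\<Sum>a\<in>Z. 1 / (z - a))"
    using finite_product_exists by blast
  show ?thesis
  proof (rule that[OF P(1,2), of "\<Sum>a\<in>Z. norm a ^ q"])
    fix \<eta> z assume \<eta>: "0 < \<eta>" "\<eta> \<le> 1" and z: "norm (z::complex) \<ge> 1" and good: "\<And>a. a \<in> Z \<Longrightarrow> \<eta> / norm a ^ q \<le> norm (z - a)"
    have pos: "\<eta> / norm a ^ q > 0" if "a \<in> Z" for a
    proof -
      have "norm a > 0" using that Z0 by auto
      thus ?thesis using \<eta> by (intro divide_pos_pos zero_less_power) auto
    qed
    have "z \<notin> Z" using good[of z] pos[of z] by auto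
    hence "norm (deriv P z / P z) \<le> (\<Sum>a\<in>Z. norm (1 / (z - a)))"
      unfolding P(3)[OF \<open>z \<notin> Z\<close>] by (intro norm_sum)
    also have "\<dots> \<le> (\<Sum>a\<in>Z. norm a ^ q / \<eta>)"
    proof (rule sum_mono)
      fix a assume a: "a \<in> Z"
      have "norm (1 / (z - a)) \<le> 1 / (\<eta> / norm a ^ q)"
        unfolding norm_divide using good[OF a] pos[OF a] by (intro frac_le) auto
      thus "norm (1 / (z - a)) \<le> norm a ^ q / \<eta>" by simp
    qed
    also have "\<dots> = (\<Sum>a\<in>Z. norm a ^ q) / \<eta> * 1" by (simp add: sum_divide_distrib)
    also have "\<dots> \<le> (\<Sum>a\<in>Z. norm a ^ q) / \<eta> * norm z ^ (2 * q)"
      using \<eta> z by (intro mult_left_mono one_le_power divide_nonneg_pos sum_nonneg) auto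
    finally show "norm (deriv P z / P z) \<le> (\<Sum>a\<in>Z. norm a ^ q) / \<eta> * norm z ^ (2 * q)" .
  qed (auto intro: sum_nonneg)
next
  case False
  define a where "a = from_nat_into Z"
  have bij: "bij_betw a UNIV Z" unfolding a_def by (rule bij_betw_from_nat_into[OF count False])
  have aZ: "a n \<in> Z" for n using bij by (auto simp: bij_betw_def)
  have a0: "a n \<noteq> 0" for n using aZ[of n] Z0 by auto
  have "(\<lambda>n. 1 / norm (a n) ^ q) summable_on UNIV"
    using summable_on_reindex_bij_betw[OF bij, of "\<lambda>a. 1 / norm a ^ q"] sum by simp
  hence summ: "summable (\<lambda>n. 1 / norm (a n) ^ q)" by (rule summable_on_imp_summable)
  have lim0: "(\<lambda>n. 1 / norm (a n) ^ q) \<longlonglongrightarrow> 0" by (rule summable_LIMSEQ_zero[OF summ])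
  have norm_a: "\<forall>\<^sub>F n in sequentially. norm (a n) \<ge> b" for b
  proof -
    define B where "B = \<bar>b\<bar> + 1"
    have B: "B > 0" by (simp add: B_def)
    have "\<forall>\<^sub>F n in sequentially. 1 / norm (a n) ^ q < 1 / B ^ q"
      using B by (intro order_tendstoD(2)[OF lim0]) auto
    thus ?thesis
    proof eventually_elim
      case (elim n)
      hence "B ^ q < norm (a n) ^ q"
        using B a0[of n] by (simp add: field_simps)
      hence "B < norm (a n)" using B by (meson norm_ge_zero power_less_imp_less_base)
      thus ?case by (simp add: B_def)
    qed
  qed
  have lim_a: "filterlim a at_infinity at_top"
    by (rule filterlim_norm_at_top_imp_at_infinity) (auto simp: filterlim_at_top norm_a)
  \<comment> \<open>Genus \<open>q\<close> calls for the exponent \<open>q + 1\<close>; as the zeros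
    tend to infinity this follows from summability with exponent \<open>q\<close>.\<close>
  have summ2: "summable (\<lambda>n. (r / norm (a n)) ^ Suc q)" if r: "r > 0" for r
  proof (rule summable_comparison_test_ev)
    show "summable (\<lambda>n. r ^ Suc q * (1 / norm (a n) ^ q))" by (intro summable_mult summ)
    show "\<forall>\<^sub>F n in sequentially. norm ((r / norm (a n)) ^ Suc q) \<le> r ^ Suc q * (1 / norm (a n) ^ q)"
      using norm_a[of 1]
    proof eventually_elim
      case (elim n)
      have "norm (a n) ^ q \<le> norm (a n) ^ Suc q" using elim by (intro power_increasing) auto
      hence "1 / norm (a n) ^ Suc q \<le> 1 / norm (a n) ^ q"
        using a0[of n] by (intro divide_left_mono mult_pos_pos zero_less_power) auto
      hence "r ^ Suc q * (1 / norm (a n) ^ Suc q) \<le> r ^ Suc q * (1 / norm (a n) ^ q)"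
        using r by (intro mult_left_mono) auto
      thus ?case using r by (simp add: power_divide del: power_Suc)
    qed
  qed
  interpret wp: weierstrass_product a "\<lambda>_. q"
    by unfold_locales (use a0 lim_a summ2 in auto)
  define P where "P = wp.f"
  define S where "S = (\<Sum>n. 1 / norm (a n) ^ q)"
  have S0: "S \<ge> 0" unfolding S_def by (intro suminf_nonneg summ) auto
  have hol: "P holomorphic_on UNIV" unfolding P_def by (rule wp.holomorphic)
  have zero: "P z = 0 \<longleftrightarrow> z \<in> Z" for z
    using bij by (auto simp: P_def wp.zero bij_betw_def)
  have P0: "P 0 \<noteq> 0" using Z0 zero by blast
  have simple: "deriv P z \<noteq> 0" if "z \<in> Z" for z
  proof (rule zorder_1_imp_deriv_nonzero[OF hol])
    have "z \<in> range a" using that bij by (simp add: bij_betw_def)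
    then obtain n where n: "z = a n" by blast
    have "a -` {z} = {n}" using bij n by (auto simp: bij_betw_def inj_def)
    thus "zorder P z = 1" unfolding P_def wp.zorder by simp
  qed (use P0 in auto)
  have ulim: "uniform_limit (cball 0 R) (\<lambda>N z. \<Prod>n<N. weierstrass_factor q (z / a n)) P sequentially" if "R > 0" for R
    unfolding P_def by (rule wp.uniform_limit[OF that])
  define K where "K = 3 + (real q + 1) * 2 ^ q"
  have K: "K \<ge> 0" by (simp add: K_def)
  have order: "finite_order P"
  proof (rule finite_orderI)
    fix z :: complex
    have lim: "(\<lambda>N. norm (\<Prod>n<N. weierstrass_factor q (z / a n))) \<longlonglongrightarrow> norm (P z)"
      by (intro tendsto_norm tendsto_uniform_limitI[OF ulim[of "norm z + 1"]]) (auto intro: add_nonneg_pos)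
    show "norm (P z) \<le> exp (K * S * (2 + norm z) ^ q)"
    proof (rule tendsto_upperbound[OF lim])
      show "\<forall>\<^sub>F N in sequentially. norm (\<Prod>n<N. weierstrass_factor q (z / a n)) \<le> exp (K * S * (2 + norm z) ^ q)"
      proof (intro always_eventually allI)
        fix N
        have "norm (\<Prod>n<N. weierstrass_factor q (z / a n)) \<le> (\<Prod>n<N. exp (K * norm (z / a n) ^ q))"
          unfolding prod_norm[symmetric] K_def
          by (intro prod_mono conjI norm_ge_zero weierstrass_factor_norm_le q)
        also have "\<dots> = exp (\<Sum>n<N. K * norm (z / a n) ^ q)" by (simp add: exp_sum)
        also have "(\<Sum>n<N. K * norm (z / a n) ^ q) = K * norm z ^ q * (\<Sum>n<N. 1 / norm (a n) ^ q)"
          by (simp add: sum_distrib_left norm_divide power_divide mult_ac)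
        also have "\<dots> \<le> K * (2 + norm z) ^ q * S"
          unfolding S_def using K summ
          by (intro mult_mono mult_left_mono power_mono sum_le_suminf) (auto intro!: sum_nonneg mult_nonneg_nonneg)
        finally show "norm (\<Prod>n<N. weierstrass_factor q (z / a n)) \<le> exp (K * S * (2 + norm z) ^ q)"
          by (simp add: mult_ac)
      qed
    qed auto
  qed
  show ?thesis
  proof (rule that[of P "2 ^ q * S"])
    show "simple_zeros_entire P Z" using hol zero simple by (auto simp: simple_zeros_entire_def)
    show "finite_order P" by (rule order)
    show "2 ^ q * S \<ge> 0" using S0 by simp
    fix \<eta> z assume \<eta>: "0 < \<eta>" "\<eta> \<le> 1" and z: "norm (z::complex) \<ge> 1" and good: "\<And>a. a \<in> Z \<Longrightarrow> \<eta> / norm a ^ q \<le> norm (z - a)"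
    have z_neq: "z \<noteq> a n" for n
    proof -
      have "\<eta> / norm (a n) ^ q > 0" using \<eta> a0[of n] by (intro divide_pos_pos zero_less_power) auto
      thus ?thesis using good[OF aZ[of n]] by auto
    qed
    hence "P z \<noteq> 0" using wp.zero by (auto simp: P_def)
    have "(\<lambda>k. deriv (\<lambda>z. weierstrass_factor q (z / a k)) z / weierstrass_factor q (z / a k)) sums (deriv P z / P z)"
    proof (rule logderiv_prodinf_complex_uniform_limit[where A = "ball 0 (norm z + 1)"])
      show "uniform_limit (ball 0 (norm z + 1)) (\<lambda>n x. \<Prod>k<n. weierstrass_factor q (x / a k)) P sequentially"
        by (rule uniform_limit_on_subset[OF ulim[of "norm z + 1"]]) (auto intro: add_nonneg_pos)
    qed (use \<open>P z \<noteq> 0\<close> a0 in \<open>auto intro!: holomorphic_intros\<close>)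
    hence "deriv P z / P z = (\<Sum>k. (z / a k) ^ q / (z - a k))"
      using a0 z_neq by (simp add: weierstrass_factor_logderiv sums_iff)
    also have "norm \<dots> \<le> (\<Sum>k. 2 ^ q / \<eta> * norm z ^ (2 * q) * (1 / norm (a k) ^ q))"
      by (intro norm_suminf_le good_point_term_bound z \<eta> a0 good aZ summable_mult summ)
    also have "\<dots> = 2 ^ q * S / \<eta> * norm z ^ (2 * q)"
      unfolding S_def by (subst suminf_mult[OF summ]) simp
    finally show "norm (deriv P z / P z) \<le> 2 ^ q * S / \<eta> * norm z ^ (2 * q)" .
  qed
qed

text \<open>The quotient \<open>u = f / H\<close> extends to an entire function without zeros, and
  \<open>w = u' / u\<close>. At a common simple zero numerator and denominator are replaced by
  difference quotients, which are holomorphic and do not vanish there.\<close>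

lemma entire_quotient:
  assumes f: "simple_zeros_entire f Z" and H: "simple_zeros_entire H Z"
  obtains w where "w holomorphic_on UNIV" "\<And>z. z \<notin> Z \<Longrightarrow> deriv f z / f z = w z + deriv H z / H z"
proof -
  have holf: "f holomorphic_on UNIV" and holH: "H holomorphic_on UNIV"
    using assms by (auto simp: simple_zeros_entire_def)
  have zf: "f z = 0 \<longleftrightarrow> z \<in> Z" and zH: "H z = 0 \<longleftrightarrow> z \<in> Z" for z
    using assms by (auto simp: simple_zeros_entire_def)
  have df: "z \<in> Z \<Longrightarrow> deriv f z \<noteq> 0" and dH: "z \<in> Z \<Longrightarrow> deriv H z \<noteq> 0" for z
    using assms by (auto simp: simple_zeros_entire_def)
  define u where "u z = (if z \<in> Z then deriv f z / deriv H z else f z / H z)" for z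
  have u_nz: "u z \<noteq> 0" for z using df dH zf zH by (auto simp: u_def)
  have f_eq: "f z = H z * u z" for z using zf[of z] zH[of z] by (cases "z \<in> Z") (simp_all add: u_def)
  have "u analytic_on {a}" for a
  proof (cases "a \<in> Z")
    case False
    have "f analytic_on {a}" "H analytic_on {a}"
      using holf holH by (metis UNIV_I analytic_at open_UNIV)+
    hence an: "(\<lambda>z. f z / H z) analytic_on {a}"
      using False zH by (intro analytic_intros) auto
    have "isCont H a" using holH by (metis UNIV_I continuous_on_eq_continuous_at holomorphic_on_imp_continuous_on open_UNIV)
    hence "\<forall>\<^sub>F z in nhds a. H z \<noteq> 0"
      using False zH unfolding continuous_within by (metis tendsto_imp_eventually_ne tendsto_at_iff_tendsto_nhds)
    hence "\<forall>\<^sub>F z in nhds a. f z / H z = u z"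
      by eventually_elim (use zH in \<open>auto simp: u_def\<close>)
    from analytic_at_cong[OF this refl] an show ?thesis by simp
  next
    case True
    define f1 where "f1 z = (if z = a then deriv f a else (f z - f a) / (z - a))" for z
    define H1 where "H1 z = (if z = a then deriv H a else (H z - H a) / (z - a))" for z
    have hol1: "f1 holomorphic_on UNIV" "H1 holomorphic_on UNIV"
      unfolding f1_def H1_def by (intro pole_lemma holf holH; simp)+
    hence "f1 analytic_on {a}" "H1 analytic_on {a}" by (metis UNIV_I analytic_at open_UNIV)+
    moreover have H1a: "H1 a \<noteq> 0" using dH[OF True] by (simp add: H1_def)
    ultimately have an: "(\<lambda>z. f1 z / H1 z) analytic_on {a}" by (intro analytic_intros) auto
    have "isCont H1 a" using hol1 by (metis UNIV_I continuous_on_eq_continuous_at holomorphic_on_imp_continuous_on open_UNIV)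
    hence "\<forall>\<^sub>F z in nhds a. H1 z \<noteq> 0"
      using H1a unfolding continuous_within by (metis tendsto_imp_eventually_ne tendsto_at_iff_tendsto_nhds)
    hence "\<forall>\<^sub>F z in nhds a. f1 z / H1 z = u z"
    proof eventually_elim
      case (elim z)
      show ?case
      proof (cases "z = a")
        case False
        have "f a = 0" "H a = 0" using True zf zH by auto
        moreover from this have "H z \<noteq> 0" using elim False by (auto simp: H1_def)
        moreover from this have "z \<notin> Z" using zH by blast
        ultimately show ?thesis using False by (simp add: f1_def H1_def u_def)
      qed (use True in \<open>auto simp: f1_def H1_def u_def\<close>)
    qed
    from analytic_at_cong[OF this refl] an show ?thesis by simp
  qed
  hence "u analytic_on UNIV" using analytic_on_analytic_at by blast
  hence holu: "u holomorphic_on UNIV" by (rule analytic_imp_holomorphic)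
  show ?thesis
  proof (rule that[of "\<lambda>z. deriv u z / u z"])
    show "(\<lambda>z. deriv u z / u z) holomorphic_on UNIV"
      using u_nz by (intro holomorphic_intros holu holomorphic_deriv) auto
    fix z assume z: "z \<notin> Z"
    have "f = (\<lambda>z. H z * u z)" using f_eq by (simp add: fun_eq_iff)
    hence "deriv f z = H z * deriv u z + deriv H z * u z"
      by (auto intro!: DERIV_imp_deriv derivative_eq_intros holomorphic_derivI[OF holH] holomorphic_derivI[OF holu])
    thus "deriv f z / f z = deriv u z / u z + deriv H z / H z"
      using f_eq[of z] z zH u_nz[of z] by (simp add: field_simps)
  qed
qed

section \<open>Zeros of the solution\<close>

text \<open>Differentiating the equation expresses each higher derivative at \<open>a\<close>
  through lower ones, so a double zero would make all derivatives vanish. Simplicity allows the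
  zeros to be handled as a plain set.\<close>

lemma linear_ode2_simple_zeros:
  assumes f: "f holomorphic_on UNIV" and A: "A holomorphic_on UNIV"
    and ode: "\<And>z. deriv (deriv f) z + A z * f z = 0"
    and nz: "\<exists>z. f z \<noteq> 0" and a: "f a = 0"
  shows "deriv f a \<noteq> 0"
proof
  assume da: "deriv f a = 0"
  have "(deriv ^^ n) f a = 0" for n
  proof (induction n rule: less_induct)
    case (less n)
    consider "n = 0" | "n = 1" | m where "n = Suc (Suc m)"
      by (metis One_nat_def not0_implies_Suc)
    thus ?case
    proof cases
      case 3
      have "deriv (deriv f) = (\<lambda>z. - A z * f z)"
        using ode by (simp add: fun_eq_iff eq_neg_iff_add_eq_0)
      hence "(deriv ^^ n) f a = (deriv ^^ m) (\<lambda>z. - A z * f z) a"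
        unfolding 3 by (simp add: funpow_swap1 del: funpow.simps) (simp add: funpow_swap1)
      also have "\<dots> = (\<Sum>i = 0..m. of_nat (m choose i) * (deriv ^^ i) (\<lambda>z. - A z) a * (deriv ^^ (m - i)) f a)"
        by (rule higher_deriv_mult[of _ UNIV]) (auto intro!: holomorphic_intros A f)
      also have "\<dots> = 0" using less 3 by (intro sum.neutral) auto
      finally show ?thesis .
    qed (use a da in auto)
  qed
  hence "f z = 0" for z
    using holomorphic_fun_eq_0_on_connected[OF f open_UNIV connected_UNIV, of a z] by auto
  thus False using nz by blast
qed

lemma zeros_bounded_away:
  assumes f: "f holomorphic_on UNIV" and nz: "\<exists>z. f z \<noteq> 0"
  obtains \<delta> where "\<delta> > 0" "\<And>a. f a = 0 \<Longrightarrow> a \<noteq> 0 \<Longrightarrow> norm a \<ge> \<delta>"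
proof (cases "f 0 = 0")
  case True
  obtain b where "f b \<noteq> 0" using nz by blast
  then obtain r where "r > 0" "\<And>z. z \<in> ball 0 r - {0} \<Longrightarrow> f z \<noteq> 0"
    using isolated_zeros[OF f open_UNIV connected_UNIV UNIV_I True UNIV_I] by blast
  thus ?thesis using that[of r] by force
next
  case False
  have "isCont f 0" using f by (metis UNIV_I continuous_on_eq_continuous_at holomorphic_on_imp_continuous_on open_UNIV)
  then obtain r where "r > 0" "\<And>z. dist 0 z < r \<Longrightarrow> f z \<noteq> 0"
    using continuous_at_avoid[of 0 f 0] False by blast
  thus ?thesis using that[of r] by force
qed

lemma zorder_pos_of_zero:
  assumes f: "f holomorphic_on UNIV" and nz: "\<exists>z. f z \<noteq> 0" and "f a = 0"
  shows "zorder f a > 0"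
  using zorder_exist_zero[OF f open_UNIV connected_UNIV UNIV_I, where z = a] assms by auto

text \<open>Orders of zeros are at least 1, so dropping them only lowers the sum; since nonzero
  zeros keep a distance \<open>\<delta>\<close> from 0, the real exponent can be raised to an
  integer at the cost of a constant.\<close>

lemma finite_convergence_exponent_imp_summable:
  assumes f: "f holomorphic_on UNIV" and nz: "\<exists>z. f z \<noteq> 0"
    and fin: "zeros_convergence_exponent f \<noteq> \<infinity>"
  obtains q :: nat where "q \<ge> 1" "(\<lambda>a. 1 / norm a ^ q) summable_on {z. f z = 0 \<and> z \<noteq> 0}"
proof -
  define Z where "Z = {z. f z = 0 \<and> z \<noteq> 0}"
  obtain s where s: "s > 0" "(\<lambda>z. of_int (zorder f z) * norm z powr (- s)) summable_on Z"
  proof (rule ccontr)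
    assume "\<not> thesis"
    hence eq: "{ereal s | s::real. s > 0 \<and> (\<lambda>z. of_int (zorder f z) * norm z powr (- s)) summable_on Z} = {}"
      using that by auto
    have "zeros_convergence_exponent f = Inf {}"
      unfolding zeros_convergence_exponent_def Z_def[symmetric] eq ..
    thus False using fin by (simp add: top_ereal_def)
  qed
  obtain \<delta> where \<delta>: "\<delta> > 0" "\<And>a. f a = 0 \<Longrightarrow> a \<noteq> 0 \<Longrightarrow> norm a \<ge> \<delta>"
    using zeros_bounded_away[OF f nz] by blast
  define q where "q = nat \<lceil>s\<rceil>"
  have q: "real q \<ge> s" "q \<ge> 1" using s(1) by (auto simp: q_def) linarith+
  have "(\<lambda>a. 1 / norm a ^ q) summable_on Z"
  proof (rule summable_on_comparison_test)
    show "(\<lambda>a. \<delta> powr (- (real q - s)) * (of_int (zorder f a) * norm a powr (- s))) summable_on Z"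
      by (intro summable_on_cmult_right s)
    fix a assume "a \<in> Z"
    hence a: "f a = 0" "a \<noteq> 0" by (auto simp: Z_def)
    have "1 / norm a ^ q = norm a powr (- real q)"
      using a by (simp add: powr_minus powr_realpow divide_inverse)
    also have "\<dots> = norm a powr (- (real q - s)) * norm a powr (- s)"
      by (simp flip: powr_add)
    also have "\<dots> \<le> \<delta> powr (- (real q - s)) * (of_int (zorder f a) * norm a powr (- s))"
    proof (intro mult_mono)
      show "norm a powr (- (real q - s)) \<le> \<delta> powr (- (real q - s))"
        using \<delta>(1) \<delta>(2)[OF a] q by (intro powr_mono2') auto
      have "1 \<le> real_of_int (zorder f a)" using zorder_pos_of_zero[OF f nz a(1)] by simp
      hence "1 * norm a powr (- s) \<le> of_int (zorder f a) * norm a powr (- s)"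
        by (intro mult_right_mono) auto
      thus "norm a powr (- s) \<le> of_int (zorder f a) * norm a powr (- s)" by simp
    qed auto
    finally show "1 / norm a ^ q \<le> \<delta> powr (- (real q - s)) * (of_int (zorder f a) * norm a powr (- s))" .
  qed auto
  thus ?thesis using that q unfolding Z_def by blast
qed

section \<open>Circles, rays and tubes that keep away from the zeros\<close>

text \<open>The excluded discs have summable radii, so \<open>exists_avoiding_point\<close> can
  escape them, and the radii shrink only polynomially, so \<open>H' / H\<close> stays polynomially
  bounded outside.\<close>

definition good_point :: "complex set \<Rightarrow> nat \<Rightarrow> real \<Rightarrow> complex \<Rightarrow> bool" where
  "good_point Z q \<eta> z \<longleftrightarrow> (\<forall>a\<in>Z. \<eta> / norm a ^ q \<le> norm (z - a))"

text \<open>For zeros with \<open>norm a \<le> 2 * norm z\<close> the displacement is at most half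
  the excluded radius. Farther zeros stay at distance at least 1/2 anyway, which exceeds their
  halved radius.\<close>

lemma good_point_nearby:
  assumes good: "good_point Z q \<eta> z" and \<eta>: "0 < \<eta>" "\<eta> \<le> 1" and z: "norm z \<ge> 1" and Z: "0 \<notin> Z"
    and y: "dist z y \<le> \<eta> / 2 / (2 * norm z) ^ q"
  shows "good_point Z q (\<eta> / 2) y"
  unfolding good_point_def
proof
  fix a assume a: "a \<in> Z"
  have a0: "a \<noteq> 0" using a Z by auto
  have tri: "norm (z - a) \<le> dist z y + norm (y - a)"
    using norm_triangle_ineq[of "z - y" "y - a"] by (simp add: dist_norm)
  show "\<eta> / 2 / norm a ^ q \<le> norm (y - a)"
  proof (cases "norm a \<le> 2 * norm z")
    case True
    have "\<eta> / 2 / (2 * norm z) ^ q \<le> \<eta> / 2 / norm a ^ q"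
      using \<eta> a0 True by (intro divide_left_mono mult_pos_pos zero_less_power power_mono) auto
    moreover have "\<eta> / norm a ^ q = \<eta> / 2 / norm a ^ q + \<eta> / 2 / norm a ^ q" by (simp flip: add_divide_distrib)
    moreover have "\<eta> / norm a ^ q \<le> norm (z - a)" using good a by (auto simp: good_point_def)
    ultimately show ?thesis using tri y by linarith
  next
    case False
    have "(2 * norm z) ^ q \<ge> 1" using z by (intro one_le_power) auto
    hence "\<eta> / 2 / (2 * norm z) ^ q \<le> \<eta> / 2 / 1"
      using \<eta> by (intro divide_left_mono) (auto simp del: power_mult_distrib)
    hence "dist z y \<le> 1 / 2" using y \<eta> by linarith
    moreover have "norm a - norm z \<le> norm (z - a)"
      using norm_triangle_ineq3[of a z] by (simp add: norm_minus_commute)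
    ultimately have "norm (y - a) \<ge> 1 / 2" using tri False z by linarith
    moreover have "norm a ^ q \<ge> 1" using False z by (intro one_le_power) auto
    hence "\<eta> / 2 / norm a ^ q \<le> \<eta> / 2 / 1"
      using \<eta> a0 by (intro divide_left_mono) auto
    ultimately show ?thesis using \<eta> by linarith
  qed
qed

text \<open>Zeros are projected to their absolute values; a radius off the projected intervals gives
  a circle off all discs.\<close>

lemma good_circles:
  assumes sum: "(\<lambda>a. 1 / norm a ^ q) summable_on Z" and Z: "0 \<notin> Z"
  obtains \<eta> where "0 < \<eta>" "\<eta> \<le> 1" "\<And>R. \<exists>r\<in>{R..R+1}. \<forall>z. norm z = r \<longrightarrow> good_point Z q \<eta> z"
proof -
  have "1 / norm a ^ q > 0" if "a \<in> Z" for a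
    using that Z by (intro divide_pos_pos zero_less_power) auto
  then obtain \<eta> where \<eta>: "0 < \<eta>" "\<eta> \<le> 1"
    "\<And>u X. \<exists>x\<in>{u..u+1}. \<forall>a\<in>Z. \<eta> * (1 / norm a ^ q) \<le> \<bar>x - X a\<bar>"
    using exists_avoiding_point[OF sum, of 1] by auto
  show ?thesis
  proof (rule that[OF \<eta>(1,2)])
    fix R :: real
    obtain r where r: "r \<in> {R..R+1}" "\<And>a. a \<in> Z \<Longrightarrow> \<eta> * (1 / norm a ^ q) \<le> \<bar>r - norm a\<bar>"
      using \<eta>(3)[of R norm] by blast
    have "good_point Z q \<eta> z" if "norm z = r" for z
      unfolding good_point_def
    proof
      fix a assume "a \<in> Z"
      thus "\<eta> / norm a ^ q \<le> norm (z - a)"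
        using r(2)[of a] norm_triangle_ineq3[of z a] that by simp
    qed
    thus "\<exists>r\<in>{R..R+1}. \<forall>z. norm z = r \<longrightarrow> good_point Z q \<eta> z" using r(1) by blast
  qed
qed

text \<open>The unit vectors \<open>a / norm a\<close> are projected onto a fixed axis, which
  replaces angles modulo \<open>2 * pi\<close> by a real coordinate and does not increase distances.
  A coordinate off the projected intervals is then the cosine of the angle between the ray and the
  axis.\<close>

lemma good_ray_exists:
  assumes sum: "(\<lambda>a. 1 / norm a ^ q) summable_on Z" and \<delta>: "\<delta> > 0" "\<And>a. a \<in> Z \<Longrightarrow> norm a \<ge> \<delta>"
    and \<theta>12: "\<theta>1 < \<theta>2"
  obtains \<theta> \<eta> where "\<theta> \<in> {\<theta>1<..<\<theta>2}" "0 < \<eta>" "\<eta> \<le> 1" "\<And>r. r \<ge> 0 \<Longrightarrow> good_point Z q \<eta> (of_real r * cis \<theta>)"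
proof -
  define mid \<epsilon> where "mid = (\<theta>1 + \<theta>2) / 2" and "\<epsilon> = min 1 ((\<theta>2 - \<theta>1) / 4)"
  have \<epsilon>: "0 < \<epsilon>" "\<epsilon> \<le> 1" "\<epsilon> < (\<theta>2 - \<theta>1) / 2" using \<theta>12 by (auto simp: \<epsilon>_def min_def)
  have pi1: "1 < pi / 2" using pi_gt3 by simp
  have sin_pos: "sin \<epsilon> > 0" using \<epsilon> pi1 by (intro sin_gt_zero) auto
  have "1 / norm a ^ q > 0" if "a \<in> Z" for a
    using \<delta>(1) \<delta>(2)[OF that] by (intro divide_pos_pos zero_less_power) auto
  then obtain \<eta>0 where \<eta>0: "0 < \<eta>0" "\<eta>0 \<le> 1"
    "\<And>u X. \<exists>x\<in>{u..u+2 * sin \<epsilon>}. \<forall>a\<in>Z. \<eta>0 * (1 / norm a ^ q) \<le> \<bar>x - X a\<bar>"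
    using exists_avoiding_point[OF sum, of "2 * sin \<epsilon>"] sin_pos by auto
  \<comment> \<open>The axis is perpendicular to the middle direction, so the coordinate 0
    corresponds to \<open>mid\<close>, and coordinates up to \<open>sin \<epsilon>\<close> in
    modulus to angles within \<open>\<epsilon>\<close> of it.\<close>
  define \<phi> where "\<phi> = mid - pi / 2"
  obtain x where x: "x \<in> {- sin \<epsilon>..sin \<epsilon>}"
    "\<And>a. a \<in> Z \<Longrightarrow> \<eta>0 * (1 / norm a ^ q) \<le> \<bar>x - Re (cis (- \<phi>) * (a / of_real (norm a)))\<bar>"
    using \<eta>0(3)[of "- sin \<epsilon>" "\<lambda>a. Re (cis (- \<phi>) * (a / of_real (norm a)))"] by auto
  have "- sin \<epsilon> \<le> x" "x \<le> sin \<epsilon>" using x(1) by auto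
  hence x1: "-1 \<le> x" "x \<le> 1" using sin_le_one[of \<epsilon>] by linarith+
  have "arcsin x \<le> arcsin (sin \<epsilon>)" "arcsin (sin (- \<epsilon>)) \<le> arcsin x"
    using x x1 by (auto intro!: arcsin_le_arcsin)
  hence arc: "\<bar>arcsin x\<bar> \<le> \<epsilon>"
    using \<epsilon> pi1 by (subst (asm) (1 2) arcsin_sin) auto
  define \<theta> where "\<theta> = mid - arcsin x"
  have "cos (\<theta> - \<phi>) = cos (pi / 2 - arcsin x)" by (simp add: \<theta>_def \<phi>_def)
  also have "\<dots> = x" using x1 by (simp add: cos_diff)
  finally have cos_x: "cos (\<theta> - \<phi>) = x" .
  \<comment> \<open>The 2 comes from replacing the point of the ray at radius \<open>norm a\<close>
    by an arbitrary one, and \<open>\<delta>\<close> bounds from below the factor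
    \<open>norm a\<close> gained when unit vectors are rescaled.\<close>
  define \<eta> where "\<eta> = min 1 (\<delta> * \<eta>0 / 2)"
  show ?thesis
  proof (rule that)
    show "\<theta> \<in> {\<theta>1<..<\<theta>2}" using arc \<epsilon> by (auto simp: \<theta>_def mid_def field_simps)
    show "0 < \<eta>" "\<eta> \<le> 1" using \<delta> \<eta>0 by (auto simp: \<eta>_def)
    fix r :: real assume r: "r \<ge> 0"
    show "good_point Z q \<eta> (of_real r * cis \<theta>)"
      unfolding good_point_def
    proof
      fix a assume a: "a \<in> Z"
      have na: "norm a > 0" using \<delta>(1) \<delta>(2)[OF a] by linarith
      define v where "v = a / of_real (norm a)"
      have "\<bar>x - Re (cis (- \<phi>) * v)\<bar> = \<bar>Re (cis (- \<phi>) * (cis \<theta> - v))\<bar>"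
        using cos_x by (simp add: right_diff_distrib cis_mult add.commute flip: cos_x)
      also have "\<dots> \<le> norm (cis (- \<phi>) * (cis \<theta> - v))" by (rule abs_Re_le_cmod)
      also have "\<dots> = norm (cis \<theta> - v)" by (simp add: norm_mult)
      finally have "\<eta>0 * (1 / norm a ^ q) \<le> norm (cis \<theta> - v)" using x(2)[OF a] by (simp add: v_def)
      hence "norm a * (\<eta>0 * (1 / norm a ^ q)) \<le> norm a * norm (cis \<theta> - v)"
        using na by (intro mult_left_mono) auto
      also have "\<dots> = norm (of_real (norm a) * (cis \<theta> - v))" by (simp add: norm_mult)
      also have "of_real (norm a) * (cis \<theta> - v) = of_real (norm a - r) * cis \<theta> + (of_real r * cis \<theta> - a)"
        using na by (simp add: v_def algebra_simps)
      also have "norm \<dots> \<le> norm (of_real (norm a - r) * cis \<theta>) + norm (of_real r * cis \<theta> - a)"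
        by (rule norm_triangle_ineq)
      also have "norm (of_real (norm a - r) * cis \<theta>) = \<bar>norm a - r\<bar>"
        by (simp add: norm_mult del: of_real_diff)
      also have "\<bar>norm a - r\<bar> \<le> norm (of_real r * cis \<theta> - a)"
        using norm_triangle_ineq3[of "of_real r * cis \<theta>" a] r by (simp add: norm_mult)
      finally have main: "norm a * (\<eta>0 * (1 / norm a ^ q)) \<le> 2 * norm (of_real r * cis \<theta> - a)" by simp
      have "\<eta> / norm a ^ q \<le> (\<delta> * \<eta>0 / 2) / norm a ^ q" by (intro divide_right_mono) (auto simp: \<eta>_def)
      also have "\<dots> \<le> (norm a * \<eta>0 / 2) / norm a ^ q"
        using \<delta>(2)[OF a] \<eta>0 by (intro divide_right_mono mult_right_mono) auto
      also have "\<dots> = norm a * (\<eta>0 * (1 / norm a ^ q)) / 2" by simp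
      also have "\<dots> \<le> norm (of_real r * cis \<theta> - a)"
      proof -
        have "X / 2 \<le> Y" if "X \<le> 2 * Y" for X Y :: real using that by simp
        from this[OF main] show ?thesis .
      qed
      finally show "\<eta> / norm a ^ q \<le> norm (of_real r * cis \<theta> - a)" .
    qed
  qed
qed

text \<open>Directions in which neither exponential dominates are isolated: where the cosine
  vanishes the sine does not, so a small shift leaves the zero, and continuity supplies an
  interval.\<close>

lemma cos_nonzero_subinterval:
  fixes n :: nat
  assumes n: "n > 0" and \<theta>12: "\<theta>1 < \<theta>2"
  obtains t1 t2 where "\<theta>1 \<le> t1" "t1 < t2" "t2 \<le> \<theta>2" "\<And>t. t \<in> {t1<..<t2} \<Longrightarrow> cos (real n * t) \<noteq> 0"
proof -
  define mid where "mid = (\<theta>1 + \<theta>2) / 2"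
  obtain p where p: "p \<in> {\<theta>1<..<\<theta>2}" "cos (real n * p) \<noteq> 0"
  proof (cases "cos (real n * mid) = 0")
    case False
    thus ?thesis using that[of mid] \<theta>12 by (auto simp: mid_def)
  next
    case True
    define t where "t = min ((\<theta>2 - \<theta>1) / 4) (1 / real n)"
    have t: "0 < t" using n \<theta>12 by (simp add: t_def)
    have t_le: "t \<le> (\<theta>2 - \<theta>1) / 4" "t \<le> 1 / real n" unfolding t_def by (rule min.cobounded1 min.cobounded2)+
    have "0 < real n * t" "real n * t \<le> 1" using n t t_le by (auto simp: field_simps)
    hence "sin (real n * t) > 0" using pi_gt3 by (intro sin_gt_zero) auto
    moreover have "sin (real n * mid) \<noteq> 0" using True sin_cos_squared_add[of "real n * mid"] by auto
    ultimately have "cos (real n * (mid + t)) \<noteq> 0" using True by (simp add: distrib_left cos_add)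
    thus ?thesis using that[of "mid + t"] t t_le \<theta>12 by (auto simp: mid_def field_simps)
  qed
  have "isCont (\<lambda>t. cos (real n * t)) p" by (intro continuous_intros)
  then obtain e where e: "e > 0" "\<And>t. dist p t < e \<Longrightarrow> cos (real n * t) \<noteq> 0"
    using continuous_at_avoid[of p "\<lambda>t. cos (real n * t)" 0] p(2) by blast
  show ?thesis
  proof (rule that[of "max \<theta>1 (p - e)" "min \<theta>2 (p + e)"])
    fix t assume "t \<in> {max \<theta>1 (p - e)<..<min \<theta>2 (p + e)}"
    hence "dist p t < e" by (auto simp: dist_real_def)
    thus "cos (real n * t) \<noteq> 0" by (rule e(2))
  qed (use p e in auto)
qed

lemma eventually_good_tubes:
  assumes good: "\<And>r. r \<ge> 0 \<Longrightarrow> good_point Z q \<eta> (of_real r * cis \<theta>)" and \<eta>: "0 < \<eta>" "\<eta> \<le> 1" and Z: "0 \<notin> Z"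
  shows "\<forall>\<^sub>F z in tubes \<theta>. good_point Z q (\<eta> / 2) z"
proof -
  \<comment> \<open>Ensures \<open>1 / r ^ k \<le> \<eta> / 2 / (2 * r) ^ q\<close> for
    \<open>r \<ge> k\<close>, so the tube lies within the discs where goodness persists with
    \<open>\<eta> / 2\<close>.\<close>
  define k where "k = max (q + 1) (nat \<lceil>2 ^ (q + 1) / \<eta>\<rceil>)"
  have k: "q + 1 \<le> k" "2 ^ (q + 1) / \<eta> \<le> real k" unfolding k_def by linarith+
  have "good_point Z q (\<eta> / 2) z" if z: "z \<in> tube \<theta> k" for z
  proof -
    obtain r where r: "r \<ge> real k + 3" "dist z (of_real r * cis \<theta>) < 1 / r ^ k" using z by (auto simp: tube_def)
    have r1: "r \<ge> 1" "r > 0" using r by auto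
    have "2 ^ (q + 1) / \<eta> * r ^ q \<le> r * r ^ q" using k r by (intro mult_right_mono) auto
    also have "\<dots> \<le> r ^ k" using k r1 power_increasing[of "q + 1" k r] by simp
    finally have "1 / r ^ k \<le> 1 / (2 ^ (q + 1) / \<eta> * r ^ q)"
      using \<eta> r1 by (intro divide_left_mono mult_pos_pos divide_pos_pos zero_less_power) auto
    also have "\<dots> = \<eta> / 2 / (2 * r) ^ q" using \<eta> by (simp add: power_mult_distrib)
    finally have "dist (of_real r * cis \<theta>) z \<le> \<eta> / 2 / (2 * norm (of_real r * cis \<theta>)) ^ q"
      using r r1 by (simp add: norm_mult dist_commute)
    thus ?thesis
      by (intro good_point_nearby[OF good[of r] \<eta> _ Z]) (use r1 in \<open>auto simp: norm_mult\<close>)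
  qed
  thus ?thesis by (auto simp: eventually_tubes)
qed

lemma poly_antiderivative_exists: "\<exists>p. pderiv p = c" for c :: "complex poly"
proof
  have sum: "pderiv (\<Sum>i\<in>S. f i) = (\<Sum>i\<in>S. pderiv (f i))" for S and f :: "nat \<Rightarrow> complex poly"
    by (induction S rule: infinite_finite_induct) (auto simp: pderiv_add)
  show "pderiv (\<Sum>i\<le>degree c. monom (coeff c i / of_nat (Suc i)) (Suc i)) = c"
    by (simp add: sum pderiv_monom poly_as_sum_of_monoms del: of_nat_Suc)
qed

lemma finite_orderE:
  assumes "finite_order G"
  obtains m where "\<And>z. norm (G z) \<le> exp ((2 + norm z) ^ m)"
  using assms unfolding finite_order_def by blast

section \<open>Factorization of the solution and growth of its entire part\<close>

lemma logderiv_riccati: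
  assumes f: "f holomorphic_on UNIV" and ode: "\<And>z. deriv (deriv f) z + A z * f z = 0" and nz: "f z \<noteq> 0"
  shows "(\<lambda>z. deriv f z / f z) analytic_on {z}"
    and "deriv (\<lambda>z. deriv f z / f z) z + (deriv f z / f z)\<^sup>2 + A z = 0"
proof -
  have an: "f analytic_on {z}" using f by (metis UNIV_I analytic_at open_UNIV)
  show "(\<lambda>z. deriv f z / f z) analytic_on {z}"
    using nz by (intro analytic_on_divide analytic_deriv an) auto
  have "deriv (\<lambda>z. deriv f z / f z) z = (deriv (deriv f) z * f z - deriv f z * deriv f z) / (f z * f z)"
    by (intro DERIV_imp_deriv DERIV_divide analytic_has_field_derivative analytic_deriv an nz)
  moreover have "deriv (deriv f) z = - A z * f z" using ode[of z] by (simp add: eq_neg_iff_add_eq_0)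
  ultimately show "deriv (\<lambda>z. deriv f z / f z) z + (deriv f z / f z)\<^sup>2 + A z = 0"
    using nz by (simp add: power2_eq_square field_simps)
qed

text \<open>The canonical product covers the nonzero zeros; a zero at the origin is added as a
  factor \<open>z\<close>, whose logarithmic derivative \<open>1 / z\<close> accounts for the
  \<open>C + 1\<close> in the bound.\<close>

lemma canonical_factorization:
  assumes f: "f holomorphic_on UNIV" and simple: "\<And>z. f z = 0 \<Longrightarrow> deriv f z \<noteq> 0" and nz: "\<exists>z. f z \<noteq> 0"
    and q: "q \<ge> 1" and sum: "(\<lambda>a. 1 / norm a ^ q) summable_on {z. f z = 0 \<and> z \<noteq> 0}"
  obtains w H C where "w holomorphic_on UNIV" "H holomorphic_on UNIV" "finite_order H" "C \<ge> 0"
    "\<And>z. H z = 0 \<longleftrightarrow> f z = 0"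
    "\<And>z. f z \<noteq> 0 \<Longrightarrow> deriv f z / f z = w z + deriv H z / H z"
    "\<And>\<eta> z. 0 < \<eta> \<Longrightarrow> \<eta> \<le> 1 \<Longrightarrow> norm z \<ge> 1 \<Longrightarrow> good_point {z. f z = 0 \<and> z \<noteq> 0} q \<eta> z \<Longrightarrow>
       norm (deriv H z / H z) \<le> C / \<eta> * norm z ^ (2 * q)"
proof -
  define Z where "Z = {z. f z = 0 \<and> z \<noteq> 0}"
  have Z0: "0 \<notin> Z" by (simp add: Z_def)
  have "countable {a\<in>Z. 1 / norm a ^ q \<noteq> 0}"
    by (rule abs_summable_countable) (use sum in \<open>simp add: Z_def\<close>)
  also have "{a\<in>Z. 1 / norm a ^ q \<noteq> 0} = Z" by (auto simp: Z_def)
  finally have count: "countable Z" .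
  obtain P C where P: "simple_zeros_entire P Z" "finite_order P" "C \<ge> 0"
    "\<And>\<eta> z. 0 < \<eta> \<Longrightarrow> \<eta> \<le> 1 \<Longrightarrow> norm z \<ge> 1 \<Longrightarrow> (\<And>a. a \<in> Z \<Longrightarrow> \<eta> / norm a ^ q \<le> norm (z - a)) \<Longrightarrow>
       norm (deriv P z / P z) \<le> C / \<eta> * norm z ^ (2 * q)"
    using canonical_product_exists[OF q sum[folded Z_def] Z0 count] by blast
  define N where "N = {z. f z = 0}"
  have f_simple: "simple_zeros_entire f N"
    using f simple by (simp add: simple_zeros_entire_def N_def)
  obtain H where H: "simple_zeros_entire H N" "finite_order H"
    "\<And>\<eta> z. 0 < \<eta> \<Longrightarrow> \<eta> \<le> 1 \<Longrightarrow> norm z \<ge> 1 \<Longrightarrow> good_point Z q \<eta> z \<Longrightarrow>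
       norm (deriv H z / H z) \<le> (C + 1) / \<eta> * norm z ^ (2 * q)"
  proof (cases "f 0 = 0")
    case False
    hence "N = Z" by (auto simp: N_def Z_def)
    show ?thesis
    proof (rule that[of P])
      fix \<eta> z assume *: "0 < \<eta>" "\<eta> \<le> 1" "norm (z::complex) \<ge> 1" "good_point Z q \<eta> z"
      have "norm (deriv P z / P z) \<le> C / \<eta> * norm z ^ (2 * q)"
        using * by (intro P(4)) (auto simp: good_point_def)
      also have "\<dots> \<le> (C + 1) / \<eta> * norm z ^ (2 * q)"
        using * by (intro mult_right_mono divide_right_mono) auto
      finally show "norm (deriv P z / P z) \<le> (C + 1) / \<eta> * norm z ^ (2 * q)" .
    qed (use P \<open>N = Z\<close> in auto)
  next
    case True
    hence N: "N = insert 0 Z" by (auto simp: N_def Z_def)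
    note lin = simple_zeros_entire_linear_mult[OF P(1) Z0]
    show ?thesis
    proof (rule that[of "\<lambda>z. (z - 0) * P z"])
      show "simple_zeros_entire (\<lambda>z. (z - 0) * P z) N" using lin(1) N by simp
      show "finite_order (\<lambda>z. (z - 0) * P z)"
        using finite_order_mult[OF finite_order_id P(2)] by simp
      fix \<eta> z assume *: "0 < \<eta>" "\<eta> \<le> 1" "norm (z::complex) \<ge> 1" "good_point Z q \<eta> z"
      have z: "z \<noteq> 0" using * by auto
      have "z \<notin> Z"
      proof
        assume "z \<in> Z"
        hence "\<eta> / norm z ^ q \<le> 0" using *(4) by (auto simp: good_point_def)
        moreover have "\<eta> / norm z ^ q > 0" using * z by (intro divide_pos_pos zero_less_power) auto
        ultimately show False by simp
      qed
      have n1: "norm z ^ (2 * q) \<ge> 1" using * by (intro one_le_power) auto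
      have "norm (deriv (\<lambda>z. (z - 0) * P z) z / ((z - 0) * P z)) = norm (1 / (z - 0) + deriv P z / P z)"
        by (subst lin(2)[OF z \<open>z \<notin> Z\<close>]) (rule refl)
      also have "\<dots> \<le> norm (1 / (z - 0)) + norm (deriv P z / P z)" by (rule norm_triangle_ineq)
      also have "norm (deriv P z / P z) \<le> C / \<eta> * norm z ^ (2 * q)"
        using * by (intro P(4)) (auto simp: good_point_def)
      also have "norm (1 / (z - 0)) \<le> 1" using * by (simp add: norm_divide divide_le_eq)
      also have "1 \<le> 1 / \<eta> * norm z ^ (2 * q)"
      proof -
        have "1 * 1 \<le> 1 / \<eta> * norm z ^ (2 * q)" using * n1 by (intro mult_mono) auto
        thus ?thesis by simp
      qed
      also have "1 / \<eta> * norm z ^ (2 * q) + C / \<eta> * norm z ^ (2 * q) = (C + 1) / \<eta> * norm z ^ (2 * q)"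
        by (simp add: add_divide_distrib algebra_simps)
      finally show "norm (deriv (\<lambda>z. (z - 0) * P z) z / ((z - 0) * P z)) \<le> (C + 1) / \<eta> * norm z ^ (2 * q)"
        by simp
    qed
  qed
  obtain w where w: "w holomorphic_on UNIV" "\<And>z. z \<notin> N \<Longrightarrow> deriv f z / f z = w z + deriv H z / H z"
    using entire_quotient[OF f_simple H(1)] by blast
  show ?thesis
  proof (rule that[of w H "C + 1"])
    fix \<eta> z assume "0 < \<eta>" "\<eta> \<le> 1" "norm (z::complex) \<ge> 1" "good_point {z. f z = 0 \<and> z \<noteq> 0} q \<eta> z"
    thus "norm (deriv H z / H z) \<le> (C + 1) / \<eta> * norm z ^ (2 * q)"
      by (intro H(3)) (auto simp: Z_def)
  qed (use H w P(3) in \<open>auto simp: simple_zeros_entire_def N_def\<close>)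
qed

lemma good_point_nonzero:
  assumes "good_point {z. f z = 0 \<and> z \<noteq> 0} q \<eta> z" "\<eta> > 0" "z \<noteq> 0"
  shows "f z \<noteq> 0"
proof
  assume "f z = 0"
  hence "\<eta> / norm z ^ q \<le> 0" using assms by (auto simp: good_point_def)
  moreover have "\<eta> / norm z ^ q > 0" using assms by (intro divide_pos_pos zero_less_power) auto
  ultimately show False by simp
qed

text \<open>On circles that keep away from the zeros \<open>riccati_bound\<close> estimates
  \<open>f' / f\<close>, and the canonical product estimates \<open>h\<close>. Their difference is
  \<open>w\<close>, which is entire, so the maximum principle carries the bound to the disc.\<close>

lemma entire_part_finite_order:
  fixes f A w h :: "complex \<Rightarrow> complex"
  defines "Z \<equiv> {z. f z = 0 \<and> z \<noteq> 0}"
  assumes f: "f holomorphic_on UNIV" and ode: "\<And>z. deriv (deriv f) z + A z * f z = 0"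
    and A: "finite_order A" and sum: "(\<lambda>a. 1 / norm a ^ q) summable_on Z"
    and w: "w holomorphic_on UNIV" and C: "C \<ge> 0"
    and eq: "\<And>z. f z \<noteq> 0 \<Longrightarrow> deriv f z / f z = w z + h z"
    and h: "\<And>\<eta> z. 0 < \<eta> \<Longrightarrow> \<eta> \<le> 1 \<Longrightarrow> norm z \<ge> 1 \<Longrightarrow> good_point Z q \<eta> z \<Longrightarrow> norm (h z) \<le> C / \<eta> * norm z ^ (2 * q)"
  shows "finite_order w"
proof -
  have Z0: "0 \<notin> Z" by (simp add: Z_def)
  obtain m where m: "\<And>z. norm (A z) \<le> exp ((2 + norm z) ^ m)" using finite_orderE[OF A] by blast
  obtain \<eta> where \<eta>: "0 < \<eta>" "\<eta> \<le> 1" "\<And>R. \<exists>r\<in>{R..R+1}. \<forall>z. norm z = r \<longrightarrow> good_point Z q \<eta> z"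
    using good_circles[OF sum Z0] by blast
  define B where "B = 8 * 2 ^ q / \<eta> + 1 + C / \<eta>"
  have B: "B \<ge> 1" using \<eta> C by (simp add: B_def)
  define M where "M = 3 * m + 2 * q"
  have circle: "norm (w z) \<le> 8 * 2 ^ q / \<eta> * r ^ q + exp ((3 + r) ^ m) + C / \<eta> * r ^ (2 * q)"
    if z: "norm z = r" and r: "r \<ge> 2" and good: "good_point Z q \<eta> z" for z r
  proof -
    \<comment> \<open>On this disc all points remain good with \<open>\<eta> / 2\<close>, so
      \<open>f\<close> has no zeros there.\<close>
    define d where "d = \<eta> / 2 / (2 * r) ^ q"
    have d: "d > 0" unfolding d_def using \<eta> r by (intro divide_pos_pos zero_less_power) auto
    have "(2 * r) ^ q \<ge> 1" using r by (intro one_le_power) auto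
    hence "d \<le> \<eta> / 2 / 1" unfolding d_def using \<eta> by (intro divide_left_mono) auto
    hence d1: "d \<le> 1" using \<eta> by simp
    have ball: "f y \<noteq> 0 \<and> norm y \<le> r + 1" if y: "y \<in> ball z d" for y
    proof -
      have "good_point Z q (\<eta> / 2) y"
        using y z r by (intro good_point_nearby[OF good \<eta>(1,2) _ Z0]) (auto simp: d_def)
      moreover have "norm y \<le> norm z + dist z y" "norm z \<le> norm y + dist z y"
        using norm_triangle_ineq2[of y z] norm_triangle_ineq2[of z y] by (auto simp: dist_norm norm_minus_commute)
      moreover have "dist z y < d" using y by simp
      ultimately show ?thesis
        using good_point_nonzero[of f q "\<eta> / 2" y] \<eta> z r d1 unfolding Z_def by force
    qed
    have "norm (deriv f z / f z) \<le> 4 * 1 / d + 0 + exp ((3 + r) ^ m)"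
    proof (rule riccati_bound[where F = "\<lambda>z. deriv f z / f z"])
      have "(\<lambda>z. deriv f z / f z) analytic_on ball z d"
        using ball logderiv_riccati(1)[OF f ode] by (subst analytic_on_analytic_at) blast
      thus "(\<lambda>z. deriv f z / f z) holomorphic_on ball z d" by (rule analytic_imp_holomorphic)
      fix y assume y: "y \<in> ball z d"
      have "(2 + norm y) ^ m \<le> (3 + r) ^ m" using ball[OF y] by (intro power_mono) auto
      hence "norm (A y) \<le> exp ((3 + r) ^ m) * 1" using m[of y] by (simp add: order_trans)
      also have "\<dots> \<le> exp ((3 + r) ^ m) * exp ((3 + r) ^ m)" using r by (intro mult_left_mono) auto
      finally have "norm (A y) \<le> (exp ((3 + r) ^ m))\<^sup>2" by (simp add: power2_eq_square)
      moreover have "(deriv f y / f y)\<^sup>2 = - (deriv (\<lambda>z. deriv f z / f z) y + A y)"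
      proof -
        have "deriv (\<lambda>z. deriv f z / f z) y + (deriv f y / f y)\<^sup>2 + A y = 0"
          using ball[OF y] by (intro logderiv_riccati(2)[OF f ode]) auto
        thus ?thesis by (simp only: eq_neg_iff_add_eq_0 add_ac)
      qed
      hence "norm ((deriv f y / f y)\<^sup>2) \<le> norm (deriv (\<lambda>z. deriv f z / f z) y) + norm (A y)"
        by (simp only: norm_minus_cancel norm_triangle_ineq)
      ultimately show "(norm (deriv f y / f y))\<^sup>2 \<le> 1 * norm (deriv (\<lambda>z. deriv f z / f z) y) +
          0 * norm (deriv f y / f y) + (exp ((3 + r) ^ m))\<^sup>2"
        by (simp only: norm_power mult_1 mult_zero_left add_0_right)
    qed (use d in auto)
    moreover have "4 * 1 / d = 8 * 2 ^ q / \<eta> * r ^ q" by (simp add: d_def power_mult_distrib)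
    moreover have "w z = deriv f z / f z - h z" using eq[of z] ball[of z] d by simp
    hence "norm (w z) \<le> norm (deriv f z / f z) + norm (h z)" by (simp only: norm_triangle_ineq4)
    moreover have "norm (h z) \<le> C / \<eta> * r ^ (2 * q)"
      using h[OF \<eta>(1,2) _ good] z r by simp
    ultimately show ?thesis by linarith
  qed
  show ?thesis
  proof (rule finite_orderI)
    fix z :: complex
    define X where "X = 3 + norm z"
    have X: "X \<ge> 2" by (simp add: X_def)
    \<comment> \<open>The offset 2 gives \<open>r \<ge> 2\<close>, as \<open>circle\<close>
      requires, and \<open>r\<close> stays below \<open>X = 3 + norm z\<close>.\<close>
    obtain r where r: "r \<in> {norm z + 2..norm z + 3}" "\<And>z. norm z = r \<Longrightarrow> good_point Z q \<eta> z"
      using \<eta>(3)[of "norm z + 2"] by (auto simp: add.assoc)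
    have bound: "norm (w y) \<le> B * exp (X ^ M)" if y: "norm y \<le> X" "norm y \<ge> 2" "good_point Z q \<eta> y" for y
    proof -
      have X3: "3 + norm y \<le> X ^ 3"
      proof -
        have "3 + norm y \<le> X * 3" using y X by simp
        also have "\<dots> \<le> X * (X * X)"
          using X mult_mono[of 2 X 2 X] by (intro mult_left_mono) auto
        finally show ?thesis by (simp add: power3_eq_cube)
      qed
      have p: "exp (X ^ M) \<ge> X ^ M" using exp_ge_add_one_self[of "X ^ M"] by linarith
      have "norm y ^ q \<le> X ^ q" using y by (intro power_mono) auto
      also have "\<dots> \<le> X ^ M" using X by (intro power_increasing) (auto simp: M_def)
      finally have 1: "norm y ^ q \<le> exp (X ^ M)" using p by linarith
      have "norm y ^ (2 * q) \<le> X ^ (2 * q)" using y by (intro power_mono) auto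
      also have "\<dots> \<le> X ^ M" using X by (intro power_increasing) (auto simp: M_def)
      finally have 2: "norm y ^ (2 * q) \<le> exp (X ^ M)" using p by linarith
      have "(3 + norm y) ^ m \<le> (X ^ 3) ^ m" using X3 by (intro power_mono) auto
      also have "\<dots> = X ^ (3 * m)" by (simp only: power_mult)
      also have "\<dots> \<le> X ^ M" using X by (intro power_increasing) (auto simp: M_def)
      finally have 3: "exp ((3 + norm y) ^ m) \<le> exp (X ^ M)" by simp
      have "norm (w y) \<le> 8 * 2 ^ q / \<eta> * norm y ^ q + exp ((3 + norm y) ^ m) + C / \<eta> * norm y ^ (2 * q)"
        using y by (intro circle) auto
      also have "\<dots> \<le> 8 * 2 ^ q / \<eta> * exp (X ^ M) + exp (X ^ M) + C / \<eta> * exp (X ^ M)"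
        using 1 2 3 \<eta> C by (intro add_mono mult_left_mono) auto
      also have "\<dots> = B * exp (X ^ M)" by (simp add: B_def algebra_simps)
      finally show ?thesis .
    qed
    have r2: "r \<ge> 2" using r(1) norm_ge_zero[of z] unfolding atLeastAtMost_iff by linarith
    have "norm (w z) \<le> B * exp (X ^ M)"
    proof (rule maximum_modulus_frontier[of w "cball 0 r"])
      fix y assume "y \<in> frontier (cball (0::complex) r)"
      hence "norm y = r" using r2 by simp
      thus "norm (w y) \<le> B * exp (X ^ M)" using r r2 by (intro bound) (auto simp: X_def)
    qed (use r in \<open>auto intro!: holomorphic_on_imp_continuous_on holomorphic_on_subset[OF w]\<close>)
    also have "\<dots> \<le> exp (B * X ^ M) * exp (X ^ M)"
    proof (intro mult_right_mono)
      have "B * 1 \<le> B * X ^ M" using B X by (intro mult_left_mono one_le_power) auto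
      thus "B \<le> exp (B * X ^ M)" using exp_ge_add_one_self[of "B * X ^ M"] by linarith
    qed auto
    also have "\<dots> = exp ((B + 1) * X ^ M)" by (simp add: algebra_simps flip: exp_add)
    also have "\<dots> \<le> exp ((B + 1) * (2 + norm z) ^ (2 * M))"
    proof -
      have "X \<le> (2 + norm z)\<^sup>2" by (simp add: X_def power2_eq_square algebra_simps)
      hence "X ^ M \<le> ((2 + norm z)\<^sup>2) ^ M" using X by (intro power_mono) auto
      hence "X ^ M \<le> (2 + norm z) ^ (2 * M)" by (simp only: power_mult)
      thus ?thesis using B by simp
    qed
    finally show "norm (w z) \<le> exp ((B + 1) * (2 + norm z) ^ (2 * M))" .
  qed
qed

section \<open>The contradiction from a finite exponent\<close>

lemma tubes_moderate_imp_ray: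
  assumes "moderate \<theta> g"
  shows "\<exists>k. \<forall>\<^sub>F r in at_top. norm (g (of_real r * cis \<theta>)) \<le> r ^ k"
proof -
  obtain k where "\<forall>\<^sub>F z in tubes \<theta>. g analytic_on {z} \<and> norm (g z) \<le> norm z ^ k \<and> norm z \<ge> 2"
    using assms by (rule moderateE)
  from eventually_tubes_ray[OF this]
  have "\<forall>\<^sub>F r in at_top. norm (g (of_real r * cis \<theta>)) \<le> r ^ k"
    unfolding eventually_ray using eventually_gt_at_top[of 0]
    by eventually_elim (simp add: norm_mult)
  thus ?thesis by blast
qed

text \<open>The exponent is written \<open>Suc N\<close> because \<open>z ^ N\<close>, from
  differentiating the exponentials, sets the scale of all rates.\<close>

lemma no_finite_exponent_solution:
  fixes N :: nat and P1 P2 Q :: "complex poly" and \<zeta>1 \<zeta>2 :: real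
    and A f :: "complex \<Rightarrow> complex"
  assumes P1: "P1 \<noteq> 0" and P2: "P2 \<noteq> 0" and \<zeta>: "\<zeta>1 > 0" "\<zeta>2 < 0"
    and A: "\<And>z. A z = poly P1 z * exp (of_real \<zeta>1 * z ^ Suc N) + poly P2 z * exp (of_real \<zeta>2 * z ^ Suc N) + poly Q z"
    and f: "f holomorphic_on UNIV" and ode: "\<And>z. deriv (deriv f) z + A z * f z = 0" and nz: "\<exists>z. f z \<noteq> 0"
    and q: "q \<ge> 1" and sum: "(\<lambda>a. 1 / norm a ^ q) summable_on {z. f z = 0 \<and> z \<noteq> 0}"
  shows False
proof -
  define Z where "Z = {z. f z = 0 \<and> z \<noteq> 0}"
  have Z0: "0 \<notin> Z" by (simp add: Z_def)
  have monom: "of_real c * z ^ Suc N = poly (monom (of_real c) (Suc N)) z" for c and z :: complex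
    by (simp add: poly_monom)
  have A_eq: "A = (\<lambda>z. poly P1 z * exp (poly (monom (of_real \<zeta>1) (Suc N)) z) + poly P2 z * exp (poly (monom (of_real \<zeta>2) (Suc N)) z) + poly Q z)"
    by (rule ext) (simp only: A monom)
  have A_hol: "A holomorphic_on UNIV"
    unfolding A_eq by (intro holomorphic_intros holomorphic_on_poly)
  have A_ord: "finite_order A"
    unfolding A_eq by (intro finite_order_add finite_order_mult finite_order_poly finite_order_exp_poly)
  have simple: "\<And>z. f z = 0 \<Longrightarrow> deriv f z \<noteq> 0"
    by (rule linear_ode2_simple_zeros[OF f A_hol ode nz])
  obtain w H C where w: "w holomorphic_on UNIV" and H: "H holomorphic_on UNIV" "finite_order H" and C: "C \<ge> 0"
    and Hz: "\<And>z. H z = 0 \<longleftrightarrow> f z = 0"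
    and eq: "\<And>z. f z \<noteq> 0 \<Longrightarrow> deriv f z / f z = w z + deriv H z / H z"
    and h_bound: "\<And>\<eta> z. 0 < \<eta> \<Longrightarrow> \<eta> \<le> 1 \<Longrightarrow> norm z \<ge> 1 \<Longrightarrow> good_point Z q \<eta> z \<Longrightarrow>
       norm (deriv H z / H z) \<le> C / \<eta> * norm z ^ (2 * q)"
    unfolding Z_def using canonical_factorization[OF f simple nz q sum] by blast
  define F h where "F z = deriv f z / f z" and "h z = deriv H z / H z" for z
  have w_ord: "finite_order w"
    by (rule entire_part_finite_order[OF f ode A_ord sum w C eq h_bound[unfolded Z_def]])
  obtain \<delta> where \<delta>0: "\<delta> > 0" "\<And>a. f a = 0 \<Longrightarrow> a \<noteq> 0 \<Longrightarrow> norm a \<ge> \<delta>"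
    using zeros_bounded_away[OF f nz] by blast
  have \<delta>: "\<delta> > 0" "\<And>a. a \<in> Z \<Longrightarrow> norm a \<ge> \<delta>"
    using \<delta>0 by (auto simp: Z_def)

  \<comment> \<open>The order of the two exponentials is left open: the one that grows along the ray
    comes first.\<close>
  define regular where "regular \<theta> \<longleftrightarrow> (\<forall>\<^sub>F z in tubes \<theta>. f z \<noteq> 0) \<and>
    (riccati_ray \<theta> N \<zeta>1 \<zeta>2 P1 P2 Q F h w \<or> riccati_ray \<theta> N \<zeta>2 \<zeta>1 P2 P1 Q F h w)" for \<theta>
  have rays: "\<exists>\<theta>\<in>{\<theta>1<..<\<theta>2}. regular \<theta>"
    if \<theta>12: "\<theta>1 < \<theta>2" for \<theta>1 \<theta>2
  proof -
    obtain t1 t2 where t: "\<theta>1 \<le> t1" "t1 < t2" "t2 \<le> \<theta>2" "\<And>t. t \<in> {t1<..<t2} \<Longrightarrow> cos (real (Suc N) * t) \<noteq> 0"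
      using cos_nonzero_subinterval[OF zero_less_Suc[of N] \<theta>12] by blast
    obtain \<theta> \<eta> where \<theta>: "\<theta> \<in> {t1<..<t2}" and \<eta>: "0 < \<eta>" "\<eta> \<le> 1"
      and good: "\<And>r. r \<ge> 0 \<Longrightarrow> good_point Z q \<eta> (of_real r * cis \<theta>)"
      using good_ray_exists[OF sum[folded Z_def] \<delta> t(2)] by blast
    have ev: "\<forall>\<^sub>F z in tubes \<theta>. good_point Z q (\<eta> / 2) z \<and> norm z \<ge> 1"
      by (intro eventually_conj eventually_good_tubes[OF good \<eta> Z0] tubes_norm_ge)
    have nzero: "\<forall>\<^sub>F z in tubes \<theta>. f z \<noteq> 0"
      using ev
    proof eventually_elim
      case (elim z)
      hence "z \<noteq> 0" by auto
      thus ?case using elim good_point_nonzero[of f q "\<eta> / 2" z] \<eta> unfolding Z_def by auto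
    qed
    have F_an: "\<forall>\<^sub>F z in tubes \<theta>. F analytic_on {z}"
      using nzero unfolding F_def by eventually_elim (rule logderiv_riccati(1)[OF f ode])
    have ric: "\<forall>\<^sub>F z in tubes \<theta>. deriv F z + F z ^ 2 + A z = 0"
      using nzero unfolding F_def by eventually_elim (rule logderiv_riccati(2)[OF f ode])
    have h_mod: "moderate \<theta> h"
    proof (rule moderateI[where C = "C / (\<eta> / 2)" and k = "2 * q"])
      show "\<forall>\<^sub>F z in tubes \<theta>. h analytic_on {z} \<and> norm (h z) \<le> C / (\<eta> / 2) * norm z ^ (2 * q)"
        using ev nzero
      proof eventually_elim
        case (elim z)
        have "H analytic_on {z}" using H(1) by (metis UNIV_I analytic_at open_UNIV)
        hence "h analytic_on {z}"
          unfolding h_def using elim Hz by (intro analytic_on_divide analytic_deriv) auto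
        moreover have "norm (h z) \<le> C / (\<eta> / 2) * norm z ^ (2 * q)"
          unfolding h_def using elim \<eta> by (intro h_bound) auto
        ultimately show ?case by blast
      qed
    qed
    have F_eq: "\<forall>\<^sub>F z in tubes \<theta>. F z = w z + h z"
      using nzero unfolding F_def h_def by eventually_elim (rule eq)
    have "cos (real (Suc N) * \<theta>) \<noteq> 0" using t(4)[OF \<theta>] .
    hence "riccati_ray \<theta> N \<zeta>1 \<zeta>2 P1 P2 Q F h w \<or> riccati_ray \<theta> N \<zeta>2 \<zeta>1 P2 P1 Q F h w"
    proof (cases "cos (real (Suc N) * \<theta>) > 0")
      case True
      have "riccati_ray \<theta> N \<zeta>1 \<zeta>2 P1 P2 Q F h w"
        using True \<zeta> P1 P2 F_an ric[unfolded A] h_mod w F_eq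
        by unfold_locales (simp_all add: mult_neg_pos del: of_nat_Suc power_Suc)
      thus ?thesis ..
    next
      case False
      with \<open>cos (real (Suc N) * \<theta>) \<noteq> 0\<close> have neg: "cos (real (Suc N) * \<theta>) < 0" by linarith
      have "riccati_ray \<theta> N \<zeta>2 \<zeta>1 P2 P1 Q F h w"
        using neg \<zeta> P1 P2 F_an ric[unfolded A] h_mod w F_eq
        by unfold_locales (simp_all add: mult_neg_neg mult_pos_neg add.commute del: of_nat_Suc power_Suc)
      thus ?thesis ..
    qed
    hence "regular \<theta>" using nzero unfolding regular_def by blast
    thus ?thesis using \<theta> t by (intro bexI[of _ \<theta>]) auto
  qed

  \<comment> \<open>Fixed once in the order \<open>\<zeta>1\<close>, \<open>\<zeta>2\<close>: on
    rays with the opposite order the operator differs only by its sign.\<close>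
  define V where "V = wkb_V N \<zeta>1 \<zeta>2 P1 P2 w"
  have V_moderate: "moderate \<theta> V"
    if "regular \<theta>" for \<theta>
    using conjunct2[OF that[unfolded regular_def]]
  proof
    assume "riccati_ray \<theta> N \<zeta>2 \<zeta>1 P2 P1 Q F h w"
    hence "moderate \<theta> (\<lambda>z. - wkb_V N \<zeta>2 \<zeta>1 P2 P1 w z)"
      by (intro moderate_uminus riccati_ray.moderate_wkb_V)
    also have "(\<lambda>z. - wkb_V N \<zeta>2 \<zeta>1 P2 P1 w z) = V"
      by (simp add: V_def fun_eq_iff wkb_V_swap[of N \<zeta>2])
    finally show ?thesis .
  qed (auto simp: V_def intro: riccati_ray.moderate_wkb_V)
  obtain R where R: "\<And>z. V z = poly R z"
  proof (rule finite_order_imp_polynomial[of V])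
    have dw: "deriv w holomorphic_on UNIV" by (intro holomorphic_deriv w) auto
    have ddw: "deriv (deriv w) holomorphic_on UNIV" by (intro holomorphic_deriv dw) auto
    show "V holomorphic_on UNIV"
      unfolding V_def wkb_V_def[abs_def] by (intro holomorphic_intros holomorphic_on_poly w dw ddw)
    show "finite_order V"
      unfolding V_def wkb_V_def[abs_def]
      by (intro finite_order_add finite_order_mult finite_order_poly finite_order_deriv w dw w_ord)
    fix \<theta>1 \<theta>2 :: real assume "\<theta>1 < \<theta>2"
    from rays[OF this] show "\<exists>\<theta>\<in>{\<theta>1<..<\<theta>2}. \<exists>k. \<forall>\<^sub>F r in at_top. norm (V (of_real r * cis \<theta>)) \<le> r ^ k"
      using tubes_moderate_imp_ray[OF V_moderate] by blast
  qed (use that in blast)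
  define D where "D = 3 * N + 2 * degree P1 + 2 * degree P2"
  note lead = leading_wkb_k[OF leading_degree[of P1] leading_degree[of P2], of N \<zeta>1 \<zeta>2, folded D_def]
  have "of_nat (Suc N) ^ 3 * of_real (\<zeta>1 * \<zeta>2 * (\<zeta>2 - \<zeta>1)) * (lead_coeff P1)\<^sup>2 * (lead_coeff P2)\<^sup>2 \<noteq> (0::complex)"
    using \<zeta> P1 P2 by (simp del: of_nat_Suc)
  then obtain c where c: "leading (R - (wkb_k0 N \<zeta>1 \<zeta>2 P1 P2 * c + wkb_k1 N \<zeta>1 \<zeta>2 P1 P2 * pderiv c +
      wkb_k2 N \<zeta>1 \<zeta>2 P1 P2 * pderiv (pderiv c))) D 0"
    using linear_differential_division[OF lead(1) _ lead(2,3)] by blast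
  have asymp: "\<exists>a. a * cos (real (Suc N) * \<theta>) > 0 \<and> ((\<lambda>z. (h z + poly c z) / z ^ N) \<longlongrightarrow> of_real (- (real (Suc N) * a / 4))) (ray \<theta>)"
    if "regular \<theta>" for \<theta>
    using conjunct2[OF that[unfolded regular_def]]
  proof
    assume *: "riccati_ray \<theta> N \<zeta>1 \<zeta>2 P1 P2 Q F h w"
    show ?thesis
      using riccati_ray.h_asymptotics[OF * R[unfolded V_def] c[unfolded D_def]] riccati_ray.a[OF *] by blast
  next
    assume *: "riccati_ray \<theta> N \<zeta>2 \<zeta>1 P2 P1 Q F h w"
    have R': "wkb_V N \<zeta>2 \<zeta>1 P2 P1 w z = poly (- R) z" for z
      using R[of z] by (simp add: V_def wkb_V_swap[of N \<zeta>2])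
    have "leading (- R - (wkb_k0 N \<zeta>2 \<zeta>1 P2 P1 * c + wkb_k1 N \<zeta>2 \<zeta>1 P2 P1 * pderiv c +
      wkb_k2 N \<zeta>2 \<zeta>1 P2 P1 * pderiv (pderiv c))) D 0"
      \<comment> \<open>Exchanging the exponentials negates \<open>R\<close> and the operator
        together, so the same \<open>c\<close> solves the division problem in both orders.\<close>
      using leading_minus[OF c] by (simp add: wkb_k_swap[of N \<zeta>2] algebra_simps)
    hence "leading (- R - (wkb_k0 N \<zeta>2 \<zeta>1 P2 P1 * c + wkb_k1 N \<zeta>2 \<zeta>1 P2 P1 * pderiv c +
      wkb_k2 N \<zeta>2 \<zeta>1 P2 P1 * pderiv (pderiv c))) (3 * N + 2 * degree P2 + 2 * degree P1) 0"
      by (simp add: D_def add_ac)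
    from riccati_ray.h_asymptotics[OF * R' this] riccati_ray.a[OF *] show ?thesis by blast
  qed

  obtain e where e: "pderiv e = c" using poly_antiderivative_exists by blast
  \<comment> \<open>Chosen so that \<open>G' / G = h + c\<close>, whose limit relative to
    \<open>z ^ N\<close> is known on every regular ray.\<close>
  define G where "G z = H z * exp (poly e z)" for z
  have G_ray: "(G \<longlongrightarrow> 0) (ray \<theta>)"
    if \<theta>: "regular \<theta>" for \<theta>
  proof -
    obtain a where a: "a * cos (real (Suc N) * \<theta>) > 0"
      "((\<lambda>z. (h z + poly c z) / z ^ N) \<longlongrightarrow> of_real (- (real (Suc N) * a / 4))) (ray \<theta>)"
      using asymp[OF \<theta>] by blast
    have nzero: "\<forall>\<^sub>F z in ray \<theta>. H z \<noteq> 0"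
      using eventually_tubes_ray[OF conjunct1[OF \<theta>[unfolded regular_def]]] Hz by (auto elim: eventually_mono)
    show ?thesis
    proof (rule ray_ode_stable[OF _ a(2), where \<rho> = "\<lambda>_. 0"])
      show "\<forall>\<^sub>F z in ray \<theta>. (G has_field_derivative (h z + poly c z) * G z + 0) (at z)"
        using nzero
      proof eventually_elim
        case (elim z)
        have "(G has_field_derivative deriv H z * exp (poly e z) + (exp (poly e z) * poly c z) * H z) (at z)"
          unfolding G_def e[symmetric]
          by (intro DERIV_mult DERIV_fun_exp poly_DERIV holomorphic_derivI[OF H(1)]) auto
        thus ?case
          using elim by (elim DERIV_cong) (simp add: G_def h_def algebra_simps)
      qed
      \<comment> \<open>The growing exponential always has
        \<open>a * cos (Suc N * \<theta>) > 0\<close>, so \<open>G\<close> decays on rays of both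
        kinds.\<close>
      show "- (real (Suc N) * a / 4) * cos (real (Suc N) * \<theta>) < 0"
        using a(1) by (simp add: mult.assoc del: of_nat_Suc)
    qed auto
  qed
  obtain p where p: "\<And>z. G z = poly p z"
  proof (rule finite_order_imp_polynomial[of G])
    show "G holomorphic_on UNIV"
      unfolding G_def by (intro holomorphic_intros H holomorphic_on_poly)
    show "finite_order G"
      unfolding G_def by (intro finite_order_mult finite_order_exp_poly H)
    fix \<theta>1 \<theta>2 :: real assume "\<theta>1 < \<theta>2"
    then obtain \<theta> where \<theta>: "\<theta> \<in> {\<theta>1<..<\<theta>2}" "(G \<longlongrightarrow> 0) (ray \<theta>)"
      using rays G_ray by blast
    have "\<forall>\<^sub>F z in ray \<theta>. norm (G z) < 1"
      using order_tendstoD(2)[OF tendsto_norm_zero[OF \<theta>(2)], of 1] by simp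
    hence "\<forall>\<^sub>F r in at_top. norm (G (of_real r * cis \<theta>)) \<le> r ^ 0"
      unfolding eventually_ray by eventually_elim simp
    thus "\<exists>\<theta>\<in>{\<theta>1<..<\<theta>2}. \<exists>k. \<forall>\<^sub>F r in at_top. norm (G (of_real r * cis \<theta>)) \<le> r ^ k"
      using \<theta>(1) by blast
  qed (use that in blast)
  \<comment> \<open>A nonzero polynomial is bounded away from 0 near infinity, while
    \<open>G\<close> tends to 0 along some ray.\<close>
  have "p = 0"
  proof (rule ccontr)
    assume "p \<noteq> 0"
    then obtain k where k: "k > 0" "\<forall>\<^sub>F z in at_infinity. norm (poly p z) \<ge> k"
      using poly_bounded_below by blast
    obtain \<theta> where \<theta>: "(G \<longlongrightarrow> 0) (ray \<theta>)" using rays[of 0 1] G_ray by auto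
    have "\<forall>\<^sub>F z in ray \<theta>. norm (G z) < k"
      using order_tendstoD(2)[OF tendsto_norm_zero[OF \<theta>], of k] k by simp
    moreover have "\<forall>\<^sub>F z in ray \<theta>. norm (poly p z) \<ge> k"
      using k(2) ray_le_at_infinity filter_leD by blast
    ultimately have "\<forall>\<^sub>F z in ray \<theta>. False" by eventually_elim (simp add: p)
    thus False by simp
  qed
  hence "H z = 0" for z using p[of z] by (simp add: G_def)
  thus False using nz Hz by blast
qed

theorem corollary3:
  fixes n :: nat and P1 P2 Q :: "complex poly" and \<zeta>1 \<zeta>2 :: real
    and A f :: "complex \<Rightarrow> complex"
  assumes "n > 0"
    and "P1 \<noteq> 0" and "P2 \<noteq> 0"
    and "\<zeta>1 > 0" and "\<zeta>2 < 0"
    and "\<And>z. A z = poly P1 z * exp (of_real \<zeta>1 * z ^ n)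
                  + poly P2 z * exp (of_real \<zeta>2 * z ^ n) + poly Q z"
    and "f holomorphic_on UNIV"
    and "\<And>z. deriv (deriv f) z + A z * f z = 0"
    and "\<exists>z. f z \<noteq> 0"
  shows "zeros_convergence_exponent f = \<infinity>"
proof (rule ccontr)
  assume "zeros_convergence_exponent f \<noteq> \<infinity>"
  then obtain q :: nat where "q \<ge> 1" "(\<lambda>a. 1 / norm a ^ q) summable_on {z. f z = 0 \<and> z \<noteq> 0}"
    using finite_convergence_exponent_imp_summable assms(7,9) by blast
  moreover obtain N where "n = Suc N" using \<open>n > 0\<close> gr0_implies_Suc by blast
  ultimately show False
    using no_finite_exponent_solution[of P1 P2 \<zeta>1 \<zeta>2 A N Q f q] assms by blast
qed

end
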